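(* Let $\mathcal{M}$ be a type II$_1$ factor, $\mathcal{A}$ a masa in $\mathcal{M}$ and let $E$ be the trace preserving conditional expectation onto $\mathcal{A}$. Suppose that for every nonzero projection $P$ in $\mathcal{M}$, the restriction of $E$ to $P\mathcal{M}P$ has non-trivial kernel. Then, for every $n$-tuple $\mathbf{A} \in \mathcal{A}^n$ of hermitian operators with finite joint spectrum and every $n$-tuple $\mathbf{S} \in \mathcal{M}^n$ of commuting hermitian operators such that $\mathbf A\prec\mathbf S$, there is an element $\mathbf{T} \in \mathcal{O}(\mathbf{S})$ such that $$E(\mathbf{T}) = \mathbf{A}.$$
   Context: A masa is a maximal abelian self-adjoint subalgebra. A doubly stochastic map on $\mathcal M$ is a linear, unital, positive, trace preserving map $D:\mathcal M\to\mathcal M$. For $\mathbf A,\mathbf S\in\mathcal M^n$, $\mathbf A\prec\mathbf S$ means that there is a doubly stochastic map $D$ on $\mathcal M$ with $D(S_i)=A_i$ for $1\le i\le n$. Maps act on tuples entrywise. $\mathcal O(\mathbf S)$ is the closure of $\{(US_1U^*,\dots,US_nU^* ):U\in\mathcal M\text{ unitary}\}$ in the norm $\|\mathbf S\|=\max_i\|S_i\|$ (operator norm). *)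

theory Defs
  imports "HOL-Analysis.Analysis"
begin

text \<open>
  A complex Hilbert space is a real Hilbert space whose real structure (norm, topology, real inner
  product) is induced by a complex one. The complex inner product is linear in its first argument.
\<close>

class complex_hilbert = real_inner + complete_space +
  fixes scaleC :: "complex \<Rightarrow> 'a \<Rightarrow> 'a" (infixr "*\<^sub>C" 75)
    and cinner :: "'a \<Rightarrow> 'a \<Rightarrow> complex"
  assumes scaleC_add_right: "c *\<^sub>C (x + y) = c *\<^sub>C x + c *\<^sub>C y"
    and scaleC_add_left: "(c + d) *\<^sub>C x = c *\<^sub>C x + d *\<^sub>C x"
    and scaleC_scaleC: "c *\<^sub>C (d *\<^sub>C x) = (c * d) *\<^sub>C x"
    and scaleC_of_real: "complex_of_real r *\<^sub>C x = r *\<^sub>R x"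
    and cinner_commute: "cinner x y = cnj (cinner y x)"
    and cinner_add_left: "cinner (x + y) z = cinner x z + cinner y z"
    and cinner_scaleC_left: "cinner (c *\<^sub>C x) y = c * cinner x y"
    and Re_cinner: "Re (cinner x y) = inner x y"

lemma cinner_self: "cinner x x = complex_of_real ((norm x)\<^sup>2)"
proof -
  have "Im (cinner x x) = 0"
    using arg_cong[OF cinner_commute[of x x], of Im] by simp
  moreover have "Re (cinner x x) = (norm x)\<^sup>2"
    by (simp add: Re_cinner power2_norm_eq_inner)
  ultimately show ?thesis by (simp add: complex_eq_iff)
qed

lemma cinner_scaleC_right: "cinner x (c *\<^sub>C y) = cnj c * cinner x y"
  by (metis cinner_commute cinner_scaleC_left complex_cnj_mult)

lemma norm_scaleC: "norm (c *\<^sub>C x) = cmod c * norm x" for x :: "'a::complex_hilbert"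
proof -
  have "complex_of_real ((norm (c *\<^sub>C x))\<^sup>2) = c * cnj c * cinner x x"
    by (simp only: cinner_self[symmetric] cinner_scaleC_left cinner_scaleC_right mult.assoc mult.left_commute)
  also have "\<dots> = complex_of_real ((cmod c * norm x)\<^sup>2)"
    by (simp only: cinner_self complex_norm_square[symmetric] power_mult_distrib of_real_mult of_real_power)
  finally have "(norm (c *\<^sub>C x))\<^sup>2 = (cmod c * norm x)\<^sup>2"
    using of_real_eq_iff by blast
  then show ?thesis by (simp add: power2_eq_iff_nonneg)
qed

lemma bounded_linear_scaleC: "bounded_linear (\<lambda>x::'a::complex_hilbert. c *\<^sub>C x)"
proof (rule bounded_linear_intro[where K = "cmod c"])
  show "c *\<^sub>C (r *\<^sub>R x) = r *\<^sub>R (c *\<^sub>C x)" for r and x :: 'a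
    by (simp flip: scaleC_of_real add: scaleC_scaleC mult.commute)
qed (simp_all add: scaleC_add_right norm_scaleC mult.commute)

text \<open>
  Operators are elements of the type \<^typ>\<open>'h \<Rightarrow>\<^sub>L 'h\<close> of bounded real-linear maps, which carries the
  operator norm; \<open>cbounded_ops\<close> is the algebra $B(H)$ of the complex-linear ones.
\<close>

type_synonym 'h op = "'h \<Rightarrow>\<^sub>L 'h"

definition cbounded_ops :: "'h::complex_hilbert op set" where
  "cbounded_ops = {T :: 'h op. \<forall>c x. T (c *\<^sub>C x) = c *\<^sub>C T x}"

lift_definition scalar_op :: "complex \<Rightarrow> 'h::complex_hilbert op" is "\<lambda>c x. c *\<^sub>C x"
  by (rule bounded_linear_scaleC)

definition scaleC_op :: "complex \<Rightarrow> 'h::complex_hilbert op \<Rightarrow> 'h op" where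
  "scaleC_op c T = scalar_op c o\<^sub>L T"

text \<open>
  On \<open>cbounded_ops\<close> the adjoint exists (Riesz representation) and is unique; elsewhere the value
  is irrelevant.
\<close>

definition adj :: "'h::complex_hilbert op \<Rightarrow> 'h op" where
  "adj T = (THE S :: 'h op. \<forall>x y. cinner (T x) y = cinner x (S y))"

definition hermitian :: "'h::complex_hilbert op \<Rightarrow> bool" where
  "hermitian T \<longleftrightarrow> T \<in> cbounded_ops \<and> adj T = T"

definition positive_op :: "'h::complex_hilbert op \<Rightarrow> bool" where
  "positive_op T \<longleftrightarrow> hermitian T \<and> (\<forall>x. 0 \<le> Re (cinner (T x) x))"

definition projection :: "'h::complex_hilbert op \<Rightarrow> bool" where
  "projection P \<longleftrightarrow> hermitian P \<and> P o\<^sub>L P = P"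

definition unitary :: "'h::complex_hilbert op \<Rightarrow> bool" where
  "unitary U \<longleftrightarrow> U \<in> cbounded_ops \<and> adj U o\<^sub>L U = id_blinfun \<and> U o\<^sub>L adj U = id_blinfun"

definition commuting_set :: "'h::complex_hilbert op set \<Rightarrow> bool" where
  "commuting_set B \<longleftrightarrow> (\<forall>S\<in>B. \<forall>T\<in>B. S o\<^sub>L T = T o\<^sub>L S)"

definition star_subalgebra :: "'h::complex_hilbert op set \<Rightarrow> bool" where
  "star_subalgebra B \<longleftrightarrow> B \<subseteq> cbounded_ops \<and> 0 \<in> B \<and>
     (\<forall>S\<in>B. \<forall>T\<in>B. S + T \<in> B) \<and> (\<forall>c. \<forall>T\<in>B. scaleC_op c T \<in> B) \<and>
     (\<forall>S\<in>B. \<forall>T\<in>B. S o\<^sub>L T \<in> B) \<and> (\<forall>T\<in>B. adj T \<in> B)"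

definition commutant :: "'h::complex_hilbert op set \<Rightarrow> 'h op set" where
  "commutant B = {T \<in> cbounded_ops. \<forall>S\<in>B. T o\<^sub>L S = S o\<^sub>L T}"

definition von_neumann_algebra :: "'h::complex_hilbert op set \<Rightarrow> bool" where
  "von_neumann_algebra M \<longleftrightarrow> star_subalgebra M \<and> commutant (commutant M) = M"

definition factor :: "'h::complex_hilbert op set \<Rightarrow> bool" where
  "factor M \<longleftrightarrow> von_neumann_algebra M \<and> M \<inter> commutant M = range scalar_op"

definition corner :: "'h::complex_hilbert op set \<Rightarrow> 'h op \<Rightarrow> 'h op set" where
  "corner M P = {P o\<^sub>L X o\<^sub>L P | X. X \<in> M}"

definition abelian_projection :: "'h::complex_hilbert op set \<Rightarrow> 'h op \<Rightarrow> bool" where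
  "abelian_projection M P \<longleftrightarrow> P \<in> M \<and> projection P \<and> commuting_set (corner M P)"

text \<open>
  Murray--von Neumann equivalence. A projection is finite if it is not equivalent to a proper
  subprojection; for projections, $Q \le P$ means $PQ = Q$.
\<close>

definition equivalent_projections :: "'h::complex_hilbert op set \<Rightarrow> 'h op \<Rightarrow> 'h op \<Rightarrow> bool" where
  "equivalent_projections M P Q \<longleftrightarrow> (\<exists>V\<in>M. adj V o\<^sub>L V = P \<and> V o\<^sub>L adj V = Q)"

definition finite_projection :: "'h::complex_hilbert op set \<Rightarrow> 'h op \<Rightarrow> bool" where
  "finite_projection M P \<longleftrightarrow> P \<in> M \<and> projection P \<and>
     (\<forall>Q\<in>M. projection Q \<and> P o\<^sub>L Q = Q \<and> equivalent_projections M P Q \<longrightarrow> Q = P)"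

definition type_II1_factor :: "'h::complex_hilbert op set \<Rightarrow> bool" where
  "type_II1_factor M \<longleftrightarrow> factor M \<and> finite_projection M id_blinfun \<and>
     (\<forall>P. abelian_projection M P \<longrightarrow> P = 0)"

definition masa :: "'h::complex_hilbert op set \<Rightarrow> 'h op set \<Rightarrow> bool" where
  "masa M A \<longleftrightarrow> star_subalgebra A \<and> A \<subseteq> M \<and> commuting_set A \<and>
     (\<forall>B. star_subalgebra B \<and> B \<subseteq> M \<and> commuting_set B \<and> A \<subseteq> B \<longrightarrow> B = A)"

text \<open>Maps defined on an algebra \<open>M\<close> are total functions of which only the values on \<open>M\<close> matter.\<close>

definition linear_functional_on ::
    "'h::complex_hilbert op set \<Rightarrow> ('h op \<Rightarrow> complex) \<Rightarrow> bool" where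
  "linear_functional_on M f \<longleftrightarrow>
     (\<forall>S\<in>M. \<forall>T\<in>M. f (S + T) = f S + f T) \<and> (\<forall>c. \<forall>T\<in>M. f (scaleC_op c T) = c * f T)"

definition linear_map_on :: "'h::complex_hilbert op set \<Rightarrow> ('h op \<Rightarrow> 'h op) \<Rightarrow> bool" where
  "linear_map_on M F \<longleftrightarrow>
     (\<forall>S\<in>M. \<forall>T\<in>M. F (S + T) = F S + F T) \<and>
     (\<forall>c. \<forall>T\<in>M. F (scaleC_op c T) = scaleC_op c (F T))"

definition positive_map_on :: "'h::complex_hilbert op set \<Rightarrow> ('h op \<Rightarrow> 'h op) \<Rightarrow> bool" where
  "positive_map_on M F \<longleftrightarrow> (\<forall>T\<in>M. positive_op T \<longrightarrow> positive_op (F T))"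

definition tracial_state :: "'h::complex_hilbert op set \<Rightarrow> ('h op \<Rightarrow> complex) \<Rightarrow> bool" where
  "tracial_state M \<tau> \<longleftrightarrow> linear_functional_on M \<tau> \<and>
     (\<forall>T\<in>M. positive_op T \<longrightarrow> \<tau> T \<in> \<real> \<and> 0 \<le> Re (\<tau> T)) \<and>
     \<tau> id_blinfun = 1 \<and>
     (\<forall>S\<in>M. \<forall>T\<in>M. \<tau> (S o\<^sub>L T) = \<tau> (T o\<^sub>L S))"

definition faithful_on :: "'h::complex_hilbert op set \<Rightarrow> ('h op \<Rightarrow> complex) \<Rightarrow> bool" where
  "faithful_on M \<tau> \<longleftrightarrow> (\<forall>T\<in>M. positive_op T \<and> \<tau> T = 0 \<longrightarrow> T = 0)"

definition op_le :: "'h::complex_hilbert op \<Rightarrow> 'h op \<Rightarrow> bool" where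
  "op_le S T \<longleftrightarrow> positive_op (T - S)"

definition herm_lub_in :: "'h::complex_hilbert op set \<Rightarrow> 'h op set \<Rightarrow> 'h op \<Rightarrow> bool" where
  "herm_lub_in M F X \<longleftrightarrow> X \<in> M \<and> hermitian X \<and> (\<forall>T\<in>F. op_le T X) \<and>
     (\<forall>Y\<in>M. hermitian Y \<and> (\<forall>T\<in>F. op_le T Y) \<longrightarrow> op_le X Y)"

text \<open>A positive functional is normal if it preserves suprema of bounded upward directed families.\<close>

definition normal_on :: "'h::complex_hilbert op set \<Rightarrow> ('h op \<Rightarrow> complex) \<Rightarrow> bool" where
  "normal_on M \<tau> \<longleftrightarrow>
     (\<forall>F X. F \<subseteq> {T \<in> M. hermitian T} \<and> F \<noteq> {} \<and>
        (\<forall>S\<in>F. \<forall>T\<in>F. \<exists>R\<in>F. op_le S R \<and> op_le T R) \<and> herm_lub_in M F X \<longrightarrow>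
        Re (\<tau> X) = (SUP T\<in>F. Re (\<tau> T)))"

text \<open>On a type II$_1$ factor exactly one functional has these properties (any tracial state does).\<close>

definition is_trace :: "'h::complex_hilbert op set \<Rightarrow> ('h op \<Rightarrow> complex) \<Rightarrow> bool" where
  "is_trace M \<tau> \<longleftrightarrow> tracial_state M \<tau> \<and> faithful_on M \<tau> \<and> normal_on M \<tau>"

definition trace_preserving ::
    "'h::complex_hilbert op set \<Rightarrow> ('h op \<Rightarrow> complex) \<Rightarrow> ('h op \<Rightarrow> 'h op) \<Rightarrow> bool" where
  "trace_preserving M \<tau> F \<longleftrightarrow> (\<forall>T\<in>M. \<tau> (F T) = \<tau> T)"

definition conditional_expectation ::
    "'h::complex_hilbert op set \<Rightarrow> 'h op set \<Rightarrow> ('h op \<Rightarrow> 'h op) \<Rightarrow> bool" where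
  "conditional_expectation M A E \<longleftrightarrow>
     linear_map_on M E \<and> positive_map_on M E \<and> E ` M \<subseteq> A \<and> (\<forall>T\<in>A. E T = T) \<and>
     (\<forall>R\<in>A. \<forall>S\<in>A. \<forall>T\<in>M. E (R o\<^sub>L T o\<^sub>L S) = R o\<^sub>L E T o\<^sub>L S)"

definition doubly_stochastic ::
    "'h::complex_hilbert op set \<Rightarrow> ('h op \<Rightarrow> complex) \<Rightarrow> ('h op \<Rightarrow> 'h op) \<Rightarrow> bool" where
  "doubly_stochastic M \<tau> D \<longleftrightarrow>
     D ` M \<subseteq> M \<and> linear_map_on M D \<and> D id_blinfun = id_blinfun \<and>
     positive_map_on M D \<and> trace_preserving M \<tau> D"

definition majorized_by ::
    "'h::complex_hilbert op set \<Rightarrow> ('h op \<Rightarrow> complex) \<Rightarrow> ('n::finite \<Rightarrow> 'h op) \<Rightarrow> ('n \<Rightarrow> 'h op) \<Rightarrow> bool"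
  where
  "majorized_by M \<tau> A S \<longleftrightarrow> (\<exists>D. doubly_stochastic M \<tau> D \<and> (\<forall>i. D (S i) = A i))"

definition tuple_norm :: "('n::finite \<Rightarrow> 'h::complex_hilbert op) \<Rightarrow> real" where
  "tuple_norm S = Max (range (\<lambda>i. norm (S i)))"

definition unitary_orbit ::
    "'h::complex_hilbert op set \<Rightarrow> ('n::finite \<Rightarrow> 'h op) \<Rightarrow> ('n \<Rightarrow> 'h op) set" where
  "unitary_orbit M S = {(\<lambda>i. U o\<^sub>L S i o\<^sub>L adj U) | U. U \<in> M \<and> unitary U}"

definition unitary_orbit_closure ::
    "'h::complex_hilbert op set \<Rightarrow> ('n::finite \<Rightarrow> 'h op) \<Rightarrow> ('n \<Rightarrow> 'h op) set" where
  "unitary_orbit_closure M S =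
     {T. \<forall>\<epsilon>>0. \<exists>R\<in>unitary_orbit M S. tuple_norm (\<lambda>i. T i - R i) < \<epsilon>}"

text \<open>
  The joint spectrum of a commuting tuple of hermitian operators consists of the values of the
  tuple under the characters of the unital C*-algebra it generates.
\<close>

definition cstar_generated :: "'h::complex_hilbert op set \<Rightarrow> 'h op set" where
  "cstar_generated X = (\<lambda>B. star_subalgebra B \<and> id_blinfun \<in> B \<and> closed B) hull X"

definition character_on :: "'h::complex_hilbert op set \<Rightarrow> ('h op \<Rightarrow> complex) \<Rightarrow> bool" where
  "character_on B \<phi> \<longleftrightarrow> linear_functional_on B \<phi> \<and>
     (\<forall>S\<in>B. \<forall>T\<in>B. \<phi> (S o\<^sub>L T) = \<phi> S * \<phi> T) \<and> (\<exists>T\<in>B. \<phi> T \<noteq> 0)"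

definition joint_spectrum :: "('n::finite \<Rightarrow> 'h::complex_hilbert op) \<Rightarrow> ('n \<Rightarrow> complex) set" where
  "joint_spectrum A = {(\<lambda>i. \<phi> (A i)) | \<phi>. character_on (cstar_generated (range A)) \<phi>}"

end

theory Submission
  imports Defs
begin

text \<open>
  Since \<open>A\<close> has finite joint spectrum, \<open>A\<^sub>i = \<Sum>\<^sub>l l\<^sub>i P\<^sub>l\<close> with orthogonal projections \<open>P\<^sub>l\<close> in the masa, and \<open>D\<close>
  may be replaced by \<open>X \<mapsto> \<Sum>\<^sub>l \<omega>\<^sub>l(X) P\<^sub>l\<close> with the states \<open>\<omega>\<^sub>l(X) = \<tau>(P\<^sub>l D(X)) / \<tau>(P\<^sub>l)\<close>. Bisection by joint spectral
  projections of \<open>S\<close> yields a binary tree of projections \<open>C(b)\<close>, \<open>b\<close> a bit string. The hypothesis on \<open>E\<close> gives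
  the carpenter lemma: every projection \<open>p\<close> has for every \<open>t \<in> [0,1]\<close> a subprojection \<open>q\<close> with \<open>E q = t E p\<close>.
  Repeated splitting of \<open>P\<^sub>l\<close> produces a tree \<open>F\<^sub>l(b)\<close> with \<open>E (F\<^sub>l(b)) = \<omega>\<^sub>l(C(b)) P\<^sub>l\<close>. Then \<open>R(b) = \<Sum>\<^sub>l F\<^sub>l(b)\<close>
  has the trace of \<open>C(b)\<close>, so for each level a unitary of the factor maps the partition \<open>C\<close> to \<open>R\<close>.
  These unitaries transport step functions \<open>\<Sum>\<^sub>b \<mu>(b) C(b)\<close> converging to \<open>S\<close> in norm to step functions
  \<open>\<Sum>\<^sub>b \<mu>(b) R(b)\<close>, whose limit \<open>T\<close> lies in the closed unitary orbit and satisfies \<open>E (T\<^sub>i) = \<Sum>\<^sub>l \<omega>\<^sub>l(S\<^sub>i) P\<^sub>l = A\<^sub>i\<close>.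

  The carpenter lemma and the equivalence of projections of equal trace both come from extreme points of
  norm-bounded sets that are complete for the trace norm \<open>\<parallel>X\<parallel>\<^sub>2\<close>. Such points exist by a farthest point
  argument, which replaces weak compactness and the Krein--Milman theorem.
\<close>

text \<open>\<open>D\<close> enters only through the numbers \<open>\<omega> l X\<close>. As
  \<open>P l\<close> is an eigenprojection of each \<open>A i\<close>, majorization gives
  \<open>\<omega> l (S i) = l i\<close>, which fixes the expectation of the limit. As
  \<open>D\<close> preserves the trace, the \<open>\<omega> l X\<close> weighted by
  \<open>tr (P l)\<close> add up to \<open>tr X\<close>, which makes the traces of C(b) and R(b)
  agree. Finiteness of the joint spectrum reduces the prescribed expectation below each
  \<open>P l\<close> to scalar multiples of \<open>P l\<close>, the form that the carpenter lemma
  delivers. The obstacle is that each level has its own unitary and these unitaries are not known to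
  converge. The tree is nested so that a unitary adapted to one level also carries every coarser
  cell to its counterpart. Any two transported step functions are then conjugates of the original
  ones by one common unitary, and the Cauchy estimate passes from \<open>S\<close> to
  \<open>T\<close> in operator norm. Membership in \<open>M\<close> is always obtained from the
  bicommutant, and points of the joint spectrum come from approximate eigenvectors instead of
  Gelfand theory.\<close>

instance complex_hilbert \<subseteq> banach ..

subsection \<open>Orthogonal projections and adjoints\<close>

text \<open>A minimizing sequence is Cauchy by the parallelogram law, because midpoints stay in the
  subspace. The residual at its limit is orthogonal to \<open>V\<close>, since moving along any
  \<open>v\<close> cannot shorten it.\<close>

lemma closed_subspace_nearest_point:
  fixes V :: "'a::{real_inner,complete_space} set"
  assumes "closed V" "subspace V"
  shows "\<exists>p\<in>V. \<forall>v\<in>V. inner (x - p) v = 0"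
proof -
  define D where "D = (INF v\<in>V. (norm (x - v))\<^sup>2)"
  have V0: "0 \<in> V" using assms(2) by (rule subspace_0)
  have bdd: "bdd_below ((\<lambda>v. (norm (x - v))\<^sup>2) ` V)"
    by (rule bdd_belowI[where m = 0]) auto
  have D_le: "D \<le> (norm (x - v))\<^sup>2" if "v \<in> V" for v
    unfolding D_def using bdd that by (rule cINF_lower)
  have "\<exists>v\<in>V. (norm (x - v))\<^sup>2 < D + 1 / real (Suc n)" for n
  proof -
    have "D < D + 1 / real (Suc n)" by simp
    then have "\<exists>y \<in> (\<lambda>v. (norm (x - v))\<^sup>2) ` V. y < D + 1 / real (Suc n)"
      using V0 unfolding D_def by (intro cInf_lessD) auto
    then show ?thesis by blast
  qed
  then obtain u where u: "\<And>n. u n \<in> V" "\<And>n. (norm (x - u n))\<^sup>2 < D + 1 / real (Suc n)"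
    by metis
  have para: "(norm (u m - u n))\<^sup>2 \<le> 2 / real (Suc m) + 2 / real (Suc n)" for m n
  proof -
    have "(1/2) *\<^sub>R (u m + u n) \<in> V"
      using u(1) assms(2) by (intro subspace_scale subspace_add)
    then have "D \<le> (norm (x - (1/2) *\<^sub>R (u m + u n)))\<^sup>2" by (rule D_le)
    moreover have "(norm (u m - u n))\<^sup>2 = 2 * (norm (x - u m))\<^sup>2 + 2 * (norm (x - u n))\<^sup>2
        - 4 * (norm (x - (1/2) *\<^sub>R (u m + u n)))\<^sup>2"
      by (simp add: power2_norm_eq_inner inner_simps inner_commute algebra_simps)
    moreover have "2 / real (Suc m) = 2 * (1 / real (Suc m))" "2 / real (Suc n) = 2 * (1 / real (Suc n))"
      by simp_all
    ultimately show ?thesis using u(2)[of m] u(2)[of n] by linarith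
  qed
  have "Cauchy u"
  proof (rule CauchyI)
    fix e :: real assume e: "0 < e"
    obtain N where N: "4 / e\<^sup>2 < real N" using reals_Archimedean2 by blast
    have "norm (u m - u n) < e" if "m \<ge> N" "n \<ge> N" for m n
    proof -
      have "2 / real (Suc m) \<le> 2 / real (Suc N)" "2 / real (Suc n) \<le> 2 / real (Suc N)"
        using that by (auto intro!: divide_left_mono)
      then have "(norm (u m - u n))\<^sup>2 \<le> 4 / real (Suc N)" using para[of m n] by simp
      also have "\<dots> < e\<^sup>2"
      proof -
        have "4 < real N * e\<^sup>2" using N e by (simp add: field_simps)
        also have "\<dots> \<le> real (Suc N) * e\<^sup>2" by (intro mult_right_mono) auto
        finally show ?thesis by (simp add: pos_divide_less_eq mult.commute)
      qed
      finally show ?thesis using e by (simp add: power2_less_imp_less)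
    qed
    then show "\<exists>M. \<forall>m\<ge>M. \<forall>n\<ge>M. norm (u m - u n) < e" by blast
  qed
  then obtain p where p: "u \<longlonglongrightarrow> p"
    using Cauchy_convergent convergent_def by blast
  have pV: "p \<in> V" using closed_sequentially[OF assms(1)] u(1) p by blast
  have "(\<lambda>n. (norm (x - u n))\<^sup>2) \<longlonglongrightarrow> (norm (x - p))\<^sup>2"
    by (intro tendsto_intros p)
  moreover have "(\<lambda>n. D + 1 / real (Suc n)) \<longlonglongrightarrow> D + 0"
    by (intro tendsto_intros LIMSEQ_Suc lim_1_over_n)
  ultimately have xp: "(norm (x - p))\<^sup>2 \<le> D"
    using u(2) less_imp_le by (intro LIMSEQ_le[of _ _ _ D]) (simp, auto intro: less_imp_le)
  have "inner (x - p) v = 0" if v: "v \<in> V" for v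
  proof -
    have *: "2 * t * inner (x - p) v \<le> t\<^sup>2 * (norm v)\<^sup>2" for t
    proof -
      have "p + t *\<^sub>R v \<in> V" using pV v assms(2) by (intro subspace_scale subspace_add)
      from order_trans[OF xp D_le[OF this]]
      have "(norm (x - p))\<^sup>2 \<le> (norm (x - (p + t *\<^sub>R v)))\<^sup>2" .
      then show ?thesis
        by (simp add: power2_norm_eq_inner inner_simps inner_commute algebra_simps
            power2_eq_square[of t])
    qed
    \<comment> \<open>The parameter \<open>t = a/b\<close> in the quadratic inequality above forces
      \<open>a = 0\<close>; the summand 1 in \<open>b\<close> covers \<open>v = 0\<close>.\<close>
    define a where "a = inner (x - p) v"
    define b where "b = (norm v)\<^sup>2 + 1"
    have b: "b > 0" by (simp add: b_def add_nonneg_pos)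
    have "2 * (a/b) * a \<le> (a/b)\<^sup>2 * (norm v)\<^sup>2" using *[of "a/b"] by (simp add: a_def)
    also have "\<dots> \<le> (a/b)\<^sup>2 * b" by (intro mult_left_mono) (auto simp: b_def)
    finally have "2 * a\<^sup>2 \<le> a\<^sup>2" using b by (simp add: field_simps power2_eq_square)
    then show ?thesis by (simp add: a_def)
  qed
  then show ?thesis using pV by blast
qed

lemma riesz_representation:
  fixes f :: "'a::{real_inner,complete_space} \<Rightarrow> real"
  assumes "bounded_linear f"
  shows "\<exists>y. \<forall>x. f x = inner x y"
proof (cases "\<forall>x. f x = 0")
  case True
  then show ?thesis by (intro exI[of _ 0]) simp
next
  case False
  interpret f: bounded_linear f by (rule assms)
  obtain w where w: "f w \<noteq> 0" using False by blast
  have "closed {x. f x = 0}"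
    by (intro closed_Collect_eq continuous_intros linear_continuous_on assms)
  moreover have "subspace {x. f x = 0}"
    by (auto simp: subspace_def f.zero f.add f.scaleR)
  ultimately obtain p where p: "f p = 0" "\<And>v. f v = 0 \<Longrightarrow> inner (w - p) v = 0"
    using closed_subspace_nearest_point[of "{x. f x = 0}" w] by auto
  define z where "z = w - p"
  have fz: "f z \<noteq> 0" using w p by (simp add: z_def f.diff)
  then have zz: "inner z z \<noteq> 0" using f.zero by auto
  have "f x = inner x ((f z / inner z z) *\<^sub>R z)" for x
  proof -
    have "f (x - (f x / f z) *\<^sub>R z) = 0" using fz by (simp add: f.diff f.scaleR)
    then have "inner z (x - (f x / f z) *\<^sub>R z) = 0" using p(2) by (simp add: z_def)
    then show ?thesis using fz zz by (simp add: inner_simps inner_commute field_simps)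
  qed
  then show ?thesis by blast
qed

lemma real_adjoint_exists:
  fixes T :: "'a::{real_inner,complete_space} \<Rightarrow>\<^sub>L 'a"
  shows "\<exists>S :: 'a \<Rightarrow>\<^sub>L 'a. \<forall>x y. inner (T x) y = inner x (S y)"
proof -
  have "\<exists>z. \<forall>x. inner (T x) y = inner x z" for y
    by (rule riesz_representation) (intro bounded_linear_intros)
  then obtain g where g: "\<And>x y. inner (T x) y = inner x (g y)" by metis
  have "bounded_linear g"
  proof (rule bounded_linear_intro[where K = "norm T"])
    show "g (x + y) = g x + g y" for x y
      by (rule inner_eq_zero_iff[THEN iffD1, THEN eq_iff_diff_eq_0[THEN iffD2]])
        (simp only: inner_diff_right inner_add_right g[symmetric])
    show "g (r *\<^sub>R x) = r *\<^sub>R g x" for r x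
      by (rule inner_eq_zero_iff[THEN iffD1, THEN eq_iff_diff_eq_0[THEN iffD2]])
        (simp only: inner_diff_right inner_scaleR_right g[symmetric])
    show "norm (g x) \<le> norm x * norm T" for x
    proof (cases "g x = 0")
      case False
      have "norm (g x) * norm (g x) = inner (T (g x)) x"
        by (metis g power2_eq_square power2_norm_eq_inner)
      also have "\<dots> \<le> norm (T (g x)) * norm x" by (rule norm_cauchy_schwarz)
      also have "\<dots> \<le> (norm T * norm (g x)) * norm x"
        by (intro mult_right_mono norm_blinfun) auto
      finally show ?thesis using False by (simp add: mult.commute mult.left_commute)
    qed simp
  qed
  then show ?thesis using g by (intro exI[of _ "Blinfun g"]) (simp add: bounded_linear_Blinfun_apply)
qed

lemma inner_right_ext: "(\<And>x. inner x y = inner x z) \<Longrightarrow> y = z"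
  using vector_eq_ldot by auto

lemma Im_cinner: "Im (cinner x y) = inner (- \<i> *\<^sub>C x) y"
  by (simp flip: Re_cinner add: cinner_scaleC_left)

text \<open>By \<open>Im_cinner\<close> the complex inner product is determined by the real one
  through multiplication by \<open>-i\<close>, so for complex linear operators the real adjoint
  already is the complex one. Later computations can therefore use the real
  \<open>inner\<close>.\<close>

lemma cinner_eq_iff_inner:
  fixes T S :: "'h::complex_hilbert op"
  assumes "T \<in> cbounded_ops"
  shows "(\<forall>x y. cinner (T x) y = cinner x (S y)) \<longleftrightarrow> (\<forall>x y. inner (T x) y = inner x (S y))"
proof
  assume "\<forall>x y. inner (T x) y = inner x (S y)"
  moreover have "(- \<i>) *\<^sub>C T x = T ((- \<i>) *\<^sub>C x)" for x
    using assms by (simp only: cbounded_ops_def mem_Collect_eq)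
  ultimately show "\<forall>x y. cinner (T x) y = cinner x (S y)"
    by (simp add: complex_eq_iff Re_cinner Im_cinner)
qed (simp flip: Re_cinner)

lemma adj_eqI:
  fixes T S :: "'h::complex_hilbert op"
  assumes "T \<in> cbounded_ops" "\<And>x y. inner (T x) y = inner x (S y)"
  shows "adj T = S"
  unfolding adj_def
proof (rule the_equality)
  show "\<forall>x y. cinner (T x) y = cinner x (S y)"
    using assms by (simp add: cinner_eq_iff_inner)
next
  fix R :: "'h op" assume "\<forall>x y. cinner (T x) y = cinner x (R y)"
  then have "inner (T x) y = inner x (R y)" for x y
    using cinner_eq_iff_inner[OF assms(1), of R] by blast
  then have "inner x (R y) = inner x (S y)" for x y
    by (simp add: assms(2))
  then show "R = S" by (intro blinfun_eqI) (rule inner_right_ext)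
qed

lemma inner_adj_right:
  assumes "T \<in> cbounded_ops"
  shows "inner x (adj T y) = inner (T x) y"
  using real_adjoint_exists[of T] adj_eqI[OF assms] by metis

lemma inner_adj_left:
  assumes "T \<in> cbounded_ops"
  shows "inner (adj T x) y = inner x (T y)"
  using inner_adj_right[OF assms] by (metis inner_commute)

lemma cbounded_opsI: "(\<And>c x. blinfun_apply T (c *\<^sub>C x) = c *\<^sub>C T x) \<Longrightarrow> T \<in> cbounded_ops"
  by (simp add: cbounded_ops_def)

lemma cbounded_ops_apply: "T \<in> cbounded_ops \<Longrightarrow> T (c *\<^sub>C x) = c *\<^sub>C T x"
  by (simp add: cbounded_ops_def)

lemma scaleC_zero [simp]: "c *\<^sub>C (0::'h::complex_hilbert) = 0"
  by (rule linear_0[OF bounded_linear.linear[OF bounded_linear_scaleC]])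

lemma scaleC_minus [simp]: "c *\<^sub>C (- x::'h::complex_hilbert) = - (c *\<^sub>C x)"
  by (rule linear_neg[OF bounded_linear.linear[OF bounded_linear_scaleC]])

lemma scaleC_diff: "c *\<^sub>C (x - y::'h::complex_hilbert) = c *\<^sub>C x - c *\<^sub>C y"
  by (rule linear_diff[OF bounded_linear.linear[OF bounded_linear_scaleC]])

lemma scaleC_scaleR: "c *\<^sub>C (r *\<^sub>R x::'h::complex_hilbert) = r *\<^sub>R (c *\<^sub>C x)"
  by (rule linear_scale[OF bounded_linear.linear[OF bounded_linear_scaleC]])

lemma scaleC_one [simp]: "1 *\<^sub>C x = (x::'h::complex_hilbert)"
  using scaleC_of_real[of 1 x] by simp

lemma scaleC_zero_left [simp]: "0 *\<^sub>C x = (0::'h::complex_hilbert)"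
  using scaleC_of_real[of 0 x] by simp

lemma scaleC_minus_left: "(- c) *\<^sub>C x = - (c *\<^sub>C (x::'h::complex_hilbert))"
  using scaleC_add_left[of c "- c" x] scaleC_of_real[of 0 x] by (simp add: add_eq_0_iff)

lemma inner_scaleC_left: "inner (c *\<^sub>C x) y = inner x (cnj c *\<^sub>C y)"
  by (simp flip: Re_cinner add: cinner_scaleC_left cinner_scaleC_right)

lemma scalar_op_apply [simp]: "scalar_op c x = c *\<^sub>C x"
  by transfer simp

lemma scaleC_op_apply [simp]: "scaleC_op c T x = c *\<^sub>C T x"
  by (simp add: scaleC_op_def)

lemma cbounded_ops_intros [simp, intro]:
  "0 \<in> cbounded_ops"
  "id_blinfun \<in> cbounded_ops"
  "T \<in> cbounded_ops \<Longrightarrow> S \<in> cbounded_ops \<Longrightarrow> T + S \<in> cbounded_ops"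
  "T \<in> cbounded_ops \<Longrightarrow> S \<in> cbounded_ops \<Longrightarrow> T - S \<in> cbounded_ops"
  "T \<in> cbounded_ops \<Longrightarrow> - T \<in> cbounded_ops"
  "T \<in> cbounded_ops \<Longrightarrow> r *\<^sub>R T \<in> cbounded_ops"
  "T \<in> cbounded_ops \<Longrightarrow> S \<in> cbounded_ops \<Longrightarrow> T o\<^sub>L S \<in> cbounded_ops"
  "scalar_op c \<in> cbounded_ops"
  "T \<in> cbounded_ops \<Longrightarrow> scaleC_op c T \<in> cbounded_ops"
  by (auto simp: cbounded_ops_def blinfun.bilinear_simps scaleC_add_right scaleC_diff
      scaleC_scaleR scaleC_scaleC mult.commute)

lemma adj_cbounded [simp, intro]:
  assumes "T \<in> cbounded_ops"
  shows "adj T \<in> cbounded_ops"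
proof (rule cbounded_opsI)
  fix c x
  have "inner y (adj T (c *\<^sub>C x)) = inner y (c *\<^sub>C adj T x)" for y
  proof -
    have "inner y (adj T (c *\<^sub>C x)) = inner (T y) (c *\<^sub>C x)"
      using assms by (simp add: inner_adj_right)
    also have "\<dots> = inner (cnj c *\<^sub>C T y) x"
      by (metis inner_scaleC_left complex_cnj_cnj)
    also have "\<dots> = inner (T (cnj c *\<^sub>C y)) x" using assms by (simp add: cbounded_ops_apply)
    also have "\<dots> = inner (cnj c *\<^sub>C y) (adj T x)" using assms by (simp add: inner_adj_right)
    also have "\<dots> = inner y (c *\<^sub>C adj T x)" by (simp add: inner_scaleC_left)
    finally show ?thesis .
  qed
  then show "adj T (c *\<^sub>C x) = c *\<^sub>C adj T x" by (rule inner_right_ext)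
qed

lemma adj_adj [simp]: "T \<in> cbounded_ops \<Longrightarrow> adj (adj T) = T"
  by (rule adj_eqI) (auto simp: inner_adj_left)

lemma adj_zero [simp]: "adj 0 = 0"
  by (rule adj_eqI) auto

lemma adj_id [simp]: "adj id_blinfun = id_blinfun"
  by (rule adj_eqI) auto

lemma adj_add [simp]:
  assumes "T \<in> cbounded_ops" "S \<in> cbounded_ops"
  shows "adj (T + S) = adj T + adj S"
  by (rule adj_eqI)
    (simp_all add: assms blinfun.add_left inner_add_left inner_add_right inner_adj_right)

lemma adj_minus [simp]:
  assumes "T \<in> cbounded_ops"
  shows "adj (- T) = - adj T"
  by (rule adj_eqI) (simp_all add: assms blinfun.minus_left inner_adj_right)

lemma adj_diff [simp]:
  assumes "T \<in> cbounded_ops" "S \<in> cbounded_ops"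
  shows "adj (T - S) = adj T - adj S"
  by (rule adj_eqI)
    (simp_all add: assms blinfun.diff_left inner_diff_left inner_diff_right inner_adj_right)

lemma adj_scaleR [simp]:
  assumes "T \<in> cbounded_ops"
  shows "adj (r *\<^sub>R T) = r *\<^sub>R adj T"
  by (rule adj_eqI) (simp_all add: assms blinfun.scaleR_left inner_adj_right)

lemma adj_compose [simp]:
  assumes "T \<in> cbounded_ops" "S \<in> cbounded_ops"
  shows "adj (T o\<^sub>L S) = adj S o\<^sub>L adj T"
  by (rule adj_eqI) (simp_all add: assms inner_adj_right)

lemma adj_scaleC_op [simp]:
  assumes "T \<in> cbounded_ops"
  shows "adj (scaleC_op c T) = scaleC_op (cnj c) (adj T)"
proof (rule adj_eqI)
  fix x y
  have "inner (scaleC_op c T x) y = inner (T x) (cnj c *\<^sub>C y)"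
    by (simp add: inner_scaleC_left)
  also have "\<dots> = inner x (cnj c *\<^sub>C adj T y)"
    using assms by (simp flip: inner_adj_right add: cbounded_ops_apply)
  finally show "inner (scaleC_op c T x) y = inner x (scaleC_op (cnj c) (adj T) y)" by simp
qed (use assms in simp)

lemma norm_adj_le: "T \<in> cbounded_ops \<Longrightarrow> norm (adj T) \<le> norm T"
proof (rule norm_blinfun_bound)
  assume T: "T \<in> cbounded_ops"
  fix x
  show "norm (adj T x) \<le> norm T * norm x"
  proof (cases "adj T x = 0")
    case False
    have "norm (adj T x) * norm (adj T x) = inner (T (adj T x)) x"
      by (simp add: T flip: inner_adj_right power2_norm_eq_inner power2_eq_square)
    also have "\<dots> \<le> norm (T (adj T x)) * norm x" by (rule norm_cauchy_schwarz)
    also have "\<dots> \<le> (norm T * norm (adj T x)) * norm x"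
      by (intro mult_right_mono norm_blinfun) auto
    finally show ?thesis using False by (simp add: mult.commute mult.left_commute)
  qed simp
qed simp

lemma norm_adj [simp]: "T \<in> cbounded_ops \<Longrightarrow> norm (adj T) = norm T"
  using norm_adj_le[of T] norm_adj_le[of "adj T"] by simp

section \<open>Hermitian operators, positive operators and projections as quadratic forms\<close>

lemma hermitian_iff:
  "hermitian T \<longleftrightarrow> T \<in> cbounded_ops \<and> (\<forall>x y. inner (T x) y = inner x (T y))"
  unfolding hermitian_def using adj_eqI inner_adj_right by metis

lemma hermitian_cbounded [dest]: "hermitian T \<Longrightarrow> T \<in> cbounded_ops"
  by (simp add: hermitian_def)

lemma hermitian_inner: "hermitian T \<Longrightarrow> inner (T x) y = inner x (T y)"
  by (simp add: hermitian_iff)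

lemma hermitian_intros [simp, intro]:
  "hermitian 0"
  "hermitian id_blinfun"
  "hermitian T \<Longrightarrow> hermitian S \<Longrightarrow> hermitian (T + S)"
  "hermitian T \<Longrightarrow> hermitian S \<Longrightarrow> hermitian (T - S)"
  "hermitian T \<Longrightarrow> hermitian (- T)"
  "hermitian T \<Longrightarrow> hermitian (r *\<^sub>R T)"
  by (auto simp: hermitian_def)

lemma hermitian_sum [intro]: "(\<And>i. i \<in> I \<Longrightarrow> hermitian (f i)) \<Longrightarrow> hermitian (sum f I)"
  by (induction I rule: infinite_finite_induct) auto

lemma hermitian_adj_compose [simp, intro]: "T \<in> cbounded_ops \<Longrightarrow> hermitian (adj T o\<^sub>L T)"
  by (auto simp: hermitian_def)

lemma hermitian_compose_commute:
  "hermitian T \<Longrightarrow> hermitian S \<Longrightarrow> T o\<^sub>L S = S o\<^sub>L T \<Longrightarrow> hermitian (T o\<^sub>L S)"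
  by (auto simp: hermitian_def)

lemma hermitian_conjugate: "hermitian T \<Longrightarrow> S \<in> cbounded_ops \<Longrightarrow> hermitian (adj S o\<^sub>L T o\<^sub>L S)"
  by (auto simp: hermitian_def blinfun_eqI)

lemma positive_op_iff: "positive_op T \<longleftrightarrow> hermitian T \<and> (\<forall>x. 0 \<le> inner (T x) x)"
  by (simp add: positive_op_def Re_cinner)

lemma op_le_iff: "hermitian S \<Longrightarrow> hermitian T \<Longrightarrow>
    op_le S T \<longleftrightarrow> (\<forall>x. inner (S x) x \<le> inner (T x) x)"
  by (auto simp: op_le_def positive_op_iff blinfun.bilinear_simps inner_simps)

lemma projectionD:
  assumes "projection P"
  shows "hermitian P" "P o\<^sub>L P = P" "P \<in> cbounded_ops" "adj P = P" "P (P x) = P x"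
  using assms by (auto simp: projection_def hermitian_def)
    (metis blinfun_apply_blinfun_compose)

lemma inner_projection: "projection P \<Longrightarrow> inner (P x) x = (norm (P x))\<^sup>2"
  by (metis projectionD(1,5) hermitian_inner power2_norm_eq_inner)

lemma positive_projection: "projection P \<Longrightarrow> positive_op P"
  by (auto simp: positive_op_iff inner_projection projectionD)

lemma norm_projection_apply: "projection P \<Longrightarrow> norm (P x) \<le> norm x"
proof -
  assume P: "projection P"
  have "norm (P x) * norm (P x) \<le> norm (P x) * norm x"
    using inner_projection[OF P, of x] norm_cauchy_schwarz[of "P x" x] by (simp add: power2_eq_square)
  then show ?thesis by (cases "P x = 0") auto
qed

lemma inner_projection_le: "projection P \<Longrightarrow> inner (P x) x \<le> (norm x)\<^sup>2"
  by (simp add: inner_projection norm_projection_apply power_mono)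

lemma projection_complement: "projection P \<Longrightarrow> projection (id_blinfun - P)"
  by (auto simp: projection_def blinfun_eqI blinfun.bilinear_simps intro!: blinfun_eqI)
    (metis blinfun_apply_blinfun_compose)

text \<open>Polarization: \<open>4 \<langle>Tx,y\<rangle> = \<langle>T(x+y),x+y\<rangle> - \<langle>T(x-y),x-y\<rangle>\<close>, applied to \<open>y\<close> a multiple of \<open>Tx\<close>.\<close>

lemma hermitian_norm_le:
  assumes T: "hermitian T" and c: "0 \<le> c" and b: "\<And>x. \<bar>inner (T x) x\<bar> \<le> c * (norm x)\<^sup>2"
  shows "norm T \<le> c"
proof (rule norm_blinfun_bound[OF c])
  fix x
  show "norm (T x) \<le> c * norm x"
  proof (cases "T x = 0")
    case False
    define y where "y = (norm x / norm (T x)) *\<^sub>R T x"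
    have ny: "norm y = norm x" using False by (simp add: y_def)
    have "4 * inner (T x) y = inner (T (x + y)) (x + y) - inner (T (x - y)) (x - y)"
      using hermitian_inner[OF T, of y x]
      by (simp add: blinfun.bilinear_simps inner_simps inner_commute)
    also have "\<dots> \<le> c * (norm (x + y))\<^sup>2 + c * (norm (x - y))\<^sup>2"
      using b[of "x + y"] b[of "x - y"] by (simp add: abs_le_iff)
    also have "\<dots> = c * (2 * (norm x)\<^sup>2 + 2 * (norm y)\<^sup>2)"
      by (simp add: power2_norm_eq_inner inner_simps inner_commute algebra_simps)
    finally have "4 * inner (T x) y \<le> c * 4 * (norm x)\<^sup>2" by (simp add: ny)
    moreover have "inner (T x) y = norm x * norm (T x)"
      using False by (simp add: y_def power2_eq_square flip: power2_norm_eq_inner)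
    ultimately have "norm x * norm (T x) \<le> norm x * (c * norm x)"
      by (simp add: power2_eq_square mult_ac)
    moreover have "norm x > 0" using False by (metis blinfun.zero_right zero_less_norm_iff)
    ultimately show ?thesis by simp
  qed (use c in simp)
qed

lemma inner_blinfun_le: "\<bar>inner (blinfun_apply T x) x\<bar> \<le> norm T * (norm x)\<^sup>2"
proof -
  have "\<bar>inner (T x) x\<bar> \<le> norm (T x) * norm x" by (rule Cauchy_Schwarz_ineq2)
  also have "\<dots> \<le> (norm T * norm x) * norm x" by (intro mult_right_mono norm_blinfun) simp
  finally show ?thesis by (simp add: power2_eq_square mult_ac)
qed

text \<open>This is Cauchy-Schwarz for the form \<open>inner (a u) v\<close>: expand positivity at
  \<open>x - s *\<^sub>R a x\<close> with \<open>s = 1 / norm a\<close>, where the quadratic term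
  costs half of the linear one. It turns estimates of quadratic forms into estimates of
  vectors.\<close>

lemma positive_op_norm_apply:
  assumes "positive_op a"
  shows "(norm (a x))\<^sup>2 \<le> norm a * inner (a x) x"
proof (cases "norm a = 0")
  case False
  define s where "s = 1 / norm a"
  have s: "s > 0" "norm a * s = 1" using False by (auto simp: s_def)
  have h: "hermitian a" and pos: "\<And>v. 0 \<le> inner (a v) v" using assms by (auto simp: positive_op_iff)
  have "0 \<le> inner (a (x - s *\<^sub>R a x)) (x - s *\<^sub>R a x)" by (rule pos)
  also have "\<dots> = inner (a x) x - 2 * s * (norm (a x))\<^sup>2 + s\<^sup>2 * inner (a (a x)) (a x)"
    using hermitian_inner[OF h, of "a x" x]
    by (simp add: blinfun.bilinear_simps inner_simps inner_commute power2_norm_eq_inner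
        power2_eq_square[of s] algebra_simps)
  also have "inner (a (a x)) (a x) \<le> norm a * (norm (a x))\<^sup>2"
    using inner_blinfun_le[of a "a x"] by simp
  finally have "0 \<le> inner (a x) x - 2 * s * (norm (a x))\<^sup>2 + s\<^sup>2 * (norm a * (norm (a x))\<^sup>2)"
    using s by (simp add: mult_left_mono)
  also have "s\<^sup>2 * (norm a * (norm (a x))\<^sup>2) = s * (norm (a x))\<^sup>2" using s
    by (simp add: power2_eq_square algebra_simps)
  finally have "s * (norm (a x))\<^sup>2 \<le> inner (a x) x" by simp
  then have "norm a * (s * (norm (a x))\<^sup>2) \<le> norm a * inner (a x) x" by (rule mult_left_mono) simp
  then show ?thesis using s by (metis mult.assoc mult_1)
qed simp

subsection \<open>Strong limits\<close>

lemma pointwise_limit_blinfun: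
  fixes x :: "nat \<Rightarrow> 'a::real_normed_vector \<Rightarrow>\<^sub>L 'b::real_normed_vector"
  assumes b: "\<And>n. norm (x n) \<le> c" and conv: "\<And>v. convergent (\<lambda>n. x n v)"
  obtains T where "\<And>v. (\<lambda>n. x n v) \<longlonglongrightarrow> blinfun_apply T v" "norm T \<le> c"
proof -
  obtain f where f: "\<And>v. (\<lambda>n. x n v) \<longlonglongrightarrow> f v"
    using conv unfolding convergent_def by metis
  have c: "0 \<le> c" using b[of 0] norm_ge_zero order_trans by blast
  have le: "norm (f v) \<le> c * norm v" for v
  proof (rule LIMSEQ_le_const2[OF tendsto_norm[OF f]])
    have "norm (x n v) \<le> c * norm v" for n
      using norm_blinfun[of "x n" v] mult_right_mono[OF b[of n] norm_ge_zero[of v]] by linarith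
    then show "\<exists>N. \<forall>n\<ge>N. norm (x n v) \<le> c * norm v" by blast
  qed
  have bl: "bounded_linear f"
  proof (rule bounded_linear_intro[where K = c])
    show "f (u + v) = f u + f v" for u v
      using tendsto_add[OF f[of u] f[of v]] f[of "u + v"] LIMSEQ_unique
      by (fastforce simp: blinfun.add_right)
    show "f (r *\<^sub>R u) = r *\<^sub>R f u" for r u
      using tendsto_scaleR[OF tendsto_const[of r] f[of u]] f[of "r *\<^sub>R u"] LIMSEQ_unique
      by (fastforce simp: blinfun.scaleR_right)
    show "norm (f v) \<le> norm v * c" for v using le[of v] by (simp add: mult.commute)
  qed
  show thesis
  proof (rule that[of "Blinfun f"])
    show "norm (Blinfun f) \<le> c"
      using le c by (intro norm_blinfun_bound) (simp_all add: bounded_linear_Blinfun_apply bl)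
  qed (simp add: bounded_linear_Blinfun_apply bl f)
qed

lemma sot_limit_cbounded:
  assumes "\<And>n. x n \<in> cbounded_ops" "\<And>v. (\<lambda>n. x n v) \<longlonglongrightarrow> blinfun_apply T v"
  shows "T \<in> cbounded_ops"
proof (rule cbounded_opsI)
  fix c v
  have "(\<lambda>n. x n (c *\<^sub>C v)) \<longlonglongrightarrow> c *\<^sub>C T v"
    using bounded_linear.tendsto[OF bounded_linear_scaleC assms(2)]
    by (simp add: cbounded_ops_apply[OF assms(1)])
  then show "T (c *\<^sub>C v) = c *\<^sub>C T v" using assms(2) LIMSEQ_unique by blast
qed

text \<open>Commutation relations survive pointwise limits; with the bicommutant description this
  makes von Neumann algebras closed under the strong limits used below.\<close>

lemma sot_limit_commute:
  fixes C T :: "'a::real_normed_vector \<Rightarrow>\<^sub>L 'a"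
  assumes "\<And>n. C o\<^sub>L x n = x n o\<^sub>L C" "\<And>v. (\<lambda>n. x n v) \<longlonglongrightarrow> T v"
  shows "C o\<^sub>L T = T o\<^sub>L C"
proof (rule blinfun_eqI)
  fix v
  have "C (x n v) = x n (C v)" for n by (metis assms(1) blinfun_apply_blinfun_compose)
  then have "(\<lambda>n. x n (C v)) \<longlonglongrightarrow> C (T v)"
    using blinfun.tendsto[OF tendsto_const[of C] assms(2)[of v]] by simp
  then show "(C o\<^sub>L T) v = (T o\<^sub>L C) v" using assms(2)[of "C v"] LIMSEQ_unique by auto
qed

lemma sot_limit_hermitian:
  assumes "\<And>n. hermitian (x n)" "\<And>v. (\<lambda>n. x n v) \<longlonglongrightarrow> blinfun_apply T v"
  shows "hermitian T"
  unfolding hermitian_iff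
proof (intro conjI allI)
  show "T \<in> cbounded_ops" using assms sot_limit_cbounded by blast
  fix u v
  have "(\<lambda>n. inner (x n u) v) \<longlonglongrightarrow> inner (T u) v" "(\<lambda>n. inner u (x n v)) \<longlonglongrightarrow> inner u (T v)"
    by (intro tendsto_intros assms)+
  then show "inner (T u) v = inner u (T v)"
    using LIMSEQ_unique by (simp add: hermitian_inner[OF assms(1)])
qed

text \<open>For positive \<open>a = x m - x n\<close> one has \<open>\<parallel>a v\<parallel>\<^sup>2 \<le> \<parallel>a\<parallel> \<langle>a v,v\<rangle>\<close>, so convergence of the bounded
  monotone scalar sequences \<open>\<langle>x n v,v\<rangle>\<close> forces strong convergence.\<close>

lemma monotone_sot_limit:
  assumes h: "\<And>n. hermitian (x n)" and c: "\<And>n. norm (x n) \<le> c"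
    and mono: "\<And>m n v. m \<le> n \<Longrightarrow> inner (blinfun_apply (x m) v) v \<le> inner (x n v) v"
  obtains T where "hermitian T" "\<And>v. (\<lambda>n. x n v) \<longlonglongrightarrow> blinfun_apply T v"
    "\<And>n v. inner (x n v) v \<le> inner (blinfun_apply T v) v" "norm T \<le> c"
proof -
  have c0: "0 \<le> c" using c[of 0] norm_ge_zero order_trans by blast
  have key: "(norm (x n v - x m v))\<^sup>2 \<le> 2 * c * (inner (x n v) v - inner (x m v) v)" if "m \<le> n" for m n v
  proof -
    have p: "positive_op (x n - x m)"
      using h mono[OF that] by (auto simp: positive_op_iff blinfun.diff_left inner_diff_left)
    have "(norm ((x n - x m) v))\<^sup>2 \<le> norm (x n - x m) * inner ((x n - x m) v) v"
      using p by (rule positive_op_norm_apply)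
    also have "\<dots> \<le> (2 * c) * inner ((x n - x m) v) v"
      using norm_triangle_ineq4[of "x n" "x m"] c[of n] c[of m] p
      by (intro mult_right_mono) (auto simp: positive_op_iff)
    finally show ?thesis by (simp add: blinfun.diff_left inner_diff_left)
  qed
  have conv: "convergent (\<lambda>n. x n v)" for v
  proof -
    have "incseq (\<lambda>n. inner (x n v) v)" using mono by (auto simp: incseq_def)
    moreover have "inner (x n v) v \<le> c * (norm v)\<^sup>2" for n
      using inner_blinfun_le[of "x n" v] mult_right_mono[OF c[of n], of "(norm v)\<^sup>2"] by simp
    ultimately obtain L where "(\<lambda>n. inner (x n v) v) \<longlonglongrightarrow> L" using incseq_convergent by metis
    then have C: "Cauchy (\<lambda>n. inner (x n v) v)" by (rule LIMSEQ_imp_Cauchy)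
    have "Cauchy (\<lambda>n. x n v)"
    proof (rule CauchyI)
      fix e :: real assume e: "0 < e"
      \<comment> \<open>The summand 1 in the denominator covers \<open>c = 0\<close>.\<close>
      define d where "d = e\<^sup>2 / (2 * c + 1)"
      have d: "d > 0" using e c0 by (auto simp: d_def intro!: divide_pos_pos)
      then obtain N where N: "\<And>m n. m \<ge> N \<Longrightarrow> n \<ge> N \<Longrightarrow> norm (inner (x m v) v - inner (x n v) v) < d"
        using CauchyD[OF C] by meson
      have *: "norm (x n v - x m v) < e" if "N \<le> m" "m \<le> n" for m n
      proof -
        have "(norm (x n v - x m v))\<^sup>2 \<le> 2 * c * (inner (x n v) v - inner (x m v) v)"
          using that by (intro key)
        also have "\<dots> \<le> 2 * c * d"
          using N[of n m] that c0 by (intro mult_left_mono) auto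
        also have "\<dots> < (2 * c + 1) * d" using d by (simp add: algebra_simps)
        also have "\<dots> = e\<^sup>2" using c0 by (simp add: d_def)
        finally show ?thesis using e by (simp add: power2_less_imp_less)
      qed
      show "\<exists>M. \<forall>m\<ge>M. \<forall>n\<ge>M. norm (x m v - x n v) < e"
        using * by (metis nle_le norm_minus_commute)
    qed
    then show ?thesis by (rule Cauchy_convergent)
  qed
  then obtain T where T: "\<And>v. (\<lambda>n. x n v) \<longlonglongrightarrow> blinfun_apply T v" "norm T \<le> c"
    using pointwise_limit_blinfun[of x c, OF c conv] by blast
  have "inner (x n v) v \<le> inner (T v) v" for n v
    by (rule LIMSEQ_le_const[where X = "\<lambda>n. inner (x n v) v"]) (auto intro!: tendsto_intros T mono)
  then show thesis using that T sot_limit_hermitian[OF h T(1)] by blast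
qed

subsection \<open>Square roots and spectral projections\<close>

lemma blinfun_compose_assoc: "(a o\<^sub>L b) o\<^sub>L c = a o\<^sub>L (b o\<^sub>L c)"
  by (rule blinfun_eqI) simp

lemma commute_compose:
  "C o\<^sub>L S = S o\<^sub>L C \<Longrightarrow> C o\<^sub>L T = T o\<^sub>L C \<Longrightarrow> C o\<^sub>L (S o\<^sub>L T) = (S o\<^sub>L T) o\<^sub>L C"
  by (metis blinfun_compose_assoc)

lemma commute_apply: "C o\<^sub>L S = S o\<^sub>L C \<Longrightarrow> blinfun_apply C (S v) = S (C v)"
  by (metis blinfun_apply_blinfun_compose)

lemma commuteI: "(\<And>v. blinfun_apply C (blinfun_apply S v) = S (C v)) \<Longrightarrow> C o\<^sub>L S = S o\<^sub>L C"
  by (rule blinfun_eqI) simp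

lemma commute_add:
  "C o\<^sub>L S = S o\<^sub>L C \<Longrightarrow> C o\<^sub>L T = T o\<^sub>L C \<Longrightarrow> C o\<^sub>L (S + T) = (S + T) o\<^sub>L C"
  by (rule commuteI) (simp add: commute_apply blinfun.bilinear_simps)

lemma commute_diff:
  "C o\<^sub>L S = S o\<^sub>L C \<Longrightarrow> C o\<^sub>L T = T o\<^sub>L C \<Longrightarrow> C o\<^sub>L (S - T) = (S - T) o\<^sub>L C"
  by (rule commuteI) (simp add: commute_apply blinfun.bilinear_simps)

lemma commute_scaleR: "C o\<^sub>L S = S o\<^sub>L C \<Longrightarrow> C o\<^sub>L (r *\<^sub>R S) = (r *\<^sub>R S) o\<^sub>L C"
  by (rule commuteI) (simp add: commute_apply blinfun.bilinear_simps)

lemma compose_id [simp]: "C o\<^sub>L id_blinfun = C" "id_blinfun o\<^sub>L C = C"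
  by (rule blinfun_eqI, simp)+

lemma commute_id: "C o\<^sub>L id_blinfun = id_blinfun o\<^sub>L C"
  by simp

lemma norm_compose_le: "norm (x o\<^sub>L y) \<le> a * b" if "norm x \<le> a" "norm y \<le> b"
  using norm_blinfun_compose[of x y] mult_mono[OF that] norm_ge_zero[of x] norm_ge_zero[of y] that
  by (smt (verit) mult_mono)

text \<open>The iteration \<open>y \<mapsto> (x + y\<^sup>2)/2\<close> starting at \<open>0\<close> with \<open>x = 1 - T\<^sup>*T\<close> converges to
  \<open>1 - (T\<^sup>*T)\<^sup>1\<^sup>/\<^sup>2\<close>; its increments are dominated by those of the scalar iteration with \<open>x = 1\<close>.\<close>

primrec sqrt_iter :: "('a::real_normed_vector \<Rightarrow>\<^sub>L 'a) \<Rightarrow> nat \<Rightarrow> 'a \<Rightarrow>\<^sub>L 'a" where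
  "sqrt_iter x 0 = 0"
| "sqrt_iter x (Suc n) = (1/2) *\<^sub>R (x + (sqrt_iter x n o\<^sub>L sqrt_iter x n))"

primrec sqrt_bound :: "nat \<Rightarrow> real" where
  "sqrt_bound 0 = 0"
| "sqrt_bound (Suc n) = (1 + (sqrt_bound n)\<^sup>2) / 2"

lemma sqrt_bound_range: "0 \<le> sqrt_bound n" "sqrt_bound n \<le> 1"
  by (induction n) (auto simp: power_le_one)

lemma sqrt_bound_mono: "sqrt_bound n \<le> sqrt_bound (Suc n)"
proof -
  have "0 \<le> (1 - sqrt_bound n)\<^sup>2" by simp
  then show ?thesis by (simp add: power2_eq_square algebra_simps)
qed

lemma sqrt_iter_commute:
  assumes "C o\<^sub>L x = x o\<^sub>L C"
  shows "C o\<^sub>L sqrt_iter x n = sqrt_iter x n o\<^sub>L C"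
proof (induction n)
  case (Suc n)
  show ?case unfolding sqrt_iter.simps by (intro commute_scaleR commute_add commute_compose assms Suc)
qed simp

lemma sqrt_iter_norm:
  assumes "norm x \<le> 1"
  shows "norm (sqrt_iter x n) \<le> sqrt_bound n"
proof (induction n)
  case (Suc n)
  have "norm (x + (sqrt_iter x n o\<^sub>L sqrt_iter x n)) \<le> 1 + sqrt_bound n * sqrt_bound n"
    by (rule norm_triangle_le[OF add_mono[OF assms norm_compose_le[OF Suc Suc]]])
  then show ?case by (simp add: power2_eq_square)
qed simp

text \<open>The iterates commute, so the difference of two consecutive squares factors into a
  difference and a sum, and both factors are bounded by their scalar counterparts.\<close>

lemma sqrt_iter_step:
  assumes x: "norm x \<le> 1"
  shows "norm (sqrt_iter x (Suc n) - sqrt_iter x n) \<le> sqrt_bound (Suc n) - sqrt_bound n"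
proof (induction n)
  case 0
  then show ?case using x by simp
next
  case (Suc n)
  let ?u = "sqrt_iter x (Suc n)" and ?v = "sqrt_iter x n"
  have comm: "?u o\<^sub>L ?v = ?v o\<^sub>L ?u"
    by (intro sqrt_iter_commute sqrt_iter_commute[symmetric] refl)
  have "sqrt_iter x (Suc (Suc n)) - ?u = (1/2) *\<^sub>R ((?u - ?v) o\<^sub>L (?u + ?v))"
    using commute_apply[OF comm]
    by (intro blinfun_eqI) (simp del: sqrt_iter.simps add: sqrt_iter.simps(2)[of x "Suc n"]
      blinfun.bilinear_simps, simp add: blinfun.bilinear_simps algebra_simps)
  moreover have "norm ((?u - ?v) o\<^sub>L (?u + ?v))
      \<le> (sqrt_bound (Suc n) - sqrt_bound n) * (sqrt_bound (Suc n) + sqrt_bound n)"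
    by (intro norm_compose_le Suc norm_triangle_le add_mono sqrt_iter_norm x)
  ultimately have "norm (sqrt_iter x (Suc (Suc n)) - ?u)
      \<le> (1/2) * ((sqrt_bound (Suc n) - sqrt_bound n) * (sqrt_bound (Suc n) + sqrt_bound n))"
    by simp
  also have "\<dots> = sqrt_bound (Suc (Suc n)) - sqrt_bound (Suc n)"
    unfolding sqrt_bound.simps(2)[of "Suc n"] sqrt_bound.simps(2)[of n]
    by (simp add: power2_eq_square field_simps)
  finally show ?case .
qed

text \<open>The iterates are built from \<open>x\<close>, hence commute with everything that
  commutes with \<open>adj T o\<^sub>L T\<close>, and this passes to the limit. The bound on
  \<open>norm T\<close> gives \<open>norm x \<le> 1\<close>, which keeps the iteration below the
  scalar one.\<close>

lemma sqrt_exists: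
  fixes T :: "'h::complex_hilbert op"
  assumes T: "T \<in> cbounded_ops" and n1: "norm T \<le> 1"
  obtains r where "positive_op r" "r o\<^sub>L r = adj T o\<^sub>L T"
    "\<And>C. C o\<^sub>L (adj T o\<^sub>L T) = (adj T o\<^sub>L T) o\<^sub>L C \<Longrightarrow> C o\<^sub>L r = r o\<^sub>L C"
proof -
  define a where "a = adj T o\<^sub>L T"
  define x where "x = id_blinfun - a"
  have ha: "hermitian a" using T by (simp add: a_def)
  have hx: "hermitian x" using ha by (simp add: x_def)
  have ia: "inner (a v) v = (norm (T v))\<^sup>2" for v
    using T by (simp add: a_def inner_adj_left power2_norm_eq_inner)
  have contr: "norm (T v) \<le> norm v" for v
    using norm_blinfun[of T v] mult_right_mono[OF n1 norm_ge_zero[of v]] by simp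
  have nx: "norm x \<le> 1"
  proof (rule hermitian_norm_le[OF hx])
    fix v
    show "\<bar>inner (x v) v\<bar> \<le> 1 * (norm v)\<^sup>2"
      using contr[of v] by (simp add: x_def blinfun.diff_left inner_diff_left ia
        power_mono flip: power2_norm_eq_inner)
  qed simp
  have hy: "hermitian (sqrt_iter x n)" for n
    by (induction n) (auto simp: hx intro!: hermitian_intros hermitian_compose_commute)
  have diff: "norm (sqrt_iter x (n + k) - sqrt_iter x n) \<le> sqrt_bound (n + k) - sqrt_bound n" for n k
  proof (induction k)
    case (Suc k)
    have "norm (sqrt_iter x (n + Suc k) - sqrt_iter x n)
        \<le> norm (sqrt_iter x (Suc (n + k)) - sqrt_iter x (n + k)) + norm (sqrt_iter x (n + k) - sqrt_iter x n)"
      using norm_triangle_ineq[of "sqrt_iter x (Suc (n + k)) - sqrt_iter x (n + k)"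
        "sqrt_iter x (n + k) - sqrt_iter x n"] by (simp del: sqrt_iter.simps)
    then show ?case using Suc sqrt_iter_step[OF nx, of "n + k"] by simp
  qed simp
  have "incseq sqrt_bound" using sqrt_bound_mono by (rule incseq_SucI)
  then have "convergent sqrt_bound"
    using incseq_convergent[of sqrt_bound 1] sqrt_bound_range convergent_def by metis
  then have C: "Cauchy sqrt_bound" by (rule convergent_Cauchy)
  have "Cauchy (sqrt_iter x)"
  proof (rule CauchyI)
    fix e :: real assume "0 < e"
    then obtain N where N: "\<And>m n. m \<ge> N \<Longrightarrow> n \<ge> N \<Longrightarrow> norm (sqrt_bound m - sqrt_bound n) < e"
      using CauchyD[OF C] by meson
    have *: "norm (sqrt_iter x m - sqrt_iter x n) < e" if "N \<le> n" "n \<le> m" for m n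
      using diff[of n "m - n"] N[of m n] that by simp
    show "\<exists>M. \<forall>m\<ge>M. \<forall>n\<ge>M. norm (sqrt_iter x m - sqrt_iter x n) < e"
      using * by (metis nle_le norm_minus_commute)
  qed
  then obtain y where y: "sqrt_iter x \<longlonglongrightarrow> y" using Cauchy_convergent convergent_def by blast
  have ys: "(\<lambda>n. sqrt_iter x n v) \<longlonglongrightarrow> y v" for v by (intro tendsto_intros y)
  have "(\<lambda>n. sqrt_iter x (Suc n)) \<longlonglongrightarrow> (1/2) *\<^sub>R (x + (y o\<^sub>L y))"
    unfolding sqrt_iter.simps by (intro tendsto_intros y)
  then have yy: "y = (1/2) *\<^sub>R (x + (y o\<^sub>L y))"
    using LIMSEQ_Suc[OF y] LIMSEQ_unique by blast
  have hy': "hermitian y" using sot_limit_hermitian[OF hy ys] .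
  have "norm (sqrt_iter x n) \<le> 1" for n
    using sqrt_iter_norm[OF nx, of n] sqrt_bound_range(2)[of n] by linarith
  then have ny: "norm y \<le> 1" using LIMSEQ_le_const2[OF tendsto_norm[OF y]] by blast
  show thesis
  proof (rule that[of "id_blinfun - y"])
    have "inner (y v) v \<le> inner v v" for v
      using inner_blinfun_le[of y v] mult_right_mono[OF ny, of "(norm v)\<^sup>2"]
      by (simp add: power2_norm_eq_inner)
    then show "positive_op (id_blinfun - y)"
      using hy' by (simp add: positive_op_iff blinfun.diff_left inner_diff_left)
    have "2 *\<^sub>R y = x + (y o\<^sub>L y)" by (subst yy) simp
    then have "2 *\<^sub>R y v = x v + y (y v)" for v
      by (metis blinfun.add_left blinfun.scaleR_left blinfun_apply_blinfun_compose)
    then show "(id_blinfun - y) o\<^sub>L (id_blinfun - y) = adj T o\<^sub>L T"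
      by (intro blinfun_eqI) (simp add: blinfun.bilinear_simps x_def a_def algebra_simps scaleR_2)
    fix C :: "'h op" assume "C o\<^sub>L (adj T o\<^sub>L T) = (adj T o\<^sub>L T) o\<^sub>L C"
    then have "C o\<^sub>L x = x o\<^sub>L C" unfolding x_def a_def by (intro commute_diff commute_id)
    then show "C o\<^sub>L (id_blinfun - y) = (id_blinfun - y) o\<^sub>L C"
      by (intro commute_diff commute_id sot_limit_commute[OF _ ys] sqrt_iter_commute)
  qed
qed

text \<open>All properties come from \<open>uniq\<close>: a point of \<open>V\<close> whose residual
  is orthogonal to \<open>V\<close> is the nearest point. The last clause turns invariance of
  \<open>V\<close> under \<open>C\<close> and \<open>adj C\<close> into a commutation relation, by
  which such projections are later recognised as elements of \<open>M\<close>.\<close>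

lemma closed_subspace_projection:
  fixes V :: "'h::complex_hilbert set"
  assumes cl: "closed V" and sub: "subspace V" and cV: "\<And>c v. v \<in> V \<Longrightarrow> c *\<^sub>C v \<in> V"
  obtains P where "projection P" "\<And>v. P v = v \<longleftrightarrow> v \<in> V"
    "\<And>C. C \<in> cbounded_ops \<Longrightarrow> C ` V \<subseteq> V \<Longrightarrow> adj C ` V \<subseteq> V \<Longrightarrow> C o\<^sub>L P = P o\<^sub>L C"
proof -
  obtain p where p: "\<And>x. p x \<in> V" "\<And>x v. v \<in> V \<Longrightarrow> inner (x - p x) v = 0"
    using closed_subspace_nearest_point[OF cl sub] by metis
  have uniq: "p x = w" if "w \<in> V" "\<And>v. v \<in> V \<Longrightarrow> inner (x - w) v = 0" for x w
  proof -
    have "p x - w \<in> V" using p(1) that(1) sub by (intro subspace_diff)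
    then have "inner (x - w) (p x - w) = 0" "inner (x - p x) (p x - w) = 0" using that p by auto
    then have "inner (p x - w) (p x - w) = 0" by (simp add: inner_diff_left)
    then show ?thesis by simp
  qed
  have lin: "p (x + y) = p x + p y" "p (r *\<^sub>R x) = r *\<^sub>R p x" for x y r
  proof (rule uniq)
    show "inner (x + y - (p x + p y)) v = 0" if "v \<in> V" for v
      using p(2)[OF that, of x] p(2)[OF that, of y] by (simp add: inner_simps)
  next
    show "p (r *\<^sub>R x) = r *\<^sub>R p x"
    proof (rule uniq)
      show "inner (r *\<^sub>R x - r *\<^sub>R p x) v = 0" if "v \<in> V" for v
        using p(2)[OF that, of x] by (simp flip: scaleR_diff_right)
    qed (use p(1) sub in \<open>auto intro: subspace_scale\<close>)
  qed (use p(1) sub in \<open>auto intro: subspace_add\<close>)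
  have np: "norm (p x) \<le> norm x" for x
  proof -
    have "norm (p x) * norm (p x) = inner x (p x)"
      using p(2)[OF p(1), of x x] by (simp add: inner_diff_left flip: power2_norm_eq_inner power2_eq_square)
    also have "\<dots> \<le> norm x * norm (p x)" by (rule norm_cauchy_schwarz)
    finally show ?thesis by (cases "p x = 0") auto
  qed
  have bl: "bounded_linear p"
    by (rule bounded_linear_intro[where K = 1]) (simp_all add: lin np)
  define P where "P = Blinfun p"
  have P: "P x = p x" for x by (simp add: P_def bounded_linear_Blinfun_apply bl)
  have fixp: "P v = v \<longleftrightarrow> v \<in> V" for v using p(1)[of v] uniq[of v v] P by auto
  have Pcb: "P \<in> cbounded_ops"
  proof (rule cbounded_opsI)
    fix c x
    show "P (c *\<^sub>C x) = c *\<^sub>C P x" unfolding P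
    proof (rule uniq)
      show "inner (c *\<^sub>C x - c *\<^sub>C p x) v = 0" if "v \<in> V" for v
        using p(2)[OF cV[OF that], of x "cnj c"] by (simp add: inner_scaleC_left flip: scaleC_diff)
    qed (use p(1) cV in auto)
  qed
  have sym: "inner (P x) y = inner x (P y)" for x y
    using p(2)[OF p(1)[of x], of y] p(2)[OF p(1)[of y], of x]
    by (simp add: P inner_diff_left inner_diff_right inner_commute)
  have proj: "projection P"
    using Pcb sym fixp p(1) by (auto simp: projection_def hermitian_iff P intro!: blinfun_eqI uniq)
  show thesis
  proof (rule that[OF proj fixp])
    fix C :: "'h op" assume C: "C \<in> cbounded_ops" "C ` V \<subseteq> V" "adj C ` V \<subseteq> V"
    show "C o\<^sub>L P = P o\<^sub>L C"
    proof (rule commuteI)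
      fix v
      show "C (P v) = P (C v)" unfolding P
      proof (rule uniq[symmetric])
        show "C (p v) \<in> V" using C(2) p(1) by blast
        fix w assume "w \<in> V"
        then have "adj C w \<in> V" using C(3) by blast
        then have "inner (v - p v) (adj C w) = 0" by (rule p(2))
        then show "inner (C v - C (p v)) w = 0"
          using C(1) by (simp add: inner_adj_right blinfun.diff_right)
      qed
    qed
  qed
qed

lemma kernel_projection:
  fixes T :: "'h::complex_hilbert op"
  assumes "T \<in> cbounded_ops"
  obtains P where "projection P" "\<And>v. P v = v \<longleftrightarrow> T v = 0"
    "\<And>C. C \<in> cbounded_ops \<Longrightarrow> C o\<^sub>L T = T o\<^sub>L C \<Longrightarrow> adj C o\<^sub>L T = T o\<^sub>L adj C \<Longrightarrow> C o\<^sub>L P = P o\<^sub>L C"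
proof -
  let ?V = "{v. T v = 0}"
  have cl: "closed ?V" by (intro closed_Collect_eq continuous_intros)
  have sub: "subspace ?V" by (auto simp: subspace_def blinfun.bilinear_simps)
  have cV: "c *\<^sub>C v \<in> ?V" if "v \<in> ?V" for c v
    using that assms by (simp add: cbounded_ops_apply)
  obtain P where P: "projection P" "\<And>v. P v = v \<longleftrightarrow> v \<in> ?V"
    "\<And>C. C \<in> cbounded_ops \<Longrightarrow> C ` ?V \<subseteq> ?V \<Longrightarrow> adj C ` ?V \<subseteq> ?V \<Longrightarrow> C o\<^sub>L P = P o\<^sub>L C"
    by (rule closed_subspace_projection[OF cl sub], erule cV, rule that)
  show thesis
  proof (rule that[OF P(1)])
    fix C :: "'h op" assume C: "C \<in> cbounded_ops" "C o\<^sub>L T = T o\<^sub>L C" "adj C o\<^sub>L T = T o\<^sub>L adj C"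
    show "C o\<^sub>L P = P o\<^sub>L C"
      using commute_apply[OF C(2), symmetric] commute_apply[OF C(3), symmetric]
      by (intro P(3) C(1)) auto
  qed (use P(2) in auto)
qed

lemma hermitian_commute_adj:
  assumes "hermitian S" "C \<in> cbounded_ops" "C o\<^sub>L S = S o\<^sub>L C"
  shows "adj C o\<^sub>L S = S o\<^sub>L adj C"
proof -
  have "adj S o\<^sub>L adj C = adj C o\<^sub>L adj S"
    using arg_cong[OF assms(3), of adj]
    unfolding adj_compose[OF assms(2) hermitian_cbounded[OF assms(1)]]
      adj_compose[OF hermitian_cbounded[OF assms(1)] assms(2)] .
  then show ?thesis using assms(1) by (simp add: hermitian_def)
qed

text \<open>With \<open>r = |S - t|\<close> the projection onto \<open>ker (r + (S - t))\<close> is the spectral projection of \<open>S\<close>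
  for \<open>]-\<infinity>, t]\<close>; \<open>e\<close> is its complement.\<close>

lemma spectral_projection:
  fixes S :: "'h::complex_hilbert op"
  assumes S: "hermitian S"
  obtains e where "projection e" "\<And>C. C \<in> cbounded_ops \<Longrightarrow> C o\<^sub>L S = S o\<^sub>L C \<Longrightarrow> C o\<^sub>L e = e o\<^sub>L C"
    "\<And>v. e v = v \<Longrightarrow> t * (norm v)\<^sup>2 \<le> inner (S v) v" "\<And>v. e v = 0 \<Longrightarrow> inner (S v) v \<le> t * (norm v)\<^sup>2"
proof -
  define s where "s = norm (S - t *\<^sub>R id_blinfun) + 1"
  have s: "s > 0" by (simp add: s_def add_nonneg_pos)
  define x where "x = (1 / s) *\<^sub>R (S - t *\<^sub>R id_blinfun)"
  have hx: "hermitian x" using S by (simp add: x_def)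
  have cx: "x \<in> cbounded_ops" using hx by blast
  have "norm x \<le> 1" using s by (simp add: x_def s_def)
  then obtain r where r: "positive_op r" "r o\<^sub>L r = adj x o\<^sub>L x"
    "\<And>C. C o\<^sub>L (adj x o\<^sub>L x) = (adj x o\<^sub>L x) o\<^sub>L C \<Longrightarrow> C o\<^sub>L r = r o\<^sub>L C"
    using sqrt_exists[OF cx] by metis
  have ax: "adj x = x" using hx by (simp add: hermitian_def)
  have hr: "hermitian r" using r(1) by (simp add: positive_op_iff)
  have rx: "r o\<^sub>L x = x o\<^sub>L r"
    by (rule r(3)[symmetric]) (simp add: ax blinfun_compose_assoc)
  have rr: "r (r v) = x (x v)" for v using r(2) by (metis ax blinfun_apply_blinfun_compose)
  have rx': "r (x v) = x (r v)" for v using rx by (rule commute_apply)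
  obtain N where N: "projection N" "\<And>v. N v = v \<longleftrightarrow> (r + x) v = 0"
    "\<And>C. C \<in> cbounded_ops \<Longrightarrow> C o\<^sub>L (r + x) = (r + x) o\<^sub>L C \<Longrightarrow> adj C o\<^sub>L (r + x) = (r + x) o\<^sub>L adj C
      \<Longrightarrow> C o\<^sub>L N = N o\<^sub>L C"
    using kernel_projection[of "r + x"] hr hx by blast
  have Sx: "inner (S v) v = t * (norm v)\<^sup>2 + s * inner (x v) v" for v
    using s by (simp add: x_def blinfun.bilinear_simps inner_diff_left power2_norm_eq_inner)
  show thesis
  proof (rule that[of "id_blinfun - N"])
    show "projection (id_blinfun - N)" using N(1) by (rule projection_complement)
    fix C :: "'h op" assume C: "C \<in> cbounded_ops" "C o\<^sub>L S = S o\<^sub>L C"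
    have *: "C' o\<^sub>L (r + x) = (r + x) o\<^sub>L C'" if "C' o\<^sub>L S = S o\<^sub>L C'" for C'
    proof -
      have "C' o\<^sub>L x = x o\<^sub>L C'" unfolding x_def
        by (intro commute_scaleR commute_diff that commute_id)
      then show ?thesis by (intro commute_add r(3)) (simp_all add: ax commute_compose)
    qed
    show "C o\<^sub>L (id_blinfun - N) = (id_blinfun - N) o\<^sub>L C"
      by (intro commute_diff commute_id N(3) C * hermitian_commute_adj S)
  next
    fix v assume "(id_blinfun - N) v = 0"
    then have "N v = v" by (simp add: blinfun.diff_left)
    then have "r v + x v = 0" by (simp add: N(2) blinfun.add_left)
    then have "x v = - r v" by (rule minus_unique[symmetric])
    then have "inner (x v) v \<le> 0" using r(1) by (simp add: positive_op_iff)
    then show "inner (S v) v \<le> t * (norm v)\<^sup>2"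
      using s by (simp add: Sx mult_nonneg_nonpos)
  next
    fix v assume "(id_blinfun - N) v = v"
    then have Nv: "N v = 0" by (simp add: blinfun.diff_left)
    \<comment> \<open>As \<open>r\<close> and \<open>x\<close> commute and have equal squares,
      \<open>(r + x)(r - x) = 0\<close>. So \<open>w\<close> and \<open>(r - x) w\<close> both lie
      in the kernel of \<open>r + x\<close>, to which \<open>v\<close> is orthogonal, and
      \<open>inner w w = 0\<close> follows.\<close>
    define w where "w = r v - x v"
    have "(r + x) w = 0" by (simp add: w_def blinfun.bilinear_simps rr rx')
    then have inN: "N w = w" by (simp only: N(2))
    have "(r + x) (r w - x w) = 0" by (simp add: blinfun.bilinear_simps rr rx')
    then have "N (r w - x w) = r w - x w" by (simp only: N(2))
    then have "inner v (r w - x w) = inner (N v) (r w - x w)"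
      by (simp add: hermitian_inner[OF projectionD(1)[OF N(1)]])
    then have "inner v (r w - x w) = 0" using Nv by simp
    moreover have "inner w w = inner v (r w - x w)"
      by (simp add: w_def inner_diff_left inner_diff_right blinfun.diff_right hermitian_inner[OF hr] hermitian_inner[OF hx])
    ultimately have "w = 0" by simp
    then have "x v = r v" by (simp add: w_def)
    then have "0 \<le> inner (x v) v" using r(1) by (simp add: positive_op_iff)
    then show "t * (norm v)\<^sup>2 \<le> inner (S v) v" using s by (simp add: Sx)
  qed
qed

subsection \<open>Extreme points of complete sets\<close>

text \<open>The points of \<open>K\<close> almost farthest from \<open>x\<close> form a slice. Moving \<open>x\<close> slightly away from an
  almost farthest point \<open>k\<^sub>0\<close> shrinks the diameter of the slice (parallelogram law). The common
  point of a shrinking nested sequence of slices is extreme.\<close>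

lemma exists_extreme_point:
  fixes K V :: "'a::real_vector set" and B :: "'a \<Rightarrow> 'a \<Rightarrow> real"
  assumes V: "subspace V" and KV: "K \<subseteq> V" and K0: "K \<noteq> {}"
    and B_add: "\<And>x y z. x \<in> V \<Longrightarrow> y \<in> V \<Longrightarrow> z \<in> V \<Longrightarrow> B (x + y) z = B x z + B y z"
    and B_scale: "\<And>r x y. x \<in> V \<Longrightarrow> y \<in> V \<Longrightarrow> B (r *\<^sub>R x) y = r * B x y"
    and B_sym: "\<And>x y. x \<in> V \<Longrightarrow> y \<in> V \<Longrightarrow> B x y = B y x"
    and B_pos: "\<And>x. x \<in> V \<Longrightarrow> 0 \<le> B x x"
    and B_bound: "\<And>x. x \<in> K \<Longrightarrow> B x x \<le> b"
    and complete: "\<And>f. (\<And>n. f n \<in> K) \<Longrightarrow>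
      (\<And>n. B (f (Suc n) - f n) (f (Suc n) - f n) \<le> (1/8) ^ n) \<Longrightarrow>
      \<exists>k\<in>K. (\<lambda>n. B (f n - k) (f n - k)) \<longlonglongrightarrow> 0"
  shows "\<exists>k\<in>K. \<forall>z\<in>V. k + z \<in> K \<longrightarrow> k - z \<in> K \<longrightarrow> B z z = 0"
proof -
  define q where "q x = B x x" for x
  have KVi: "k \<in> V" if "k \<in> K" for k using that KV by blast
  have diffV: "x - y \<in> V" if "x \<in> V" "y \<in> V" for x y using that V by (rule_tac subspace_diff)
  have scaleV: "r *\<^sub>R x \<in> V" if "x \<in> V" for r x using that V by (rule_tac subspace_scale)
  have addV: "x + y \<in> V" if "x \<in> V" "y \<in> V" for x y using that V by (rule_tac subspace_add)
  have q_expand: "q (x + r *\<^sub>R y) = q x + 2 * r * B x y + r\<^sup>2 * q y" if "x \<in> V" "y \<in> V" for x y r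
  proof -
    have "B x (x + r *\<^sub>R y) = B x x + r * B x y" "B y (x + r *\<^sub>R y) = B x y + r * B y y"
      using that by (simp_all add: B_sym[of _ "x + r *\<^sub>R y"] B_add B_scale addV scaleV B_sym[of y x])
    then show ?thesis
      using that by (simp add: q_def B_add B_scale addV scaleV power2_eq_square algebra_simps)
  qed
  have q_pos: "0 \<le> q x" if "x \<in> V" for x using B_pos that by (simp add: q_def)
  have q_plus: "q (x + y) = q x + 2 * B x y + q y" if "x \<in> V" "y \<in> V" for x y
    using q_expand[OF that, of 1] by simp
  have q_minus: "q (x - y) = q x - 2 * B x y + q y" if "x \<in> V" "y \<in> V" for x y
    using q_expand[OF that, of "-1"] by simp
  have B_le: "\<bar>2 * B x y\<bar> \<le> q x + q y" if "x \<in> V" "y \<in> V" for x y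
    using q_plus[OF that] q_minus[OF that] q_pos[OF addV[OF that]] q_pos[OF diffV[OF that]] by linarith
  have q_diff_le: "q (x - y) \<le> 2 * q x + 2 * q y" if "x \<in> V" "y \<in> V" for x y
    using q_minus[OF that] B_le[OF that] by linarith
  define \<rho> where "\<rho> x = (SUP k\<in>K. q (k - x))" for x
  have bdd: "bdd_above ((\<lambda>k. q (k - x)) ` K)" if "x \<in> V" for x
  proof (rule bdd_aboveI2)
    fix k assume "k \<in> K"
    then show "q (k - x) \<le> 2 * b + 2 * q x"
      using q_diff_le[of k x] that B_bound[of k] KVi by (fastforce simp: q_def)
  qed
  have \<rho>_upper: "q (k - x) \<le> \<rho> x" if "k \<in> K" "x \<in> V" for k x
    unfolding \<rho>_def by (rule cSUP_upper[OF that(1) bdd[OF that(2)]])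
  have \<rho>_approx: "\<exists>k\<in>K. \<rho> x - e < q (k - x)" if "x \<in> V" "e > 0" for x e
  proof -
    have "\<rho> x - e < (SUP k\<in>K. q (k - x))" using that by (simp add: \<rho>_def)
    then show ?thesis using less_cSUP_iff[OF K0 bdd[OF that(1)]] by blast
  qed
  define slice where "slice x e = {k \<in> K. \<rho> x - e \<le> q (k - x)}" for x e
  have step: "\<exists>x' e'. x' \<in> V \<and> 0 < e' \<and> e' \<le> d \<and> slice x' e' \<subseteq> slice x e \<and>
      (\<forall>k\<in>slice x' e'. \<forall>l\<in>slice x' e'. q (k - l) \<le> d)"
    if x: "x \<in> V" and e: "0 < e" and d: "0 < d" for x e d
  proof -
    obtain k1 where k1: "k1 \<in> K" using K0 by blast
    have \<rho>0: "0 \<le> \<rho> x" using \<rho>_upper[OF k1 x] q_pos[OF diffV[OF KVi[OF k1] x]] by linarith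
    \<comment> \<open>Moving the centre by \<open>s\<close> times \<open>k0 - x\<close> raises each
      \<open>q (k - x)\<close> by at most \<open>3 * s * \<rho> x\<close>; this choice keeps the
      increase below \<open>e / 3\<close>.\<close>
    define s where "s = min 1 (e / (9 * (\<rho> x + 1)))"
    have s: "0 < s" "s \<le> 1" using e \<rho>0 by (auto simp: s_def)
    have "s \<le> e / (9 * (\<rho> x + 1))" by (simp add: s_def)
    then have "s * (9 * (\<rho> x + 1)) \<le> e" using \<rho>0 by (simp add: pos_le_divide_eq)
    then have se: "3 * s * \<rho> x \<le> e / 3" using s by (simp add: algebra_simps)
    \<comment> \<open>The bound \<open>e / 3\<close> keeps the new slice inside the old one. The
      bound \<open>s * d / 20\<close> is what the estimate
      \<open>s * q (k - k0) \<le> 5 * e'\<close> below needs in order to give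
      \<open>q (k - k0) \<le> d / 4\<close>.\<close>
    define e' where "e' = min d (min (e / 3) (s * d / 20))"
    have e': "0 < e'" "e' \<le> d" "e' \<le> e / 3" "e' \<le> s * d / 20" using e d s by (auto simp: e'_def)
    obtain k0 where k0: "k0 \<in> K" "\<rho> x - e' < q (k0 - x)" using \<rho>_approx[OF x e'(1)] by blast
    define x' where "x' = x - s *\<^sub>R (k0 - x)"
    have x': "x' \<in> V" unfolding x'_def by (intro diffV scaleV KVi x k0)
    define w where "w = k0 - x"
    have w: "w \<in> V" unfolding w_def by (intro diffV KVi x k0)
    have qw: "q w \<le> \<rho> x" "\<rho> x - e' < q w" "0 \<le> q w"
      using \<rho>_upper[OF k0(1) x] k0(2) q_pos[OF w] by (auto simp: w_def)
    have exp: "q (k - x') = q (k - x) + 2 * s * B (k - x) w + s\<^sup>2 * q w" if "k \<in> K" for k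
    proof -
      have "k - x' = (k - x) + s *\<^sub>R w" by (simp add: x'_def w_def)
      then show ?thesis using q_expand[OF diffV[OF KVi[OF that] x] w, of s] by (simp only:)
    qed
    have near: "q (k - x') - q (k - x) \<le> e / 3" if k: "k \<in> K" for k
    proof -
      have "2 * B (k - x) w \<le> 2 * \<rho> x"
        using B_le[OF diffV[OF KVi[OF k] x] w] \<rho>_upper[OF k x] qw by linarith
      then have "s * (2 * B (k - x) w) \<le> s * (2 * \<rho> x)" using s by (intro mult_left_mono) auto
      moreover have "s\<^sup>2 * q w \<le> s * \<rho> x" using s qw \<rho>0
        by (intro mult_mono) (auto simp: power2_eq_square mult_left_le)
      ultimately show ?thesis using exp[OF k] se by simp
    qed
    have "q (k0 - x') = (1 + s)\<^sup>2 * q w"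
      using exp[OF k0(1)] by (simp add: w_def q_def power2_eq_square algebra_simps)
    then have \<rho>': "(1 + s)\<^sup>2 * q w \<le> \<rho> x'" using \<rho>_upper[OF k0(1) x'] by simp
    have "1 * q w \<le> (1 + s)\<^sup>2 * q w" using s qw by (intro mult_right_mono) auto
    then have \<rho>'': "\<rho> x - e' \<le> \<rho> x'" using \<rho>' qw by simp
    have close: "q (k - k0) \<le> d / 4" if "k \<in> slice x' e'" for k
    proof -
      have k: "k \<in> K" "\<rho> x' - e' \<le> q (k - x')" using that by (auto simp: slice_def)
      have "k - k0 = (k - x) - w" by (simp add: w_def)
      then have "q (k - k0) = q (k - x) - 2 * B (k - x) w + q w"
        using q_minus[OF diffV[OF KVi[OF k(1)] x] w] by (simp only:)
      then have "s * q (k - k0) = s * (q (k - x) - 2 * B (k - x) w + q w)" by (simp only:)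
      then have "s * q (k - k0) = (1 + s) * q (k - x) + (s + s\<^sup>2) * q w - q (k - x')"
        using exp[OF k(1)] by (simp add: algebra_simps)
      also have "\<dots> \<le> (1 + s) * \<rho> x + (s + s\<^sup>2) * \<rho> x - ((1 + s)\<^sup>2 * (\<rho> x - e') - e')"
      proof -
        have "(1 + s) * q (k - x) \<le> (1 + s) * \<rho> x"
          using \<rho>_upper[OF k(1) x] s by (intro mult_left_mono) auto
        moreover have "(s + s\<^sup>2) * q w \<le> (s + s\<^sup>2) * \<rho> x" using qw s by (intro mult_left_mono) auto
        moreover have "(1 + s)\<^sup>2 * (\<rho> x - e') \<le> (1 + s)\<^sup>2 * q w" using qw by (intro mult_left_mono) auto
        ultimately show ?thesis using k(2) \<rho>' by linarith
      qed
      also have "\<dots> = ((1 + s)\<^sup>2 + 1) * e'" by (simp add: power2_eq_square algebra_simps)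
      also have "\<dots> \<le> 5 * e'"
      proof -
        have "(1 + s)\<^sup>2 \<le> 2\<^sup>2" using s by (intro power_mono) auto
        then show ?thesis using e' by (intro mult_right_mono) auto
      qed
      also have "\<dots> \<le> s * (d / 4)" using e' by simp
      finally show ?thesis using s by (simp add: mult_le_cancel_left)
    qed
    have "slice x' e' \<subseteq> slice x e"
    proof
      fix k assume "k \<in> slice x' e'"
      then have k: "k \<in> K" "\<rho> x' - e' \<le> q (k - x')" by (auto simp: slice_def)
      then show "k \<in> slice x e" using near[OF k(1)] \<rho>'' e' by (auto simp: slice_def)
    qed
    moreover have "q (k - l) \<le> d" if "k \<in> slice x' e'" "l \<in> slice x' e'" for k l
    proof -
      have "k - k0 \<in> V" "l - k0 \<in> V" using that k0(1) KVi by (simp_all add: slice_def diffV)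
      from q_diff_le[OF this] show ?thesis using close[OF that(1)] close[OF that(2)] by simp
    qed
    ultimately show ?thesis using x' e' by blast
  qed
  obtain k1 where "k1 \<in> K" using K0 by blast
  then have k1V: "k1 \<in> V" by (rule KVi)
  \<comment> \<open>A pair holds a centre and a slice width. The rate \<open>(1/8) ^ n\<close> is
    the one for which completeness is assumed; \<open>unit_ball_complete\<close> needs a rate that
    leaves a summable rest after multiplication by \<open>2 ^ (n + 1)\<close>.\<close>
  have "\<exists>f. \<forall>n. (fst (f n) \<in> V \<and> 0 < snd (f n)) \<and>
      (snd (f (Suc n)) \<le> (1/8) ^ n \<and>
       slice (fst (f (Suc n))) (snd (f (Suc n))) \<subseteq> slice (fst (f n)) (snd (f n)) \<and>
       (\<forall>k\<in>slice (fst (f (Suc n))) (snd (f (Suc n))). \<forall>l\<in>slice (fst (f (Suc n))) (snd (f (Suc n))).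
          q (k - l) \<le> (1/8) ^ n))"
  proof (rule dependent_nat_choice)
    show "\<exists>x :: 'a \<times> real. fst x \<in> V \<and> 0 < snd x" using k1V by (intro exI[of _ "(k1, 1)"]) simp
    fix x :: "'a \<times> real" and n :: nat assume "fst x \<in> V \<and> 0 < snd x"
    then obtain x' e' where "x' \<in> V" "0 < e'" "e' \<le> (1/8) ^ n" "slice x' e' \<subseteq> slice (fst x) (snd x)"
      "\<forall>k\<in>slice x' e'. \<forall>l\<in>slice x' e'. q (k - l) \<le> (1/8) ^ n"
      using step[of "fst x" "snd x" "(1/8) ^ n"] by auto
    then show "\<exists>y. (fst y \<in> V \<and> 0 < snd y) \<and> snd y \<le> (1/8) ^ n \<and>
        slice (fst y) (snd y) \<subseteq> slice (fst x) (snd x) \<and>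
        (\<forall>k\<in>slice (fst y) (snd y). \<forall>l\<in>slice (fst y) (snd y). q (k - l) \<le> (1/8) ^ n)"
      by (intro exI[of _ "(x', e')"]) simp
  qed
  then obtain f where f: "\<And>n. fst (f n) \<in> V" "\<And>n. 0 < snd (f n)" "\<And>n. snd (f (Suc n)) \<le> (1/8) ^ n"
    "\<And>n. slice (fst (f (Suc n))) (snd (f (Suc n))) \<subseteq> slice (fst (f n)) (snd (f n))"
    "\<And>n k l. k \<in> slice (fst (f (Suc n))) (snd (f (Suc n))) \<Longrightarrow>
       l \<in> slice (fst (f (Suc n))) (snd (f (Suc n))) \<Longrightarrow> q (k - l) \<le> (1/8) ^ n"
    by metis
  define sl where "sl n = slice (fst (f n)) (snd (f n))" for n
  have sl_mono: "sl n \<subseteq> sl m" if "m \<le> n" for m n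
    by (rule lift_Suc_antimono_le[OF _ that]) (simp add: sl_def f(4))
  have slK: "sl n \<subseteq> K" for n by (auto simp: sl_def slice_def)
  have ne: "\<exists>k. k \<in> sl n" for n
    using \<rho>_approx[OF f(1) f(2), of n n] by (auto simp: sl_def slice_def intro: less_imp_le)
  have "\<forall>n. \<exists>k. k \<in> sl (Suc n)" using ne by blast
  then obtain k where k: "\<And>n. k n \<in> sl (Suc n)" by metis
  have kK: "k n \<in> K" for n using k slK by blast
  have "B (k (Suc n) - k n) (k (Suc n) - k n) \<le> (1/8) ^ n" for n
    using f(5)[of "k (Suc n)" n "k n"] k[of n] k[of "Suc n"] sl_mono[of "Suc n" "Suc (Suc n)"]
    by (auto simp: sl_def q_def)
  then obtain c where c: "c \<in> K" "(\<lambda>n. q (k n - c)) \<longlonglongrightarrow> 0"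
    using complete[of k] kK by (auto simp: q_def)
  have "B z z = 0" if z: "z \<in> V" "c + z \<in> K" "c - z \<in> K" for z
  proof -
    have le: "q z \<le> (1/8) ^ n" for n
    proof -
      define x where "x = fst (f (Suc n))"
      define e where "e = snd (f (Suc n))"
      have x: "x \<in> V" and e: "e \<le> (1/8) ^ n" using f by (auto simp: x_def e_def)
      have cx: "c - x \<in> V" by (intro diffV KVi c x)
      have "q ((c - x) + z) \<le> \<rho> x" "q ((c - x) - z) \<le> \<rho> x"
        using \<rho>_upper[OF z(2) x] \<rho>_upper[OF z(3) x] by (simp_all add: algebra_simps)
      then have 1: "q (c - x) + q z \<le> \<rho> x" using q_plus[OF cx z(1)] q_minus[OF cx z(1)] by linarith
      \<comment> \<open>The slices are not known to be closed for \<open>q\<close>, so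
        \<open>c\<close> is compared with \<open>k m\<close> by a weighted Young inequality. Letting
        first \<open>m\<close> grow and then \<open>\<theta>\<close> tend to 0 shows that
        \<open>c\<close> still lies in the slice, and fact \<open>1\<close> then bounds
        \<open>q z\<close> by its width.\<close>
      have 2: "\<rho> x - e \<le> (1 + 1/\<theta>) * q (k m - c) + (1 + \<theta>) * q (c - x)" if "m \<ge> n" "\<theta> > 0" for m \<theta>
      proof -
        have kc: "k m - c \<in> V" by (intro diffV KVi kK c)
        have "k m \<in> sl (Suc n)" using k[of m] sl_mono[of "Suc n" "Suc m"] that by auto
        then have "\<rho> x - e \<le> q (k m - x)" by (simp add: sl_def slice_def x_def e_def)
        also have "k m - x = (k m - c) + (c - x)" by simp
        also have "q \<dots> = q (k m - c) + 2 * B (k m - c) (c - x) + q (c - x)"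
          by (rule q_plus[OF kc cx])
        finally have *: "\<rho> x - e \<le> q (k m - c) + 2 * B (k m - c) (c - x) + q (c - x)" .
        have "0 \<le> q ((k m - c) + (- \<theta>) *\<^sub>R (c - x))" by (intro q_pos addV scaleV kc cx)
        then have "2 * \<theta> * B (k m - c) (c - x) \<le> q (k m - c) + \<theta>\<^sup>2 * q (c - x)"
          using q_expand[OF kc cx, of "- \<theta>"] by simp
        then have "2 * B (k m - c) (c - x) \<le> (1/\<theta>) * q (k m - c) + \<theta> * q (c - x)"
          using that(2) by (simp add: field_simps power2_eq_square)
        with * show ?thesis by (simp add: algebra_simps)
      qed
      have 3: "\<rho> x - e \<le> (1 + \<theta>) * q (c - x)" if "\<theta> > 0" for \<theta>
      proof -
        have "(\<lambda>m. (1 + 1/\<theta>) * q (k m - c) + (1 + \<theta>) * q (c - x)) \<longlonglongrightarrow> (1 + 1/\<theta>) * 0 + (1 + \<theta>) * q (c - x)"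
          by (intro tendsto_intros c)
        then have "\<rho> x - e \<le> (1 + 1/\<theta>) * 0 + (1 + \<theta>) * q (c - x)"
          by (rule LIMSEQ_le_const) (use 2 that in blast)
        then show ?thesis by simp
      qed
      have "\<rho> x - e \<le> q (c - x)"
      proof (rule field_le_epsilon)
        fix d :: real assume d: "0 < d"
        have p: "0 < q (c - x) + 1" using q_pos[OF cx] by simp
        have "\<rho> x - e \<le> (1 + d / (q (c - x) + 1)) * q (c - x)" using d p by (intro 3) auto
        also have "\<dots> = q (c - x) + d * (q (c - x) / (q (c - x) + 1))" by (simp add: algebra_simps)
        also have "\<dots> \<le> q (c - x) + d * 1"
          using d p q_pos[OF cx] by (intro add_left_mono mult_left_mono) auto
        finally show "\<rho> x - e \<le> q (c - x) + d" by simp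
      qed
      then show ?thesis using 1 e by linarith
    qed
    have "(\<lambda>n. (1/8::real) ^ n) \<longlonglongrightarrow> 0" by (rule LIMSEQ_power_zero) simp
    then have "q z \<le> 0" by (rule LIMSEQ_le_const) (use le in blast)
    then show ?thesis using q_pos[OF z(1)] by (simp add: q_def)
  qed
  then show ?thesis using c(1) by blast
qed

subsection \<open>Von Neumann algebras\<close>

lemma commutantI: "T \<in> cbounded_ops \<Longrightarrow> (\<And>S. S \<in> B \<Longrightarrow> T o\<^sub>L S = S o\<^sub>L T) \<Longrightarrow> T \<in> commutant B"
  by (simp add: commutant_def)

lemma commutantD: "T \<in> commutant B \<Longrightarrow> S \<in> B \<Longrightarrow> T o\<^sub>L S = S o\<^sub>L T" "T \<in> commutant B \<Longrightarrow> T \<in> cbounded_ops"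
  by (auto simp: commutant_def)

lemma scaleR_eq_scaleC_op: "r *\<^sub>R T = scaleC_op (complex_of_real r) T"
  by (rule blinfun_eqI) (simp add: blinfun.scaleR_left scaleC_of_real)

lemma commutant_adj:
  assumes "\<And>S. S \<in> B \<Longrightarrow> S \<in> cbounded_ops" "\<And>S. S \<in> B \<Longrightarrow> adj S \<in> B" "T \<in> commutant B"
  shows "adj T \<in> commutant B"
proof (rule commutantI)
  have T: "T \<in> cbounded_ops" using assms(3) by (rule commutantD)
  then show "adj T \<in> cbounded_ops" by simp
  fix S assume S: "S \<in> B"
  then have "adj (T o\<^sub>L adj S) = adj (adj S o\<^sub>L T)"
    using commutantD(1)[OF assms(3) assms(2)[OF S]] by simp
  then show "adj T o\<^sub>L S = S o\<^sub>L adj T"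
    using T assms(1)[OF S] by (simp add: adj_compose)
qed

lemma commutant_closure:
  assumes "S \<in> commutant B" "T \<in> commutant B"
  shows "S + T \<in> commutant B" "S - T \<in> commutant B" "S o\<^sub>L T \<in> commutant B"
proof -
  have c: "S \<in> cbounded_ops" "T \<in> cbounded_ops" using assms commutantD by blast+
  show "S + T \<in> commutant B" "S - T \<in> commutant B"
    using commutantD(1)[OF assms(1)] commutantD(1)[OF assms(2)] c
    by (auto intro!: commutantI commute_add[symmetric] commute_diff[symmetric])
  show "S o\<^sub>L T \<in> commutant B"
    using commutantD(1)[OF assms(1)] commutantD(1)[OF assms(2)] c
    by (intro commutantI commute_compose[symmetric] cbounded_ops_intros) simp_all
qed

lemma commute_scaleC:
  assumes "C o\<^sub>L T = T o\<^sub>L C" "C \<in> cbounded_ops"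
  shows "C o\<^sub>L scaleC_op c T = scaleC_op c T o\<^sub>L C"
  using assms by (intro commuteI) (simp add: cbounded_ops_apply commute_apply)

lemma star_subalgebra_commutant:
  assumes "\<And>S. S \<in> B \<Longrightarrow> S \<in> cbounded_ops" "\<And>S. S \<in> B \<Longrightarrow> adj S \<in> B"
  shows "star_subalgebra (commutant B)"
  unfolding star_subalgebra_def
proof (intro conjI ballI allI commutant_closure commutant_adj assms)
  show "commutant B \<subseteq> cbounded_ops" "0 \<in> commutant B" by (auto simp: commutant_def)
  show "scaleC_op c T \<in> commutant B" if "T \<in> commutant B" for c T
    using that assms(1) by (auto intro!: commutantI commute_scaleC[symmetric] dest: commutantD)
qed

text \<open>The operator is \<open>g = h (1 + h)^-1\<close>. Its quadratic form at \<open>v\<close>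
  is the minimum over \<open>y\<close> of \<open>inner (h y) y + (norm (v - y))\<^sup>2\<close>.
  This variational form shows at once that \<open>g\<close> increases with \<open>h\<close> and is
  bounded by \<open>h\<close> (take \<open>z = v\<close>) and by 1 (take
  \<open>z = 0\<close>).\<close>

lemma resolvent_exists:
  fixes h :: "'h::complex_hilbert op"
  assumes h: "positive_op h"
  obtains g where "positive_op g" "norm g \<le> 1"
    "\<And>v. \<exists>y. inner (blinfun_apply g v) v = inner (h y) y + (norm (v - y))\<^sup>2"
    "\<And>v z. inner (g v) v \<le> inner (h z) z + (norm (v - z))\<^sup>2"
    "\<And>C. C o\<^sub>L h = h o\<^sub>L C \<Longrightarrow> C o\<^sub>L g = g o\<^sub>L C"
proof -
  define f where "f = id_blinfun + h"
  have fv: "f v = v + h v" for v by (simp add: f_def blinfun.add_left)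
  have hh: "hermitian h" and hp: "\<And>v. 0 \<le> inner (h v) v" using h by (auto simp: positive_op_iff)
  have low: "norm v \<le> norm (f v)" for v
  proof -
    have "norm v * norm v \<le> inner (f v) v"
      using hp[of v] by (simp add: fv inner_add_left flip: power2_norm_eq_inner power2_eq_square)
    also have "\<dots> \<le> norm (f v) * norm v" by (rule norm_cauchy_schwarz)
    finally show ?thesis by (cases "v = 0") auto
  qed
  \<comment> \<open>\<open>1 + h\<close> does not shrink vectors, so its range is closed; a vector
    orthogonal to the range vanishes by positivity of \<open>h\<close>, so the range is
    everything.\<close>
  have "complete (range f)"
    by (rule complete_isometric_image[where e = 1])
      (auto simp: low complete_UNIV intro: blinfun.bounded_linear_right)
  then have "closed (range f)" by (rule complete_imp_closed)
  moreover have "subspace (range f)"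
    by (rule linear_subspace_image) (auto intro: bounded_linear.linear blinfun.bounded_linear_right)
  ultimately have near: "\<exists>p\<in>range f. \<forall>v\<in>range f. inner (x - p) v = 0" for x
    by (rule closed_subspace_nearest_point)
  have "\<exists>y. f y = x" for x
  proof -
    obtain p where p: "p \<in> range f" "\<And>v. inner (x - p) (f v) = 0" using near[of x] by auto
    have "inner (x - p) (x - p) + inner (h (x - p)) (x - p) = 0"
      using p(2)[of "x - p"] by (simp add: fv inner_add_right inner_commute)
    then have "inner (x - p) (x - p) \<le> 0" using hp[of "x - p"] by linarith
    then have "x = p" using inner_ge_zero[of "x - p"] by (simp add: antisym_conv)
    then show ?thesis using p(1) by auto
  qed
  then obtain k where k: "\<And>x. f (k x) = x" by metis
  have inj: "x = y" if "f x = f y" for x y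
    using low[of "x - y"] that by (simp add: blinfun.diff_right)
  have kf: "k (f x) = x" for x using k[of "f x"] inj by blast
  have bl: "bounded_linear k"
  proof (rule bounded_linear_intro[where K = 1])
    show "k (x + y) = k x + k y" for x y by (rule inj) (simp add: k blinfun.add_right)
    show "k (r *\<^sub>R x) = r *\<^sub>R k x" for r x by (rule inj) (simp add: k blinfun.scaleR_right)
    show "norm (k x) \<le> norm x * 1" for x using low[of "k x"] by (simp add: k)
  qed
  define g where "g = id_blinfun - Blinfun k"
  have gv: "g v = v - k v" for v by (simp add: g_def blinfun.diff_left bounded_linear_Blinfun_apply bl)
  have gh: "g v = h (k v)" for v using k[of v] by (simp add: gv fv algebra_simps)
  have gk: "inner (g v) v = inner (h (k v)) (k v) + (norm (v - k v))\<^sup>2" for v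
  proof -
    have "v = k v + h (k v)" using k[of v] by (simp add: fv)
    then have "inner (h (k v)) v = inner (h (k v)) (k v) + inner (h (k v)) (h (k v))"
      by (metis inner_add_right)
    moreover have "v - k v = h (k v)" using gh gv by metis
    ultimately show ?thesis by (simp add: gh power2_norm_eq_inner)
  qed
  \<comment> \<open>With \<open>z = y + u\<close> around the minimizer \<open>y\<close> the cross
    terms cancel and only nonnegative terms in \<open>u\<close> remain.\<close>
  have min: "inner (g v) v \<le> inner (h z) z + (norm (v - z))\<^sup>2" for v z
  proof -
    define y u where "y = k v" and "u = z - k v"
    have v: "v = y + h y" using k[of v] by (simp add: fv y_def)
    have z: "z = y + u" by (simp add: y_def u_def)
    have "inner (h z) z + (norm (v - z))\<^sup>2 =
        inner (h y) y + (norm (h y))\<^sup>2 + inner (h u) u + (norm u)\<^sup>2"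
      using hermitian_inner[OF hh, of u y]
      by (simp add: z v blinfun.bilinear_simps inner_simps inner_commute power2_norm_eq_inner)
    moreover have "inner (g v) v = inner (h y) y + (norm (h y))\<^sup>2"
      using gk[of v] gh[of v] gv[of v] by (simp add: y_def)
    ultimately show ?thesis using hp[of u] by simp
  qed
  have gcb: "g \<in> cbounded_ops"
  proof (rule cbounded_opsI)
    fix c x
    have "k (c *\<^sub>C x) = c *\<^sub>C k x"
    proof (rule inj)
      have "f (c *\<^sub>C k x) = c *\<^sub>C f (k x)"
        using hermitian_cbounded[OF hh] by (simp add: fv cbounded_ops_apply scaleC_add_right)
      then show "f (k (c *\<^sub>C x)) = f (c *\<^sub>C k x)" by (simp add: k)
    qed
    then show "g (c *\<^sub>C x) = c *\<^sub>C g x" by (simp add: gv scaleC_diff)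
  qed
  have gsym: "inner (g u) v = inner u (g v)" for u v
  proof -
    have "inner (k u) (f (k v)) = inner (f (k u)) (k v)"
      by (simp add: fv inner_add_left inner_add_right hermitian_inner[OF hh])
    then show ?thesis by (simp add: gv k inner_diff_left inner_diff_right)
  qed
  have gpos: "0 \<le> inner (g v) v" for v using gk[of v] hp[of "k v"] by simp
  have hg: "hermitian g" using gcb gsym by (simp add: hermitian_iff)
  show thesis
  proof (rule that[of g])
    show "positive_op g" using hg gpos by (simp add: positive_op_iff)
    show "norm g \<le> 1"
    proof (rule hermitian_norm_le[OF hg])
      show "\<bar>inner (g v) v\<bar> \<le> 1 * (norm v)\<^sup>2" for v using gpos[of v] min[of v 0] by simp
    qed simp
    show "\<exists>y. inner (g v) v = inner (h y) y + (norm (v - y))\<^sup>2" for v using gk by blast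
    show "inner (g v) v \<le> inner (h z) z + (norm (v - z))\<^sup>2" for v z by (rule min)
    fix C :: "'h op" assume C: "C o\<^sub>L h = h o\<^sub>L C"
    show "C o\<^sub>L g = g o\<^sub>L C"
    proof (rule commuteI)
      fix v
      have "f (C (k v)) = C (f (k v))" by (simp add: fv blinfun.add_right commute_apply[OF C])
      then have "f (C (k v)) = C v" by (simp add: k)
      then have "C (k v) = k (C v)" using kf by metis
      then show "C (g v) = g (C v)" by (simp add: gv blinfun.diff_right)
    qed
  qed
qed

locale vna =
  fixes M :: "'h::complex_hilbert op set"
  assumes vna: "von_neumann_algebra M"
begin

lemma cbounded [simp, dest]: "T \<in> M \<Longrightarrow> T \<in> cbounded_ops"
  using vna by (auto simp: von_neumann_algebra_def star_subalgebra_def)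

lemma zero_mem [simp, intro]: "0 \<in> M"
  and add_mem [simp, intro]: "S \<in> M \<Longrightarrow> T \<in> M \<Longrightarrow> S + T \<in> M"
  and scaleC_mem [simp, intro]: "T \<in> M \<Longrightarrow> scaleC_op c T \<in> M"
  and compose_mem [simp, intro]: "S \<in> M \<Longrightarrow> T \<in> M \<Longrightarrow> S o\<^sub>L T \<in> M"
  and adj_mem [simp, intro]: "T \<in> M \<Longrightarrow> adj T \<in> M"
  using vna by (auto simp: von_neumann_algebra_def star_subalgebra_def)

lemma mem_if_commute:
  "T \<in> cbounded_ops \<Longrightarrow> (\<And>C. C \<in> commutant M \<Longrightarrow> C o\<^sub>L T = T o\<^sub>L C) \<Longrightarrow> T \<in> M"
  using vna commutantI[of T "commutant M"] by (simp add: von_neumann_algebra_def)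

lemma commutant_commute: "T \<in> M \<Longrightarrow> C \<in> commutant M \<Longrightarrow> C o\<^sub>L T = T o\<^sub>L C"
  by (rule commutantD)

text \<open>Operators built from a single \<open>S\<close>, such as spectral projections and bounded
  transforms, are recognised as elements of \<open>M\<close> in this way: their construction makes
  them commute with all that commutes with \<open>S\<close>, in particular with the commutant of
  \<open>M\<close>.\<close>

lemma mem_if_commutes:
  assumes "T \<in> cbounded_ops" "S \<in> M"
    and "\<And>C. C \<in> cbounded_ops \<Longrightarrow> C o\<^sub>L S = S o\<^sub>L C \<Longrightarrow> C o\<^sub>L T = T o\<^sub>L C"
  shows "T \<in> M"
proof (rule mem_if_commute[OF assms(1)])
  show "C o\<^sub>L T = T o\<^sub>L C" if "C \<in> commutant M" for C
    using that assms(2) by (intro assms(3) commutant_commute commutantD(2)[OF that])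
qed

lemma id_mem [simp, intro]: "id_blinfun \<in> M"
  by (rule mem_if_commute) auto

lemma scaleR_mem [simp, intro]: "T \<in> M \<Longrightarrow> r *\<^sub>R T \<in> M"
  by (simp add: scaleR_eq_scaleC_op)

lemma uminus_mem [simp, intro]: "T \<in> M \<Longrightarrow> - T \<in> M"
  using scaleR_mem[of T "-1"] by simp

lemma diff_mem [simp, intro]: "S \<in> M \<Longrightarrow> T \<in> M \<Longrightarrow> S - T \<in> M"
  using add_mem[of S "- T"] by simp

lemma sum_mem [intro]: "(\<And>i. i \<in> I \<Longrightarrow> f i \<in> M) \<Longrightarrow> sum f I \<in> M"
  by (induction I rule: infinite_finite_induct) auto

lemma subspace_M: "subspace M"
  by (auto simp: subspace_def)

lemma sot_limit_mem:
  assumes "\<And>n. x n \<in> M" "\<And>v. (\<lambda>n. x n v) \<longlonglongrightarrow> blinfun_apply T v"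
  shows "T \<in> M"
proof (rule mem_if_commute)
  show "T \<in> cbounded_ops" using sot_limit_cbounded[OF cbounded] assms by blast
  show "C o\<^sub>L T = T o\<^sub>L C" if "C \<in> commutant M" for C
    using commutant_commute[OF assms(1) that] assms(2) by (rule sot_limit_commute)
qed

lemma spectral_projection_mem:
  assumes "S \<in> M" "hermitian S"
  obtains e where "e \<in> M" "projection e" "\<And>C. C \<in> cbounded_ops \<Longrightarrow> C o\<^sub>L S = S o\<^sub>L C \<Longrightarrow> C o\<^sub>L e = e o\<^sub>L C"
    "\<And>v. e v = v \<Longrightarrow> t * (norm v)\<^sup>2 \<le> inner (S v) v" "\<And>v. e v = 0 \<Longrightarrow> inner (S v) v \<le> t * (norm v)\<^sup>2"
proof -
  obtain e where e: "projection e" "\<And>C. C \<in> cbounded_ops \<Longrightarrow> C o\<^sub>L S = S o\<^sub>L C \<Longrightarrow> C o\<^sub>L e = e o\<^sub>L C"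
    "\<And>v. e v = v \<Longrightarrow> t * (norm v)\<^sup>2 \<le> inner (S v) v" "\<And>v. e v = 0 \<Longrightarrow> inner (S v) v \<le> t * (norm v)\<^sup>2"
    by (rule spectral_projection[OF assms(2), where t = t], rule that)
  have "e \<in> M" by (rule mem_if_commutes[OF projectionD(3)[OF e(1)] assms(1) e(2)])
  then show thesis using that e by blast
qed

lemma positive_op_dominates_projection:
  assumes "w \<in> M" "positive_op w" "w \<noteq> 0"
  obtains e t where "e \<in> M" "projection e" "e \<noteq> 0" "0 < t"
    "\<And>v. t * (norm (e v))\<^sup>2 \<le> inner (w v) v"
    "\<And>C. C \<in> cbounded_ops \<Longrightarrow> C o\<^sub>L w = w o\<^sub>L C \<Longrightarrow> C o\<^sub>L e = e o\<^sub>L C"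
proof -
  have hw: "hermitian w" and wp: "\<And>v. 0 \<le> inner (w v) v" using assms(2) by (auto simp: positive_op_iff)
  \<comment> \<open>Any value strictly between 0 and \<open>norm w\<close> serves: if
    \<open>e\<close> were 0, then \<open>w\<close> would be bounded by
    \<open>t < norm w\<close>.\<close>
  define t where "t = norm w / 2"
  have t: "0 < t" "t < norm w" using assms(3) by (auto simp: t_def)
  obtain e where e: "e \<in> M" "projection e" "\<And>C. C \<in> cbounded_ops \<Longrightarrow> C o\<^sub>L w = w o\<^sub>L C \<Longrightarrow> C o\<^sub>L e = e o\<^sub>L C"
    "\<And>v. e v = v \<Longrightarrow> t * (norm v)\<^sup>2 \<le> inner (w v) v" "\<And>v. e v = 0 \<Longrightarrow> inner (w v) v \<le> t * (norm v)\<^sup>2"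
    by (rule spectral_projection_mem[OF assms(1) hw, where t = t], rule that)
  have "e \<noteq> 0"
  proof
    assume "e = 0"
    then have "inner (w v) v \<le> t * (norm v)\<^sup>2" for v using e(5) by simp
    then have "norm w \<le> t" using wp t by (intro hermitian_norm_le[OF hw]) auto
    then show False using t by simp
  qed
  moreover have "t * (norm (e v))\<^sup>2 \<le> inner (w v) v" for v
  proof -
    have c: "w (e v) = e (w v)"
      using e(3)[of w] assms(1) by (simp add: commute_apply)
    have he: "inner (e x) y = inner x (e y)" for x y
      using e(2) projectionD hermitian_inner by blast
    have ee: "e (e x) = e x" for x using e(2) by (rule projectionD)
    have "inner (w v) v = inner (w (e v)) (e v) + inner (w (v - e v)) (v - e v)"
      by (simp add: blinfun.bilinear_simps inner_simps c he ee flip: he)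
    moreover have "t * (norm (e v))\<^sup>2 \<le> inner (w (e v)) (e v)" by (rule e(4)) (rule ee)
    ultimately show ?thesis using wp[of "v - e v"] by simp
  qed
  ultimately show thesis using that e t by blast
qed

end

section \<open>Faithful normal tracial states and the trace norm\<close>

locale tracial_vna = vna M for M :: "'h::complex_hilbert op set" +
  fixes \<tau> :: "'h op \<Rightarrow> complex"
  assumes trace: "is_trace M \<tau>"
begin

definition tr :: "'h op \<Rightarrow> real" where "tr X = Re (\<tau> X)"

lemma tr_add: "S \<in> M \<Longrightarrow> T \<in> M \<Longrightarrow> tr (S + T) = tr S + tr T"
  using trace by (simp add: tr_def is_trace_def tracial_state_def linear_functional_on_def)

lemma tr_scaleR: "T \<in> M \<Longrightarrow> tr (r *\<^sub>R T) = r * tr T"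
  using trace
  by (simp add: tr_def is_trace_def tracial_state_def linear_functional_on_def scaleR_eq_scaleC_op)

lemma tr_uminus: "T \<in> M \<Longrightarrow> tr (- T) = - tr T"
  using tr_scaleR[of T "-1"] by simp

lemma tr_diff: "S \<in> M \<Longrightarrow> T \<in> M \<Longrightarrow> tr (S - T) = tr S - tr T"
  using tr_add[of S "- T"] by (simp add: tr_uminus)

lemma tr_zero [simp]: "tr 0 = 0"
  using tr_scaleR[of 0 0] by simp

lemma tr_id [simp]: "tr id_blinfun = 1"
  using trace by (simp add: tr_def is_trace_def tracial_state_def)

lemma tr_sum: "(\<And>i. i \<in> I \<Longrightarrow> f i \<in> M) \<Longrightarrow> tr (sum f I) = (\<Sum>i\<in>I. tr (f i))"
  by (induction I rule: infinite_finite_induct) (auto simp: tr_add sum_mem)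

lemma tr_commute: "S \<in> M \<Longrightarrow> T \<in> M \<Longrightarrow> tr (S o\<^sub>L T) = tr (T o\<^sub>L S)"
  using trace by (simp add: tr_def is_trace_def tracial_state_def)

lemma tr_pos: "T \<in> M \<Longrightarrow> positive_op T \<Longrightarrow> 0 \<le> tr T"
  using trace by (simp add: tr_def is_trace_def tracial_state_def)

lemma tr_faithful: "T \<in> M \<Longrightarrow> positive_op T \<Longrightarrow> tr T = 0 \<Longrightarrow> T = 0"
  using trace by (auto simp: tr_def is_trace_def tracial_state_def faithful_on_def complex_eq_iff
      complex_is_Real_iff)

lemma tr_mono:
  assumes "S \<in> M" "T \<in> M" "hermitian S" "hermitian T" "\<And>v. inner (S v) v \<le> inner (T v) v"
  shows "tr S \<le> tr T"
proof -
  have "positive_op (T - S)"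
    using assms by (simp add: positive_op_iff blinfun.diff_left inner_diff_left)
  then show ?thesis using tr_pos[of "T - S"] assms by (simp add: tr_diff)
qed

text \<open>Normality is formulated for directed families and suprema inside \<open>M\<close>. An
  increasing sequence is directed, and its strong limit is its supremum because quadratic forms pass
  to the limit.\<close>

lemma tr_normal:
  assumes mem: "\<And>n. x n \<in> M" and h: "\<And>n. hermitian (x n)" and c: "\<And>n. tr (x n) \<le> c"
    and mono: "\<And>m n v. m \<le> n \<Longrightarrow> inner (blinfun_apply (x m) v) v \<le> inner (x n v) v"
    and T: "T \<in> M" "hermitian T" "\<And>v. (\<lambda>n. x n v) \<longlonglongrightarrow> blinfun_apply T v"
  shows "tr T \<le> c"
proof -
  have le: "inner (x n v) v \<le> inner (T v) v" for n v
    by (rule LIMSEQ_le_const[where X = "\<lambda>n. inner (x n v) v"]) (auto intro!: tendsto_intros T mono)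
  have "herm_lub_in M (range x) T"
    unfolding herm_lub_in_def
  proof (intro conjI ballI impI T)
    show "op_le S T" if "S \<in> range x" for S
      using that le h T by (auto simp: op_le_iff)
    fix Y assume Y: "Y \<in> M" "hermitian Y \<and> (\<forall>S\<in>range x. op_le S Y)"
    have "inner (T v) v \<le> inner (Y v) v" for v
    proof (rule LIMSEQ_le_const2[where X = "\<lambda>n. inner (x n v) v"])
      show "(\<lambda>n. inner (x n v) v) \<longlonglongrightarrow> inner (T v) v" by (intro tendsto_intros T)
      show "\<exists>N. \<forall>n\<ge>N. inner (x n v) v \<le> inner (Y v) v" using Y h by (auto simp: op_le_iff)
    qed
    then show "op_le T Y" using Y T by (simp add: op_le_iff)
  qed
  moreover have "\<exists>R\<in>range x. op_le S R \<and> op_le S' R" if S: "S \<in> range x" "S' \<in> range x" for S S'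
  proof -
    obtain m n where "S = x m" "S' = x n" using S by blast
    then show ?thesis using h mono by (intro bexI[of _ "x (max m n)"]) (auto simp: op_le_iff)
  qed
  moreover have "range x \<subseteq> {T \<in> M. hermitian T}" using mem h by blast
  ultimately have "Re (\<tau> T) = (SUP S\<in>range x. Re (\<tau> S))"
    using trace unfolding is_trace_def normal_on_def by blast
  also have "\<dots> \<le> c" using c by (intro cSUP_least) (auto simp: tr_def)
  finally show ?thesis by (simp add: tr_def)
qed

abbreviation tnorm2 :: "'h op \<Rightarrow> real" where "tnorm2 X \<equiv> tr (adj X o\<^sub>L X)"

lemma positive_adj_compose: "X \<in> cbounded_ops \<Longrightarrow> positive_op (adj X o\<^sub>L X)"
  by (simp add: positive_op_iff inner_adj_left)

lemma inner_adj_compose: "X \<in> cbounded_ops \<Longrightarrow> inner ((adj X o\<^sub>L X) v) v = (norm (X v))\<^sup>2"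
  by (simp add: inner_adj_left power2_norm_eq_inner)

lemma tnorm2_pos: "X \<in> M \<Longrightarrow> 0 \<le> tnorm2 X"
  by (intro tr_pos positive_adj_compose) auto

lemma tnorm2_le:
  assumes "X \<in> M" "T \<in> M" "hermitian T" "\<And>v. (norm (X v))\<^sup>2 \<le> inner (T v) v"
  shows "tnorm2 X \<le> tr T"
  using assms(4) inner_adj_compose[of X] assms(1-3) by (intro tr_mono) auto

lemma tnorm2_faithful:
  assumes "X \<in> M" "tnorm2 X = 0"
  shows "X = 0"
proof -
  have "adj X o\<^sub>L X = 0" using assms by (intro tr_faithful positive_adj_compose) auto
  then have "(norm (X v))\<^sup>2 = 0" for v using inner_adj_compose[of X v] assms by simp
  then show ?thesis by (intro blinfun_eqI) simp
qed

text \<open>The unit ball is complete for \<open>\<parallel>X\<parallel>\<^sub>2\<^sup>2 = \<tau>(X\<^sup>*X)\<close>. With \<open>d\<^sub>n = x\<^sub>n\<^sub>+\<^sub>1 - x\<^sub>n\<close> the Cauchy--Schwarz inequality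
  gives \<open>|x\<^sub>m - x\<^sub>N|\<^sup>2 \<le> h\<^sub>N\<^sub>,\<^sub>m = \<Sum> 2\<^sup>n\<^sup>+\<^sup>1 |d\<^sub>n|\<^sup>2\<close>, where the sums \<open>h\<^sub>N\<^sub>,\<^sub>m\<close> have small trace but need not be bounded.
  The bounded operators \<open>g = h (1 + h)\<^sup>-\<^sup>1\<close> are still increasing in \<open>m\<close>, have small trace, and satisfy
  \<open>|x\<^sub>m - x\<^sub>N|\<^sup>2 \<le> 8 g\<close>; normality bounds the trace of their suprema.\<close>

lemma unit_ball_complete:
  assumes mem: "\<And>n. x n \<in> M" and n1: "\<And>n. norm (x n) \<le> 1"
    and small: "\<And>n. tnorm2 (x (Suc n) - x n) \<le> (1/8) ^ n"
  obtains y where "y \<in> M" "\<And>v. (\<lambda>n. x n v) \<longlonglongrightarrow> blinfun_apply y v" "(\<lambda>n. tnorm2 (x n - y)) \<longlonglongrightarrow> 0"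
proof -
  define d where "d n = x (Suc n) - x n" for n
  have dM: "d n \<in> M" for n by (simp add: d_def mem)
  define h where "h N m = (\<Sum>n=N..<m. 2 ^ (n + 1) *\<^sub>R (adj (d n) o\<^sub>L d n))" for N m
  have hM: "h N m \<in> M" for N m unfolding h_def by (intro sum_mem scaleR_mem compose_mem adj_mem dM)
  have hh: "hermitian (h N m)" for N m unfolding h_def using dM by (intro hermitian_sum hermitian_intros) auto
  have h_inner: "inner (h N m v) v = (\<Sum>n=N..<m. 2 ^ (n + 1) * (norm (d n v))\<^sup>2)" for N m v
    using dM by (simp add: h_def blinfun.sum_left inner_sum_left blinfun.scaleR_left inner_adj_left
      power2_norm_eq_inner)
  have h_pos: "positive_op (h N m)" for N m
    by (auto simp: positive_op_iff hh h_inner intro!: sum_nonneg)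
  have h_mono: "inner (h N m v) v \<le> inner (h N' m' v) v" if "N' \<le> N" "m \<le> m'" for N m N' m' v
    unfolding h_inner using that by (intro sum_mono2) auto
  have tr_h: "tr (h N m) \<le> 4 * (1/4) ^ N" for N m
  proof -
    have "tr (h N m) = (\<Sum>n=N..<m. 2 ^ (n + 1) * tnorm2 (d n))"
      using dM by (simp add: h_def tr_sum tr_scaleR)
    also have "\<dots> \<le> (\<Sum>n=N..<m. 2 * (1/4) ^ n)"
    proof (rule sum_mono)
      fix n
      have "2 ^ (n + 1) * tnorm2 (d n) \<le> 2 ^ (n + 1) * (1/8) ^ n"
        using small[of n] by (intro mult_left_mono) (auto simp: d_def)
      also have "\<dots> = 2 * (2 * (1/8)) ^ n" unfolding power_mult_distrib by simp
      finally show "2 ^ (n + 1) * tnorm2 (d n) \<le> 2 * (1/4) ^ n" by simp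
    qed
    also have "\<dots> \<le> 4 * (1/4) ^ N"
    proof (cases "N \<le> m")
      case True
      have "(\<Sum>n=N..<m. 2 * (1/4::real) ^ n) \<le> 4 * (1/4) ^ N - (8/3) * (1/4) ^ m"
        using True by (induction m rule: dec_induct) auto
      then show ?thesis using zero_le_power[of "1/4::real" m] by linarith
    qed simp
    finally show ?thesis .
  qed
  \<comment> \<open>Cauchy-Schwarz plays weights \<open>(1/2) ^ (n + 1)\<close>, of total at most 1,
    against the weights \<open>2 ^ (n + 1)\<close> in \<open>h\<close>.\<close>
  have dom: "(norm ((x m - x N) v))\<^sup>2 \<le> inner (h N m v) v" if "N \<le> m" for N m v
  proof -
    have "(\<Sum>n=N..<m. (1/2::real) ^ (n + 1)) = (1/2) ^ N - (1/2) ^ m"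
      using that by (induction m rule: dec_induct) auto
    then have w: "(\<Sum>n=N..<m. ((1/2::real) ^ (n + 1))) \<le> 1"
      using power_le_one[of "1/2::real" N] zero_le_power[of "1/2::real" m] by linarith
    have "(x m - x N) v = (\<Sum>n=N..<m. d n v)"
      using sum_Suc_diff'[OF that, of "\<lambda>n. x n v"] by (simp add: d_def blinfun.diff_left)
    then have "norm ((x m - x N) v) \<le> (\<Sum>n=N..<m. norm (d n v))" by (simp add: norm_sum)
    then have "(norm ((x m - x N) v))\<^sup>2 \<le> (\<Sum>n=N..<m. norm (d n v))\<^sup>2" by (intro power_mono) auto
    also have "\<dots> = (\<Sum>n=N..<m. sqrt ((1/2) ^ (n + 1)) * (sqrt (2 ^ (n + 1)) * norm (d n v)))\<^sup>2"
      by (simp add: real_sqrt_mult[symmetric] power_mult_distrib[symmetric] mult.assoc[symmetric]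
        del: power_Suc)
    also have "\<dots> \<le> (\<Sum>n=N..<m. (sqrt ((1/2) ^ (n + 1)))\<^sup>2) * (\<Sum>n=N..<m. (sqrt (2 ^ (n + 1)) * norm (d n v))\<^sup>2)"
      by (rule Cauchy_Schwarz_ineq_sum)
    also have "\<dots> = (\<Sum>n=N..<m. (1/2) ^ (n + 1)) * inner (h N m v) v"
      by (simp add: h_inner power_mult_distrib)
    also have "\<dots> \<le> 1 * inner (h N m v) v"
      using w h_pos by (intro mult_right_mono) (auto simp: positive_op_iff)
    finally show ?thesis by simp
  qed
  have "\<exists>g. positive_op g \<and> norm g \<le> 1 \<and>
    (\<forall>v. \<exists>y. inner (blinfun_apply g v) v = inner (h N m y) y + (norm (v - y))\<^sup>2) \<and>
    (\<forall>v z. inner (g v) v \<le> inner (h N m z) z + (norm (v - z))\<^sup>2) \<and>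
    (\<forall>C. C o\<^sub>L h N m = h N m o\<^sub>L C \<longrightarrow> C o\<^sub>L g = g o\<^sub>L C)" for N m
    using resolvent_exists[OF h_pos[of N m]] by metis
  then obtain g where g: "\<And>N m. positive_op (g N m)" "\<And>N m. norm (g N m) \<le> 1"
    "\<And>N m v. \<exists>y. inner (blinfun_apply (g N m) v) v = inner (h N m y) y + (norm (v - y))\<^sup>2"
    "\<And>N m v z. inner (g N m v) v \<le> inner (h N m z) z + (norm (v - z))\<^sup>2"
    "\<And>N m C. C o\<^sub>L h N m = h N m o\<^sub>L C \<Longrightarrow> C o\<^sub>L g N m = g N m o\<^sub>L C"
    by metis
  have gh: "hermitian (g N m)" for N m using g(1) by (simp add: positive_op_iff)
  have gM: "g N m \<in> M" for N m
    by (rule mem_if_commutes[OF hermitian_cbounded[OF gh] hM g(5)])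
  \<comment> \<open>Insert the minimizer for the larger operator into the variational bound for the
    smaller one.\<close>
  have g_mono: "inner (g N m v) v \<le> inner (g N' m' v) v" if "N' \<le> N" "m \<le> m'" for N m N' m' v
  proof -
    obtain y where "inner (g N' m' v) v = inner (h N' m' y) y + (norm (v - y))\<^sup>2" using g(3) by metis
    moreover have "inner (h N m y) y \<le> inner (h N' m' y) y" using that by (rule h_mono)
    ultimately show ?thesis using g(4)[of N m v y] by linarith
  qed
  have tr_g: "tr (g N m) \<le> 4 * (1/4) ^ N" for N m
    using tr_mono[OF gM hM gh hh, of N m N m] g(4)[of N m v v for v] tr_h[of N m] by auto
  \<comment> \<open>At the minimizer \<open>y\<close> the bound \<open>dom\<close> applies; on
    \<open>v - y\<close> only \<open>norm ?X \<le> 2\<close> is available. The factor 8 comes from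
    \<open>(a + 2 b)\<^sup>2 \<le> 2 a\<^sup>2 + 8 b\<^sup>2\<close>.\<close>
  have dom_g: "(norm ((x m - x N) v))\<^sup>2 \<le> 8 * inner (g N m v) v" if "N \<le> m" for N m v
  proof -
    let ?X = "x m - x N"
    obtain y where y: "inner (g N m v) v = inner (h N m y) y + (norm (v - y))\<^sup>2" using g(3) by metis
    have nX: "norm ?X \<le> 2" using norm_triangle_ineq4[of "x m" "x N"] n1[of m] n1[of N] by simp
    have "norm (?X (v - y)) \<le> 2 * norm (v - y)"
      using norm_blinfun[of ?X "v - y"] mult_right_mono[OF nX norm_ge_zero[of "v - y"]] by simp
    moreover have "norm (?X v) \<le> norm (?X y) + norm (?X (v - y))"
      using norm_triangle_ineq[of "?X y" "?X (v - y)"] by (simp add: blinfun.bilinear_simps)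
    ultimately have "norm (?X v) \<le> norm (?X y) + 2 * norm (v - y)" by simp
    then have "(norm (?X v))\<^sup>2 \<le> (norm (?X y) + 2 * norm (v - y))\<^sup>2" by (intro power_mono) auto
    also have "\<dots> \<le> 2 * (norm (?X y))\<^sup>2 + 8 * (norm (v - y))\<^sup>2"
      using zero_le_power2[of "norm (?X y) - 2 * norm (v - y)"]
      by (simp add: power2_eq_square algebra_simps)
    also have "\<dots> \<le> 2 * inner (h N m y) y + 8 * (norm (v - y))\<^sup>2" using dom[OF that, of y] by simp
    also have "\<dots> \<le> 8 * inner (g N m v) v"
      using h_pos[of N m] by (simp add: y positive_op_iff)
    finally show ?thesis .
  qed
  have "\<exists>G. hermitian G \<and> (\<forall>v. (\<lambda>m. g N m v) \<longlonglongrightarrow> blinfun_apply G v) \<and> (\<forall>m v. inner (g N m v) v \<le> inner (G v) v) \<and>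
      norm G \<le> 1" for N
    using monotone_sot_limit[of "g N" 1, OF gh g(2) g_mono[OF order_refl]] by metis
  then obtain G where G: "\<And>N. hermitian (G N)" "\<And>N v. (\<lambda>m. g N m v) \<longlonglongrightarrow> blinfun_apply (G N) v"
    "\<And>N m v. inner (g N m v) v \<le> inner (G N v) v" "\<And>N. norm (G N) \<le> 1"
    by metis
  have GM: "G N \<in> M" for N by (rule sot_limit_mem[OF gM G(2)])
  have G_pos: "0 \<le> inner (G N v) v" for N v
    using G(3)[of N 0 v] g(1)[of N 0] by (auto simp: positive_op_iff intro: order_trans)
  have tr_G: "tr (G N) \<le> 4 * (1/4) ^ N" for N
    by (rule tr_normal[OF gM gh tr_g g_mono[OF order_refl] GM G(1) G(2)])
  have G_mono: "inner (G N v) v \<le> inner (G N' v) v" if "N' \<le> N" for N N' v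
  proof (rule LIMSEQ_le)
    show "(\<lambda>m. inner (g N m v) v) \<longlonglongrightarrow> inner (G N v) v" "(\<lambda>m. inner (g N' m v) v) \<longlonglongrightarrow> inner (G N' v) v"
      by (intro tendsto_intros G)+
  qed (use g_mono[OF that order_refl] in blast)
  have dom_G: "(norm ((x m - x N) v))\<^sup>2 \<le> 8 * inner (G N v) v" if "N \<le> m" for N m v
    using dom_g[OF that, of v] G(3)[of N m v] by linarith
  have lim0: "(\<lambda>N. 4 * (1/4::real) ^ N) \<longlonglongrightarrow> 0"
    using tendsto_mult_left[OF LIMSEQ_power_zero[of "1/4::real"], of 4] by simp
  \<comment> \<open>The \<open>G N\<close> decrease, so the monotone limit is taken of
    \<open>- G N\<close>. Its negative is positive with trace at most \<open>4 * (1/4) ^ N\<close>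
    for every \<open>N\<close>, hence 0 by faithfulness; with \<open>dom_G\<close> this makes
    \<open>x n v\<close> Cauchy for each \<open>v\<close>.\<close>
  obtain L where L: "hermitian L" "\<And>v. (\<lambda>N. - G N v) \<longlonglongrightarrow> blinfun_apply L v"
    "\<And>N v. inner ((- G N) v) v \<le> inner (L v) v"
  proof (rule monotone_sot_limit[of "\<lambda>N. - G N" 1])
    show "hermitian (- G N)" "norm (- G N) \<le> 1" for N using G(1,4) by auto
    show "inner ((- G m) v) v \<le> inner ((- G n) v) v" if "m \<le> n" for m n v
      using G_mono[OF that] by (simp add: blinfun.minus_left)
  qed (rule that, simp_all add: blinfun.minus_left)
  have LM: "L \<in> M" by (rule sot_limit_mem[of "\<lambda>N. - G N"]) (auto simp: GM L(2) blinfun.minus_left)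
  have Lp: "positive_op (- L)"
  proof -
    have "inner (L v) v \<le> 0" for v
    proof (rule LIMSEQ_le_const2)
      show "(\<lambda>N. inner (- G N v) v) \<longlonglongrightarrow> inner (L v) v" by (intro tendsto_intros L)
    qed (use G_pos in auto)
    then show ?thesis using L(1) by (simp add: positive_op_iff blinfun.minus_left)
  qed
  have "tr (- L) \<le> 4 * (1/4) ^ N" for N
  proof -
    have "tr (- L) \<le> tr (G N)"
    proof (rule tr_mono)
      show "inner ((- L) v) v \<le> inner (G N v) v" for v using L(3)[of N v] by (simp add: blinfun.minus_left)
    qed (use GM LM G(1) L(1) in auto)
    then show ?thesis using tr_G[of N] by linarith
  qed
  then have "tr (- L) \<le> 0" by (intro LIMSEQ_le_const[OF lim0]) auto
  then have "- L = 0" using tr_pos[OF _ Lp] LM by (intro tr_faithful Lp) auto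
  then have L0: "L = 0" by simp
  have G0: "(\<lambda>N. 8 * inner (G N v) v) \<longlonglongrightarrow> 0" for v
  proof -
    have "(\<lambda>N. - 8 * inner (- G N v) v) \<longlonglongrightarrow> - 8 * inner (L v) v" by (intro tendsto_intros L)
    then show ?thesis by (simp add: L0)
  qed
  have conv: "convergent (\<lambda>n. x n v)" for v
  proof -
    have "Cauchy (\<lambda>n. x n v)"
    proof (rule metric_CauchyI)
      fix e :: real assume e: "0 < e"
      then have "\<forall>\<^sub>F N in sequentially. 8 * inner (G N v) v < (e/2)\<^sup>2"
        using order_tendstoD(2)[OF G0] by (auto simp del: power_divide)
      then obtain N where N: "8 * inner (G N v) v < (e/2)\<^sup>2" by (auto simp: eventually_sequentially)
      have *: "norm (x m v - x N v) < e / 2" if "N \<le> m" for m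
      proof -
        have "(norm (x m v - x N v))\<^sup>2 < (e/2)\<^sup>2" using dom_G[OF that, of v] N by (simp add: blinfun.diff_left)
        then show ?thesis by (rule power2_less_imp_less) (use e in simp)
      qed
      have "dist (x m v) (x n v) < e" if "N \<le> m" "N \<le> n" for m n
        using *[OF that(1)] *[OF that(2)] norm_triangle_ineq4[of "x m v - x N v" "x n v - x N v"]
        by (simp add: dist_norm)
      then show "\<exists>M. \<forall>m\<ge>M. \<forall>n\<ge>M. dist (x m v) (x n v) < e" by blast
    qed
    then show ?thesis by (rule Cauchy_convergent)
  qed
  obtain y where y: "\<And>v. (\<lambda>n. x n v) \<longlonglongrightarrow> blinfun_apply y v"
    by (rule pointwise_limit_blinfun[of x 1, OF n1 conv], rule that)
  have yM: "y \<in> M" by (rule sot_limit_mem[OF mem y])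
  have "tnorm2 (x N - y) \<le> 8 * (4 * (1/4) ^ N)" for N
  proof -
    have "(norm ((x N - y) v))\<^sup>2 \<le> 8 * inner (G N v) v" for v
    proof (rule LIMSEQ_le_const2)
      show "(\<lambda>m. (norm ((x m - x N) v))\<^sup>2) \<longlonglongrightarrow> (norm ((x N - y) v))\<^sup>2"
        unfolding blinfun.diff_left norm_minus_commute[of _ "x N v"] by (intro tendsto_intros y)
    qed (use dom_G in blast)
    then have "tnorm2 (x N - y) \<le> tr (8 *\<^sub>R G N)"
      using mem yM GM G(1) by (intro tnorm2_le) (auto simp: blinfun.scaleR_left)
    then show ?thesis using tr_G[of N] GM by (simp add: tr_scaleR)
  qed
  moreover have "0 \<le> tnorm2 (x N - y)" for N using mem yM by (intro tnorm2_pos) auto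
  moreover have "(\<lambda>N. 8 * (4 * (1/4::real) ^ N)) \<longlonglongrightarrow> 0" using tendsto_mult_left[OF lim0, of 8] by simp
  ultimately have "(\<lambda>n. tnorm2 (x n - y)) \<longlonglongrightarrow> 0"
    by (rule_tac tendsto_sandwich[of "\<lambda>_. 0" _ _ "\<lambda>N. 8 * (4 * (1/4::real) ^ N)"]) auto
  then show thesis by (rule that[OF yM y])
qed

text \<open>\<open>B\<close> is the real inner product of the trace norm, and faithfulness turns
  \<open>B z z = 0\<close> into \<open>z = 0\<close>. The closedness premise is offered two kinds of
  convergence: order and support conditions pass to strong limits, a prescribed value of
  \<open>E\<close> passes to limits in trace norm.\<close>

lemma exists_extreme_point_M:
  assumes K: "K \<subseteq> M" "K \<noteq> {}" and n1: "\<And>x. x \<in> K \<Longrightarrow> norm x \<le> 1"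
    and closed: "\<And>f y. (\<And>n. f n \<in> K) \<Longrightarrow> y \<in> M \<Longrightarrow> (\<And>v. (\<lambda>n. f n v) \<longlonglongrightarrow> blinfun_apply y v) \<Longrightarrow>
      (\<lambda>n. tnorm2 (f n - y)) \<longlonglongrightarrow> 0 \<Longrightarrow> y \<in> K"
  shows "\<exists>k\<in>K. \<forall>z\<in>M. k + z \<in> K \<longrightarrow> k - z \<in> K \<longrightarrow> z = 0"
proof -
  define B where "B x y = (tr (adj x o\<^sub>L y) + tr (adj y o\<^sub>L x)) / 2" for x y
  have B_self: "B x x = tr (adj x o\<^sub>L x)" for x by (simp add: B_def)
  have "\<exists>k\<in>K. \<forall>z\<in>M. k + z \<in> K \<longrightarrow> k - z \<in> K \<longrightarrow> tr (adj z o\<^sub>L z) = 0"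
  proof (rule exists_extreme_point[of M K B 1, unfolded B_self])
    have add: "adj (x + y) o\<^sub>L z = (adj x o\<^sub>L z) + (adj y o\<^sub>L z)"
        "adj z o\<^sub>L (x + y) = (adj z o\<^sub>L x) + (adj z o\<^sub>L y)"
      if "x \<in> M" "y \<in> M" "z \<in> M" for x y z
      using that by (auto intro!: blinfun_eqI simp: blinfun.bilinear_simps)
    show "B (x + y) z = B x z + B y z" if "x \<in> M" "y \<in> M" "z \<in> M" for x y z
      using that by (simp add: B_def add[OF that] tr_add field_simps del: adj_add)
    have scale: "adj (r *\<^sub>R x) o\<^sub>L y = r *\<^sub>R (adj x o\<^sub>L y)"
        "adj y o\<^sub>L (r *\<^sub>R x) = r *\<^sub>R (adj y o\<^sub>L x)"
      if "x \<in> M" "y \<in> M" for r x y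
      using that by (auto intro!: blinfun_eqI simp: blinfun.bilinear_simps)
    show "B (r *\<^sub>R x) y = r * B x y" if "x \<in> M" "y \<in> M" for r x y
      using that by (simp add: B_def scale[OF that] tr_scaleR field_simps del: adj_scaleR)
    show "B x y = B y x" for x y by (simp add: B_def)
    show "tr (adj x o\<^sub>L x) \<le> 1" if "x \<in> K" for x
    proof -
      have xM: "x \<in> M" using that K by blast
      have "norm (x v) \<le> norm v" for v
        using norm_blinfun[of x v] mult_right_mono[OF n1[OF that] norm_ge_zero[of v]] by simp
      then have "(norm (x v))\<^sup>2 \<le> (norm v)\<^sup>2" for v by (intro power_mono) auto
      then have "tnorm2 x \<le> tr id_blinfun"
        using xM by (intro tnorm2_le) (auto simp flip: power2_norm_eq_inner)
      then show ?thesis by simp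
    qed
    show "\<exists>k\<in>K. (\<lambda>n. tr (adj (f n - k) o\<^sub>L (f n - k))) \<longlonglongrightarrow> 0"
      if f: "\<And>n. f n \<in> K" "\<And>n. tr (adj (f (Suc n) - f n) o\<^sub>L (f (Suc n) - f n)) \<le> (1/8) ^ n" for f
    proof -
      have fM: "f n \<in> M" and fn: "norm (f n) \<le> 1" for n using f(1) K(1) n1 by auto
      obtain y where y: "y \<in> M" "\<And>v. (\<lambda>n. f n v) \<longlonglongrightarrow> blinfun_apply y v" "(\<lambda>n. tnorm2 (f n - y)) \<longlonglongrightarrow> 0"
        by (rule unit_ball_complete[OF fM fn f(2)], rule that)
      show ?thesis using closed[OF f(1) y] y(3) by (intro bexI)
    qed
  qed (use K tnorm2_pos subspace_M in auto)
  then show ?thesis using tnorm2_faithful by blast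
qed

end

subsection \<open>Equivalence of projections of equal trace\<close>

text \<open>The vectors that \<open>e o\<^sub>L x\<close> kills for all \<open>x\<close> in
  \<open>M\<close> form a closed subspace invariant under \<open>M\<close> and under its commutant,
  so its projection is central and therefore scalar. If some \<open>f v\<close> is nonzero, it lies
  in the subspace, the scalar is 1, and \<open>e\<close> kills everything.\<close>

lemma (in vna) factor_prime:
  assumes "factor M" "e \<in> M" "f \<in> M" "\<And>x. x \<in> M \<Longrightarrow> e o\<^sub>L x o\<^sub>L f = 0"
  shows "e = 0 \<or> f = 0"
proof (rule disjCI)
  assume "f \<noteq> 0"
  then obtain v where v: "f v \<noteq> 0" by (metis blinfun_eqI blinfun.zero_left)
  let ?N = "{w. \<forall>x\<in>M. e (blinfun_apply x w) = 0}"
  have "?N = (\<Inter>x\<in>M. {w. e (blinfun_apply x w) = 0})" by auto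
  then have cl: "closed ?N" by (auto intro!: closed_INT closed_Collect_eq continuous_intros)
  have sub: "subspace ?N" by (auto simp: subspace_def blinfun.bilinear_simps)
  have cN: "c *\<^sub>C w \<in> ?N" if "w \<in> ?N" for c w
    using that assms(2) by (simp add: cbounded_ops_apply)
  obtain P where P: "projection P" "\<And>v. P v = v \<longleftrightarrow> v \<in> ?N"
    "\<And>C. C \<in> cbounded_ops \<Longrightarrow> C ` ?N \<subseteq> ?N \<Longrightarrow> adj C ` ?N \<subseteq> ?N \<Longrightarrow> C o\<^sub>L P = P o\<^sub>L C"
    by (rule closed_subspace_projection[OF cl sub], erule cN, rule that)
  have inM: "C ` ?N \<subseteq> ?N" if "C \<in> M" for C
  proof clarify
    fix w x assume "\<forall>x\<in>M. e (x w) = 0" "x \<in> M"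
    then have "e ((x o\<^sub>L C) w) = 0" using that by blast
    then show "e (x (C w)) = 0" by simp
  qed
  have inM': "C ` ?N \<subseteq> ?N" if "C \<in> commutant M" for C
  proof clarify
    fix w x assume w: "\<forall>x\<in>M. e (x w) = 0" and x: "x \<in> M"
    have "e (x (C w)) = C (e (x w))"
      using commute_apply[OF commutant_commute[OF assms(2) that]] commute_apply[OF commutant_commute[OF x that]]
      by simp
    then show "e (x (C w)) = 0" using w x by simp
  qed
  have Pcb: "P \<in> cbounded_ops" using P(1) by (rule projectionD)
  have "P \<in> M"
  proof (rule mem_if_commute[OF Pcb])
    fix C assume C: "C \<in> commutant M"
    have "adj C \<in> commutant M" by (rule commutant_adj[OF _ _ C]) auto
    then show "C o\<^sub>L P = P o\<^sub>L C" using C by (intro P(3) inM' commutantD(2)[OF C])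
  qed
  moreover have "P \<in> commutant M"
    by (rule commutantI[OF Pcb]) (auto intro!: P(3)[symmetric] inM simp del: image_subset_iff)
  ultimately obtain c where c: "P = scalar_op c" using assms(1) unfolding factor_def by blast
  have "e (x (f v)) = 0" if "x \<in> M" for x
    using arg_cong[OF assms(4)[OF that], of "\<lambda>T. T v"] by simp
  then have "c *\<^sub>C f v = f v" using P(2)[of "f v"] c by simp
  then have "(c - 1) *\<^sub>C f v = 0"
    using scaleC_add_left[of "c - 1" 1 "f v"] scaleC_of_real[of 1 "f v"] by simp
  then have "cmod (c - 1) * norm (f v) = 0" by (metis norm_scaleC norm_zero)
  then have "c = 1" using v by simp
  then have "P w = w" for w using c scaleC_of_real[of 1 w] by simp
  then have "e (id_blinfun w) = 0" for w using P(2)[of w] id_mem by blast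
  then show "e = 0" by (intro blinfun_eqI) simp
qed

lemma norm_le_one_apply: "norm (x :: 'a::real_normed_vector \<Rightarrow>\<^sub>L 'b::real_normed_vector) \<le> 1 \<longleftrightarrow> (\<forall>v. norm (x v) \<le> norm v)"
proof
  assume "norm x \<le> 1"
  then show "\<forall>v. norm (x v) \<le> norm v"
    using norm_blinfun[of x] mult_right_mono[OF _ norm_ge_zero, of "norm x" 1] by (fastforce intro: order_trans)
qed (auto intro: norm_blinfun_bound)

text \<open>An extreme point \<open>V\<close> of the unit ball of \<open>qMp\<close> is a partial isometry: with \<open>b = 1 - V\<^sup>*V\<close> both
  \<open>V (1 \<plusminus> b/2)\<close> are contractions. Moreover \<open>(q - VV\<^sup>*) M (p - V\<^sup>*V) = 0\<close>, so in a factor one of the two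
  differences vanishes.\<close>

lemma (in tracial_vna) equal_trace_equivalent:
  assumes fac: "factor M" and p: "p \<in> M" "projection p" and q: "q \<in> M" "projection q"
    and tr_eq: "tr p = tr q"
  obtains V where "V \<in> M" "adj V o\<^sub>L V = p" "V o\<^sub>L adj V = q" "q o\<^sub>L V = V" "V o\<^sub>L p = V"
proof -
  define K where "K = {x \<in> M. norm x \<le> 1 \<and> q o\<^sub>L x = x \<and> x o\<^sub>L p = x}"
  have "\<exists>k\<in>K. \<forall>z\<in>M. k + z \<in> K \<longrightarrow> k - z \<in> K \<longrightarrow> z = 0"
  proof (rule exists_extreme_point_M)
    show "K \<subseteq> M" "\<And>x. x \<in> K \<Longrightarrow> norm x \<le> 1" by (auto simp: K_def)
    show "K \<noteq> {}" by (auto simp: K_def intro!: exI[of _ 0])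
    fix f :: "nat \<Rightarrow> 'h op" and y
    assume f: "\<And>n. f n \<in> K" and y: "y \<in> M" "\<And>v. (\<lambda>n. f n v) \<longlonglongrightarrow> y v"
    have n1: "norm (f n v) \<le> norm v" for n v using f[of n] by (simp add: K_def norm_le_one_apply)
    have fq: "q (f n v) = f n v" and fp: "f n (p v) = f n v" for n v
      using f[of n] blinfun_apply_blinfun_compose[of q "f n" v] blinfun_apply_blinfun_compose[of "f n" p v]
      by (auto simp: K_def)
    have "norm (y v) \<le> norm v" for v
      using LIMSEQ_le_const2[OF tendsto_norm[OF y(2)[of v]]] n1 by blast
    moreover have "q (y v) = y v" for v
    proof -
      have "(\<lambda>n. q (f n v)) \<longlonglongrightarrow> q (y v)" by (intro tendsto_intros y)
      then show ?thesis using y(2)[of v] LIMSEQ_unique by (simp add: fq) blast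
    qed
    moreover have "y (p v) = y v" for v
      using y(2)[of "p v"] y(2)[of v] LIMSEQ_unique by (simp add: fp) blast
    ultimately show "y \<in> K" using y(1) by (auto simp: K_def norm_le_one_apply intro!: blinfun_eqI)
  qed
  then obtain V where VK: "V \<in> K" and ext: "\<And>z. z \<in> M \<Longrightarrow> V + z \<in> K \<Longrightarrow> V - z \<in> K \<Longrightarrow> z = 0"
    by blast
  have VM: "V \<in> M" and V1: "\<And>v. norm (V v) \<le> norm v" and qV: "q o\<^sub>L V = V" and Vp: "V o\<^sub>L p = V"
    using VK by (auto simp: K_def norm_le_one_apply)
  have qVv: "q (V v) = V v" and Vpv: "V (p v) = V v" for v
    using arg_cong[OF qV, of "\<lambda>T. T v"] arg_cong[OF Vp, of "\<lambda>T. T v"] by auto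
  have Vcb: "V \<in> cbounded_ops" using VM by simp
  define a where "a = adj V o\<^sub>L V"
  define b where "b = id_blinfun - a"
  have aM: "a \<in> M" and bM: "b \<in> M" using VM by (auto simp: a_def b_def)
  have ha: "hermitian a" using Vcb by (simp add: a_def)
  then have hb: "hermitian b" by (simp add: b_def)
  have bsym: "inner (b u) v = inner u (b v)" for u v by (rule hermitian_inner[OF hb])
  have b_inner: "inner (b v) v = (norm v)\<^sup>2 - (norm (V v))\<^sup>2" for v
    using Vcb by (simp add: b_def a_def blinfun.diff_left inner_diff_left inner_adj_left power2_norm_eq_inner)
  have bp: "positive_op b" using hb V1 by (auto simp: positive_op_iff b_inner power_mono)
  have "norm b \<le> 1"
  proof (rule hermitian_norm_le[OF hb])
    show "\<bar>inner (b v) v\<bar> \<le> 1 * (norm v)\<^sup>2" for v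
      using V1[of v] by (simp add: b_inner power_mono)
  qed simp
  then have bb: "(norm (b v))\<^sup>2 \<le> inner (b v) v" for v
    using positive_op_norm_apply[OF bp, of v] mult_right_mono[of "norm b" 1 "inner (b v) v"] bp
    by (auto simp: positive_op_iff)
  have V2: "(norm (V u))\<^sup>2 = inner u u - inner (b u) u" for u
    by (simp add: b_inner power2_norm_eq_inner)
  define z where "z = (1/2) *\<^sub>R (V o\<^sub>L b)"
  have zv: "z v = (1/2) *\<^sub>R V (b v)" for v by (simp add: z_def blinfun.scaleR_left)
  have zM: "z \<in> M" using VM bM by (simp add: z_def)
  have ba: "b (p v) = b v - v + p v" for v by (simp add: b_def a_def blinfun.diff_left Vpv)
  have zq: "q (z v) = z v" for v by (simp add: zv blinfun.scaleR_right qVv)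
  have zp: "z (p v) = z v" for v by (simp add: zv ba blinfun.bilinear_simps Vpv)
  have inK: "V + x \<in> K" if "x \<in> M" "\<And>v. norm ((V + x) v) \<le> norm v" "\<And>v. q (x v) = x v" "\<And>v. x (p v) = x v" for x
    using that VM qVv Vpv by (auto simp: K_def norm_le_one_apply blinfun.bilinear_simps intro!: blinfun_eqI)
  have "z = 0"
  proof (rule ext[OF zM])
    \<comment> \<open>As \<open>adj V o\<^sub>L V = 1 - b\<close>, the square of the left side is
      the quadratic form of \<open>(1 + b/2)\<^sup>2 (1 - b)\<close>, which is
      \<open>1 - (3/4) b\<^sup>2 - (1/4) b\<^sup>3\<close>.\<close>
    have "norm (V (v + (1/2) *\<^sub>R b v)) \<le> norm v" for v
    proof -
      have "(norm (V (v + (1/2) *\<^sub>R b v)))\<^sup>2 =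
          inner v v - 3/4 * inner (b v) (b v) - 1/4 * inner (b (b v)) (b v)"
        unfolding V2
        by (simp add: blinfun.bilinear_simps inner_simps bsym[of "b v" v] inner_commute[of v "b v"]
          algebra_simps)
      also have "\<dots> \<le> (norm v)\<^sup>2"
      proof -
        have "0 \<le> inner (b (b v)) (b v)" using bp by (simp add: positive_op_iff)
        then show ?thesis using inner_ge_zero[of "b v"] unfolding power2_norm_eq_inner by linarith
      qed
      finally show ?thesis by (rule power2_le_imp_le) simp
    qed
    then show "V + z \<in> K" using zM zq zp by (intro inK) (auto simp: blinfun.bilinear_simps zv)
    have "norm (V (v - (1/2) *\<^sub>R b v)) \<le> norm v" for v
    proof -
      have "(norm (v - (1/2) *\<^sub>R b v))\<^sup>2 = (norm v)\<^sup>2 - inner (b v) v + 1/4 * (norm (b v))\<^sup>2"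
        by (simp add: power2_norm_eq_inner inner_simps inner_commute algebra_simps)
      also have "\<dots> \<le> (norm v)\<^sup>2" using bb[of v] zero_le_power2[of "norm (b v)"] by linarith
      finally have "norm (v - (1/2) *\<^sub>R b v) \<le> norm v" by (rule power2_le_imp_le) simp
      then show ?thesis using V1[of "v - (1/2) *\<^sub>R b v"] by linarith
    qed
    then have "V + (- z) \<in> K" using zM zq zp
      by (intro inK) (auto simp: blinfun.bilinear_simps zv)
    then show "V - z \<in> K" by simp
  qed
  \<comment> \<open>Extremality gives \<open>V b = 0\<close>, that is \<open>V a = V\<close>: so
    \<open>V\<close> is a partial isometry with initial projection \<open>a\<close> and final
    projection \<open>c\<close>.\<close>
  then have Vb: "V (b v) = 0" for v using zv[of v] by simp
  then have Va: "V (a v) = V v" for v using Vb[of v] by (simp add: b_def blinfun.bilinear_simps)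
  have av: "a v = adj V (V v)" for v by (simp add: a_def)
  have aa: "a (a v) = a v" for v by (simp add: av) (metis Va av)
  have V_a: "(norm (V v))\<^sup>2 = inner (a v) v" for v using Vcb by (simp add: av inner_adj_left power2_norm_eq_inner)
  define c where "c = V o\<^sub>L adj V"
  have cM: "c \<in> M" using VM by (simp add: c_def)
  have cv: "c v = V (adj V v)" for v by (simp add: c_def)
  have hc: "hermitian c" using hermitian_adj_compose[of "adj V"] Vcb by (simp add: c_def)
  have apply_adj: "adj V (V (adj V v)) = adj V v" for v
  proof -
    have "inner (adj V (V (adj V v))) w = inner (adj V v) w" for w
      using Vcb Va[of w] by (simp add: inner_adj_left inner_adj_right av flip: inner_adj_right)
    then have "inner w (adj V (V (adj V v))) = inner w (adj V v)" for w by (metis inner_commute)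
    then show ?thesis by (rule inner_right_ext)
  qed
  define e where "e = q - c"
  define f where "f = p - a"
  have eM: "e \<in> M" and fM: "f \<in> M" using p q aM cM by (auto simp: e_def f_def)
  have he: "hermitian e" and hf: "hermitian f" using hc ha p q projectionD by (auto simp: e_def f_def)
  have ap: "a (p v) = a v" for v by (simp add: av Vpv)
  have pav: "p (a v) = a v" for v
  proof (rule inner_right_ext)
    show "inner w (p (a v)) = inner w (a v)" for w
      using ap[of w] by (metis hermitian_inner[OF ha] hermitian_inner[OF projectionD(1)[OF p(2)]])
  qed
  have qcv: "q (c v) = c v" for v by (simp add: cv qVv)
  have cq: "c (q v) = c v" for v
  proof (rule inner_right_ext)
    show "inner w (c (q v)) = inner w (c v)" for w
      using qcv[of w] by (metis hermitian_inner[OF hc] hermitian_inner[OF projectionD(1)[OF q(2)]])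
  qed
  have pp: "p (p v) = p v" and qq: "q (q v) = q v" for v using p q by (auto intro: projectionD)
  have cc: "c (c v) = c v" for v by (simp add: cv apply_adj)
  have f_proj: "projection f"
    using hf by (auto simp: projection_def f_def blinfun.bilinear_simps pp ap pav aa intro!: blinfun_eqI)
  have e_proj: "projection e"
    using he by (auto simp: projection_def e_def blinfun.bilinear_simps qq qcv cq cc intro!: blinfun_eqI)
  have eV: "e (V v) = 0" for v by (simp add: e_def blinfun.diff_left qVv cv) (simp add: Va flip: av)
  have qe: "q (e v) = e v" for v by (simp add: e_def blinfun.bilinear_simps qq qcv)
  have fp: "f (p v) = f v" for v by (simp add: f_def blinfun.bilinear_simps pp ap)
  \<comment> \<open>A small multiple \<open>y\<close> of \<open>e x f\<close> has range orthogonal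
    to that of \<open>V\<close> and satisfies \<open>norm (y v) \<le> norm (f v)\<close>. Hence
    \<open>V + y\<close> and \<open>V - y\<close> stay in \<open>K\<close>, and extremality forces
    \<open>y = 0\<close>.\<close>
  have small: "e o\<^sub>L x o\<^sub>L f = 0" if xM: "x \<in> M" for x
  proof -
    define s where "s = 1 / (norm x + 1)"
    have s: "s > 0" "s * norm x \<le> 1" by (auto simp: s_def add_nonneg_pos pos_divide_le_eq)
    define y where "y = s *\<^sub>R (e o\<^sub>L x o\<^sub>L f)"
    have yv: "y v = s *\<^sub>R e (x (f v))" for v by (simp add: y_def blinfun.scaleR_left)
    have yM: "y \<in> M" using xM eM fM by (simp add: y_def)
    have yf: "norm (y v) \<le> norm (f v)" for v
    proof -
      have "norm (y v) = s * norm (e (x (f v)))" using s by (simp add: yv)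
      also have "\<dots> \<le> s * norm (x (f v))"
        using s norm_projection_apply[OF e_proj] by (intro mult_left_mono) auto
      also have "\<dots> \<le> s * (norm x * norm (f v))" using s by (intro mult_left_mono norm_blinfun) auto
      also have "\<dots> = (s * norm x) * norm (f v)" by simp
      also have "\<dots> \<le> 1 * norm (f v)" using s by (intro mult_right_mono) auto
      finally show ?thesis by simp
    qed
    have contr: "norm (V v + r *\<^sub>R y v) \<le> norm v" if "\<bar>r\<bar> = 1" for v r
    proof -
      have "inner (V v) (y v) = s * inner (e (V v)) (x (f v))"
        by (simp add: yv hermitian_inner[OF he])
      then have orth: "inner (V v) (y v) = 0" by (simp add: eV)
      have r2: "r * r = 1" using that by (metis abs_mult_self_eq mult_1)
      have "(norm (V v + r *\<^sub>R y v))\<^sup>2 = (norm (V v))\<^sup>2 + (norm (y v))\<^sup>2"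
        using orth r2 by (simp add: power2_norm_eq_inner inner_simps inner_commute mult.assoc[symmetric])
      also have "\<dots> \<le> inner (a v) v + (norm (f v))\<^sup>2" using yf[of v] by (simp add: V_a power_mono)
      also have "\<dots> = inner (p v) v"
      proof -
        have "inner (f v) v = inner (p v) v - inner (a v) v"
          by (simp add: f_def blinfun.diff_left inner_diff_left)
        then show ?thesis using inner_projection[OF f_proj, of v] by simp
      qed
      also have "\<dots> \<le> (norm v)\<^sup>2" by (rule inner_projection_le[OF p(2)])
      finally show ?thesis by (rule power2_le_imp_le) simp
    qed
    have "y = 0"
    proof (rule ext[OF yM])
      show "V + y \<in> K" using contr[of 1] yM qe fp
        by (intro inK) (auto simp: blinfun.bilinear_simps yv)
      have "V + (- y) \<in> K" using contr[of "-1"] yM qe fp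
        by (intro inK) (auto simp: blinfun.bilinear_simps yv)
      then show "V - y \<in> K" by simp
    qed
    then show ?thesis using s by (simp add: y_def)
  qed
  \<comment> \<open>The trace property gives \<open>tr c = tr a\<close>, so the two defects have
    equal trace. One of them vanishes, hence by faithfulness so does the other.\<close>
  have "tr e = tr f"
    using p q aM cM tr_eq VM by (simp add: e_def f_def tr_diff a_def c_def tr_commute[of V "adj V"])
  moreover have "e = 0 \<or> f = 0" using factor_prime[OF fac eM fM small] .
  ultimately have "tr e = 0" "tr f = 0" by auto
  then have "e = 0" "f = 0"
    using eM fM e_proj f_proj positive_projection tr_faithful by blast+
  then show thesis using that[OF VM _ _ qV Vp] by (simp add: e_def f_def a_def c_def)
qed

section \<open>Unitaries between partitions of unity\<close>

definition partition_of_unity :: "'i set \<Rightarrow> ('i \<Rightarrow> 'h::complex_hilbert op) \<Rightarrow> bool" where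
  "partition_of_unity J P \<longleftrightarrow> finite J \<and> (\<forall>j\<in>J. projection (P j)) \<and>
    (\<forall>i\<in>J. \<forall>j\<in>J. i \<noteq> j \<longrightarrow> P i o\<^sub>L P j = 0) \<and> sum P J = id_blinfun"

lemma sum_compose_left: "sum f I o\<^sub>L T = (\<Sum>i\<in>I. f i o\<^sub>L T)"
  by (rule blinfun_eqI) (simp add: blinfun.sum_left)

lemma sum_compose_right: "T o\<^sub>L sum f I = (\<Sum>i\<in>I. T o\<^sub>L f i)"
  by (rule blinfun_eqI) (simp add: blinfun.sum_left blinfun.sum_right)

text \<open>The partial isometries between matching blocks are added up. Different blocks are
  orthogonal on both sides and the blocks exhaust the space, so the sum is unitary.\<close>

lemma (in tracial_vna) equal_trace_unitary:
  assumes fac: "factor M" and P: "partition_of_unity J P" and Q: "partition_of_unity J Q"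
    and M: "\<And>j. j \<in> J \<Longrightarrow> P j \<in> M" "\<And>j. j \<in> J \<Longrightarrow> Q j \<in> M"
    and tr_eq: "\<And>j. j \<in> J \<Longrightarrow> tr (Q j) = tr (P j)"
  obtains U where "U \<in> M" "unitary U" "\<And>j. j \<in> J \<Longrightarrow> U o\<^sub>L Q j o\<^sub>L adj U = P j"
proof -
  have fin: "finite J" using P by (simp add: partition_of_unity_def)
  have "\<exists>V. V \<in> M \<and> adj V o\<^sub>L V = Q j \<and> V o\<^sub>L adj V = P j \<and> P j o\<^sub>L V = V \<and> V o\<^sub>L Q j = V" if "j \<in> J" for j
  proof -
    have "projection (Q j)" "projection (P j)" using P Q that by (auto simp: partition_of_unity_def)
    from equal_trace_equivalent[OF fac M(2)[OF that] this(1) M(1)[OF that] this(2) tr_eq[OF that]]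
    show ?thesis by metis
  qed
  then obtain V where V: "\<And>j. j \<in> J \<Longrightarrow> V j \<in> M" "\<And>j. j \<in> J \<Longrightarrow> adj (V j) o\<^sub>L V j = Q j"
    "\<And>j. j \<in> J \<Longrightarrow> V j o\<^sub>L adj (V j) = P j" "\<And>j. j \<in> J \<Longrightarrow> P j o\<^sub>L V j = V j"
    "\<And>j. j \<in> J \<Longrightarrow> V j o\<^sub>L Q j = V j" by metis
  have Ph: "adj (P j) = P j" "adj (Q j) = Q j" if "j \<in> J" for j
    using P Q that by (auto simp: partition_of_unity_def projectionD)
  have VQ: "V i o\<^sub>L Q j = (if i = j then V i else 0)" if "i \<in> J" "j \<in> J" for i j
  proof (cases "i = j")
    case False
    have "V i o\<^sub>L Q j = V i o\<^sub>L (Q i o\<^sub>L Q j)" by (metis V(5) that(1) blinfun_compose_assoc)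
    also have "Q i o\<^sub>L Q j = 0" using Q that False by (simp add: partition_of_unity_def)
    finally show ?thesis using False by simp
  qed (use V that in simp)
  have PV: "P i o\<^sub>L V j = (if i = j then V j else 0)" if "i \<in> J" "j \<in> J" for i j
  proof (cases "i = j")
    case False
    have "P i o\<^sub>L V j = (P i o\<^sub>L P j) o\<^sub>L V j" by (metis V(4) that(2) blinfun_compose_assoc)
    also have "P i o\<^sub>L P j = 0" using P that False by (simp add: partition_of_unity_def)
    finally show ?thesis using False by simp
  qed (use V that in simp)
  define U where "U = sum V J"
  have UM: "U \<in> M" unfolding U_def using V(1) by (rule sum_mem)
  have adjU: "adj U = (\<Sum>j\<in>J. adj (V j))"
    unfolding U_def using fin V(1)
  proof (induction J rule: finite_induct)
    case (insert x F)
    then have "sum V F \<in> M" by (intro sum_mem) auto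
    then show ?case using insert by simp
  qed simp
  have QV: "Q j o\<^sub>L adj (V i) = (if i = j then adj (V i) else 0)" if "i \<in> J" "j \<in> J" for i j
  proof -
    have "Q j o\<^sub>L adj (V i) = adj (V i o\<^sub>L Q j)" using M V(1) that Ph by simp
    then show ?thesis using VQ[OF that] by simp
  qed
  have VP: "adj (V i) o\<^sub>L P j = (if i = j then adj (V i) else 0)" if "i \<in> J" "j \<in> J" for i j
  proof -
    have "adj (V i) o\<^sub>L P j = adj (P j o\<^sub>L V i)" using M V(1) that Ph by simp
    then show ?thesis using PV[OF that(2,1)] by auto
  qed
  have UQU: "U o\<^sub>L Q j o\<^sub>L adj U = P j" if "j \<in> J" for j
  proof -
    have "U o\<^sub>L Q j = V j"
      unfolding U_def sum_compose_left using fin that VQ[OF _ that] by (simp add: sum.delta)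
    moreover have "V j o\<^sub>L adj U = (V j o\<^sub>L Q j) o\<^sub>L adj U" using V(5)[OF that] by simp
    moreover have "Q j o\<^sub>L adj U = adj (V j)"
      unfolding adjU sum_compose_right using fin that QV[OF _ that] by (simp add: sum.delta)
    ultimately show ?thesis using V(3)[OF that] by (simp add: blinfun_compose_assoc)
  qed
  have UU: "U o\<^sub>L adj U = id_blinfun"
  proof -
    have "U o\<^sub>L adj U = U o\<^sub>L (sum Q J) o\<^sub>L adj U" using Q by (simp add: partition_of_unity_def)
    also have "\<dots> = (\<Sum>j\<in>J. U o\<^sub>L Q j o\<^sub>L adj U)" by (simp add: sum_compose_left sum_compose_right)
    also have "\<dots> = sum P J" using UQU by simp
    finally show ?thesis using P by (simp add: partition_of_unity_def)
  qed
  have UU': "adj U o\<^sub>L U = id_blinfun"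
  proof -
    have 1: "P j o\<^sub>L U = V j" if "j \<in> J" for j
      unfolding U_def sum_compose_right using fin that PV[OF that] by (simp add: sum.delta)
    have 2: "adj U o\<^sub>L P j = adj (V j)" if "j \<in> J" for j
      unfolding adjU sum_compose_left using fin that VP[OF _ that] by (simp add: sum.delta)
    have "adj U o\<^sub>L U = adj U o\<^sub>L (sum P J) o\<^sub>L U" using P by (simp add: partition_of_unity_def)
    also have "\<dots> = (\<Sum>j\<in>J. adj U o\<^sub>L P j o\<^sub>L U)" by (simp add: sum_compose_left sum_compose_right)
    also have "\<dots> = (\<Sum>j\<in>J. Q j)"
    proof (rule sum.cong[OF refl])
      fix j assume j: "j \<in> J"
      have "adj U o\<^sub>L P j o\<^sub>L U = (adj U o\<^sub>L P j) o\<^sub>L (P j o\<^sub>L U)"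
        by (metis V(4) j 1 2 blinfun_compose_assoc)
      then show "adj U o\<^sub>L P j o\<^sub>L U = Q j" using 1[OF j] 2[OF j] V(2)[OF j] by simp
    qed
    finally show ?thesis using Q by (simp add: partition_of_unity_def)
  qed
  show thesis
    by (rule that[OF UM _ UQU]) (use UM UU UU' in \<open>auto simp: unitary_def\<close>)
qed

subsection \<open>Masas and the carpenter lemma\<close>

text \<open>The definition of a masa mentions no topology. Its bicommutant is again an abelian star
  subalgebra of \<open>M\<close>, so maximality identifies the two; this is what makes a masa a von
  Neumann algebra.\<close>

lemma (in vna) bicommutant_abelian:
  assumes BM: "B \<subseteq> M" and adjB: "\<And>S. S \<in> B \<Longrightarrow> adj S \<in> B" and comm: "commuting_set B"
  shows "star_subalgebra (commutant (commutant B))" "commuting_set (commutant (commutant B))"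
    "commutant (commutant B) \<subseteq> M" "B \<subseteq> commutant (commutant B)"
proof -
  have Bcb: "S \<in> cbounded_ops" if "S \<in> B" for S using that BM by auto
  show sub: "B \<subseteq> commutant (commutant B)"
  proof
    fix S assume "S \<in> B"
    then show "S \<in> commutant (commutant B)"
      using Bcb commutantD(1) by (metis commutantI)
  qed
  show "star_subalgebra (commutant (commutant B))"
    using Bcb adjB by (intro star_subalgebra_commutant commutant_adj) (auto dest: commutantD(2))
  have "B \<subseteq> commutant B"
    using comm Bcb by (auto intro!: commutantI simp: commuting_set_def)
  then have "commutant (commutant B) \<subseteq> commutant B" by (auto simp: commutant_def)
  then show "commuting_set (commutant (commutant B))"
    unfolding commuting_set_def using commutantD(1) by blast
  have "commutant M \<subseteq> commutant B" using BM by (auto simp: commutant_def)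
  then have "commutant (commutant B) \<subseteq> commutant (commutant M)" by (auto simp: commutant_def)
  then show "commutant (commutant B) \<subseteq> M" using vna by (simp add: von_neumann_algebra_def)
qed

section \<open>The trace preserving expectation onto a masa\<close>

locale masa_expectation = tracial_vna M \<tau>
  for M :: "'h::complex_hilbert op set" and \<tau> +
  fixes \<A> :: "'h op set" and E :: "'h op \<Rightarrow> 'h op"
  assumes masa: "masa M \<A>"
    and cond_exp: "conditional_expectation M \<A> E"
    and E_trace: "trace_preserving M \<tau> E"
begin

lemma masa_subset: "T \<in> \<A> \<Longrightarrow> T \<in> M"
  and masa_adj: "T \<in> \<A> \<Longrightarrow> adj T \<in> \<A>"
  and masa_commute: "S \<in> \<A> \<Longrightarrow> T \<in> \<A> \<Longrightarrow> S o\<^sub>L T = T o\<^sub>L S"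
  using masa by (auto simp: masa_def star_subalgebra_def commuting_set_def)

lemma masa_vna: "vna \<A>"
proof
  have "commutant (commutant \<A>) = \<A>"
    using bicommutant_abelian[of \<A>] masa masa_subset masa_adj by (auto simp: masa_def)
  then show "von_neumann_algebra \<A>" using masa by (simp add: von_neumann_algebra_def masa_def)
qed

sublocale A: vna \<A> by (rule masa_vna)

lemma E_mem [simp, intro]: "T \<in> M \<Longrightarrow> E T \<in> \<A>"
  and E_fix: "T \<in> \<A> \<Longrightarrow> E T = T"
  and E_add: "S \<in> M \<Longrightarrow> T \<in> M \<Longrightarrow> E (S + T) = E S + E T"
  and E_scaleC: "T \<in> M \<Longrightarrow> E (scaleC_op c T) = scaleC_op c (E T)"
  and E_pos: "T \<in> M \<Longrightarrow> positive_op T \<Longrightarrow> positive_op (E T)"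
  and E_bimodule: "R \<in> \<A> \<Longrightarrow> S \<in> \<A> \<Longrightarrow> T \<in> M \<Longrightarrow> E (R o\<^sub>L T o\<^sub>L S) = R o\<^sub>L E T o\<^sub>L S"
  using cond_exp by (auto simp: conditional_expectation_def linear_map_on_def positive_map_on_def)

lemma E_memM [simp, intro]: "T \<in> M \<Longrightarrow> E T \<in> M"
  using masa_subset by blast

lemma E_scaleR: "T \<in> M \<Longrightarrow> E (r *\<^sub>R T) = r *\<^sub>R E T"
  by (simp add: scaleR_eq_scaleC_op E_scaleC)

lemma E_zero [simp]: "E 0 = 0"
  by (rule E_fix) simp

lemma E_id [simp]: "E id_blinfun = id_blinfun"
  by (rule E_fix) simp

lemma E_diff: "S \<in> M \<Longrightarrow> T \<in> M \<Longrightarrow> E (S - T) = E S - E T"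
  using E_add[of S "- T"] E_scaleR[of T "-1"] by simp

lemma E_sum: "(\<And>i. i \<in> I \<Longrightarrow> f i \<in> M) \<Longrightarrow> E (sum f I) = (\<Sum>i\<in>I. E (f i))"
  by (induction I rule: infinite_finite_induct) (auto simp: E_add sum_mem)

lemma E_left: "R \<in> \<A> \<Longrightarrow> T \<in> M \<Longrightarrow> E (R o\<^sub>L T) = R o\<^sub>L E T"
  using E_bimodule[of R id_blinfun T] by simp

lemma tr_E: "T \<in> M \<Longrightarrow> tr (E T) = tr T"
  using E_trace by (simp add: tr_def trace_preserving_def)

text \<open>\<open>E\<close> is an orthogonal projection for the trace inner product: the module
  property gives \<open>tr (E T o\<^sub>L T) = tr (E T o\<^sub>L E T)\<close>, so
  \<open>T - E T\<close> is orthogonal to \<open>E T\<close>.\<close>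

lemma tnorm2_E_le:
  assumes "T \<in> M" "hermitian T" "hermitian (E T)"
  shows "tnorm2 (E T) \<le> tnorm2 T"
proof -
  have h: "adj T = T" "adj (E T) = E T" using assms by (auto simp: hermitian_def)
  have EE: "tr (E T o\<^sub>L T) = tnorm2 (E T)"
    using tr_E[of "E T o\<^sub>L T"] E_left[of "E T" T] assms by (simp add: h)
  then have EE': "tr (T o\<^sub>L E T) = tnorm2 (E T)" using tr_commute[of T "E T"] assms by simp
  have "adj (T - E T) o\<^sub>L (T - E T) = (T o\<^sub>L T) - (T o\<^sub>L E T) - (E T o\<^sub>L T) + (E T o\<^sub>L E T)"
    using assms h by (intro blinfun_eqI) (simp add: blinfun.bilinear_simps)
  then have "tnorm2 (T - E T) = tnorm2 T - tnorm2 (E T)"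
    using assms EE EE' h by (simp add: tr_diff tr_add)
  moreover have "0 \<le> tnorm2 (T - E T)" using assms by (intro tnorm2_pos) auto
  ultimately show ?thesis by simp
qed

end

text \<open>The identity times \<open>norm T\<close>, plus or minus \<open>T\<close>, is positive.
  Since \<open>positive_op\<close> includes being hermitian, positivity of the two images gives both
  symmetry and the norm bound. The lemma serves \<open>E\<close> as well as
  \<open>D\<close>.\<close>

lemma positive_map_hermitian:
  assumes T: "T \<in> M" "hermitian T" and M: "von_neumann_algebra M"
    and lin: "linear_map_on M F" and pos: "positive_map_on M F" and F1: "F id_blinfun = id_blinfun"
  shows "hermitian (F T)" "norm (F T) \<le> norm T"
proof -
  interpret vna M by standard (rule M)
  let ?c = "norm T"
  have F_add: "F (S + R) = F S + F R" if "S \<in> M" "R \<in> M" for S R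
    using lin that by (simp add: linear_map_on_def)
  have F_scale: "F (r *\<^sub>R S) = r *\<^sub>R F S" if "S \<in> M" for r S
    using lin that by (simp add: linear_map_on_def scaleR_eq_scaleC_op)
  have bound: "\<bar>inner (T v) v\<bar> \<le> ?c * inner v v" for v
    using inner_blinfun_le[of T v] by (simp add: power2_norm_eq_inner)
  have "positive_op (?c *\<^sub>R id_blinfun + s *\<^sub>R T)" if "\<bar>s\<bar> = 1" for s
  proof -
    have "0 \<le> inner ((?c *\<^sub>R id_blinfun + s *\<^sub>R T) v) v" for v
    proof -
      have "\<bar>s * inner (T v) v\<bar> \<le> ?c * inner v v" using bound[of v] that by (simp add: abs_mult)
      then show ?thesis by (simp add: blinfun.add_left blinfun.scaleR_left inner_add_left)
    qed
    then show ?thesis using T(2) by (simp add: positive_op_iff)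
  qed
  then have "positive_op (F (?c *\<^sub>R id_blinfun + s *\<^sub>R T))" if "\<bar>s\<bar> = 1" for s
    using pos that T(1) by (simp add: positive_map_on_def)
  then have P: "positive_op (?c *\<^sub>R id_blinfun + s *\<^sub>R F T)" if "\<bar>s\<bar> = 1" for s
    using that T(1) by (simp add: F_add F_scale F1)
  have "hermitian (?c *\<^sub>R id_blinfun + F T)" using P[of 1] by (simp add: positive_op_iff)
  then have "hermitian ((?c *\<^sub>R id_blinfun + F T) - ?c *\<^sub>R id_blinfun)"
    by (rule hermitian_intros(4)) simp
  then show h: "hermitian (F T)" by simp
  show "norm (F T) \<le> norm T"
  proof (rule hermitian_norm_le[OF h])
    fix v
    show "\<bar>inner (F T v) v\<bar> \<le> norm T * (norm v)\<^sup>2"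
      using P[of 1] P[of "-1"] by (auto simp: positive_op_iff blinfun.bilinear_simps inner_add_left
        inner_diff_left power2_norm_eq_inner abs_le_iff dest!: spec[of _ v])
  qed simp
qed

context masa_expectation
begin

lemma E_hermitian: "T \<in> M \<Longrightarrow> hermitian T \<Longrightarrow> hermitian (E T)"
  and norm_E_le: "T \<in> M \<Longrightarrow> hermitian T \<Longrightarrow> norm (E T) \<le> norm T"
  using positive_map_hermitian[of T M E] vna cond_exp by (auto simp: conditional_expectation_def)

text \<open>\<open>E\<close> preserves hermitian operators. Applied to \<open>X + adj X\<close> and
  to \<open>i (X - adj X)\<close> this makes both \<open>Y\<close> and \<open>i Y\<close> hermitian,
  so \<open>Y = 0\<close>.\<close>

lemma E_adj_zero:
  assumes X: "X \<in> M" "E X = 0"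
  shows "E (adj X) = 0"
proof -
  define Y where "Y = E (adj X)"
  have XM: "adj X \<in> M" and YM: "Y \<in> M" using X by (auto simp: Y_def)
  have "hermitian (E (X + adj X))"
    using X XM by (intro E_hermitian) (auto simp: hermitian_def add.commute)
  then have 1: "adj Y = Y" using X XM by (simp add: E_add hermitian_def Y_def)
  have "adj (scaleC_op \<i> (X - adj X)) = scaleC_op \<i> (X - adj X)"
    using X XM by (intro blinfun_eqI) (simp add: blinfun.bilinear_simps scaleC_diff
      scaleC_minus_left)
  then have "hermitian (E (scaleC_op \<i> (X - adj X)))"
    using X XM by (intro E_hermitian) (auto simp: hermitian_def)
  then have "hermitian (scaleC_op \<i> (- Y))" using X XM by (simp add: E_scaleC E_diff Y_def)
  then have "scaleC_op (- \<i>) (- Y) = scaleC_op \<i> (- Y)" using YM 1 by (simp add: hermitian_def)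
  then have eq: "scaleC_op (- \<i>) (- Y) v = scaleC_op \<i> (- Y) v" for v by (simp only:)
  have "\<i> *\<^sub>C Y v = - (\<i> *\<^sub>C Y v)" for v
    using eq[of v] by (simp only: scaleC_op_apply blinfun.minus_left scaleC_minus scaleC_minus_left minus_minus)
  then have "2 *\<^sub>R (\<i> *\<^sub>C Y v) = 0" for v by (metis add.right_inverse scaleR_2)
  then have "norm (Y v) = 0" for v using norm_scaleC[of \<i> "Y v"] by simp
  then have "Y v = 0" for v by simp
  then show ?thesis unfolding Y_def[symmetric] by (intro blinfun_eqI) simp
qed

text \<open>The corner and the kernel of \<open>E\<close> are both stable under adjoints, so the
  given kernel element may be replaced by \<open>X + adj X\<close>, or by \<open>i X\<close> if that
  sum vanishes.\<close>

lemma hermitian_kernel_element: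
  assumes ker: "\<And>P. P \<in> M \<Longrightarrow> projection P \<Longrightarrow> P \<noteq> 0 \<Longrightarrow> {X \<in> corner M P. E X = 0} \<noteq> {0}"
    and e: "e \<in> M" "projection e" "e \<noteq> 0"
  obtains Z where "Z \<in> M" "hermitian Z" "Z \<noteq> 0" "E Z = 0" "\<And>v. Z v = e (Z (e v))"
proof -
  have "0 \<in> {X \<in> corner M e. E X = 0}" by (auto simp: corner_def intro!: exI[of _ 0])
  then obtain X where X: "X \<in> corner M e" "E X = 0" "X \<noteq> 0" using ker[OF e] by blast
  then obtain Y where Y: "Y \<in> M" "X = e o\<^sub>L Y o\<^sub>L e" by (auto simp: corner_def)
  have XM: "X \<in> M" using Y e by simp
  have ee: "e (e v) = e v" and ecb: "e \<in> cbounded_ops" and ae: "adj e = e" for v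
    using e(2) by (auto intro: projectionD)
  have Xe: "X v = e (X (e v))" for v by (simp add: Y ee)
  have "adj X = e o\<^sub>L adj Y o\<^sub>L e" using Y e ae by (simp add: blinfun_compose_assoc)
  then have aXe: "adj X v = e (adj X (e v))" for v by (simp add: ee)
  have aX: "E (adj X) = 0" by (rule E_adj_zero[OF XM X(2)])
  show thesis
  proof (cases "X + adj X = 0")
    case False
    show thesis
    proof (rule that[of "X + adj X"])
      show "hermitian (X + adj X)" using XM by (auto simp: hermitian_def add.commute)
      show "(X + adj X) v = e ((X + adj X) (e v))" for v
        using Xe[of v] aXe[of v] by (simp add: blinfun.bilinear_simps)
    qed (use False XM X(2) aX in \<open>auto simp: E_add\<close>)
  next
    case True
    then have 1: "adj X = - X" by (simp add: add_eq_0_iff)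
    show thesis
    proof (rule that[of "scaleC_op \<i> X"])
      show "hermitian (scaleC_op \<i> X)"
        using XM 1 by (auto simp: hermitian_def blinfun.minus_left scaleC_minus_left intro!: blinfun_eqI)
      show "scaleC_op \<i> X \<noteq> 0"
      proof
        assume "scaleC_op \<i> X = 0"
        then have "\<i> *\<^sub>C X v = 0" for v by (metis scaleC_op_apply blinfun.zero_left)
        then have "norm (X v) = 0" for v using norm_scaleC[of \<i> "X v"] by simp
        then show False using X(3) by (auto intro!: blinfun_eqI)
      qed
      show "scaleC_op \<i> X v = e (scaleC_op \<i> X (e v))" for v
        using Xe[of v] ecb by (simp add: cbounded_ops_apply)
    qed (use XM X(2) in \<open>auto simp: E_scaleC intro!: blinfun_eqI\<close>)
  qed
qed

text \<open>The projection is an extreme point \<open>k\<close> of \<open>{y. 0 \<le> y \<le> p, E y = t E p}\<close>: otherwise \<open>k - k\<^sup>2 \<ge> \<epsilon> e\<close> for some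
  projection \<open>e \<noteq> 0\<close>, and \<open>k\<close> may be perturbed by a small hermitian element of \<open>eMe\<close> in the kernel of \<open>E\<close>.\<close>

lemma carpenter:
  assumes ker: "\<And>P. P \<in> M \<Longrightarrow> projection P \<Longrightarrow> P \<noteq> 0 \<Longrightarrow> {X \<in> corner M P. E X = 0} \<noteq> {0}"
    and p: "p \<in> M" "projection p" and t: "0 \<le> t" "t \<le> 1"
  obtains q where "q \<in> M" "projection q" "p o\<^sub>L q = q" "E q = t *\<^sub>R E p"
proof -
  define K where "K = {y \<in> M. hermitian y \<and> (\<forall>v. 0 \<le> inner (y v) v \<and> inner (y v) v \<le> inner (p v) v) \<and> E y = t *\<^sub>R E p}"
  have hp: "hermitian p" and pp: "p (p v) = p v" for v using p(2) by (auto intro: projectionD)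
  have p0: "0 \<le> inner (p v) v" for v by (simp add: inner_projection[OF p(2)])
  have "\<exists>k\<in>K. \<forall>z\<in>M. k + z \<in> K \<longrightarrow> k - z \<in> K \<longrightarrow> z = 0"
  proof (rule exists_extreme_point_M)
    show "K \<subseteq> M" by (auto simp: K_def)
    have "t *\<^sub>R p \<in> K"
      using p t hp p0 by (auto simp: K_def E_scaleR blinfun.scaleR_left mult_left_le_one_le)
    then show "K \<noteq> {}" by blast
    show "norm y \<le> 1" if "y \<in> K" for y
    proof (rule hermitian_norm_le)
      show "hermitian y" using that by (simp add: K_def)
      show "\<bar>inner (y v) v\<bar> \<le> 1 * (norm v)\<^sup>2" for v
      proof -
        have "0 \<le> inner (y v) v" "inner (y v) v \<le> inner (p v) v" using that by (auto simp: K_def)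
        then show ?thesis using inner_projection_le[OF p(2), of v] by simp
      qed
    qed simp
    fix f :: "nat \<Rightarrow> 'h op" and y
    assume f: "\<And>n. f n \<in> K" and y: "y \<in> M" "\<And>v. (\<lambda>n. f n v) \<longlonglongrightarrow> y v" "(\<lambda>n. tnorm2 (f n - y)) \<longlonglongrightarrow> 0"
    have hf: "hermitian (f n)" and fM: "f n \<in> M" and Ef: "E (f n) = t *\<^sub>R E p"
      and f_range: "0 \<le> inner (f n v) v" "inner (f n v) v \<le> inner (p v) v" for n v
      using f[of n] by (auto simp: K_def)
    have hy: "hermitian y" by (rule sot_limit_hermitian[OF hf y(2)])
    have lim: "(\<lambda>n. inner (f n v) v) \<longlonglongrightarrow> inner (y v) v" for v by (intro tendsto_intros y)
    have "0 \<le> inner (y v) v" "inner (y v) v \<le> inner (p v) v" for v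
      using LIMSEQ_le_const[OF lim] LIMSEQ_le_const2[OF lim] f_range by blast+
    \<comment> \<open>Strong convergence alone gives no control of \<open>E\<close>; its
      contractivity in trace norm on hermitian operators makes this constraint closed.\<close>
    moreover have "E y = t *\<^sub>R E p"
    proof -
      define D where "D = t *\<^sub>R E p - E y"
      have DM: "D \<in> M" using p y(1) by (simp add: D_def)
      have "tnorm2 D \<le> tnorm2 (f n - y)" for n
      proof -
        have "E (f n - y) = D" using fM y(1) by (simp add: E_diff Ef D_def)
        then show ?thesis using tnorm2_E_le[of "f n - y"] E_hermitian[of "f n - y"] fM hf hy y(1) by auto
      qed
      then have "tnorm2 D \<le> 0" by (intro LIMSEQ_le_const[OF y(3)]) auto
      then have "tnorm2 D = 0" using tnorm2_pos[OF DM] by simp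
      then have "D = 0" by (rule tnorm2_faithful[OF DM])
      then show ?thesis by (simp add: D_def)
    qed
    ultimately show "y \<in> K" using y(1) hy by (simp add: K_def)
  qed
  then obtain k where kK: "k \<in> K" and ext: "\<And>z. z \<in> M \<Longrightarrow> k + z \<in> K \<Longrightarrow> k - z \<in> K \<Longrightarrow> z = 0"
    by blast
  have kM: "k \<in> M" and hk: "hermitian k" and k0: "\<And>v. 0 \<le> inner (k v) v"
    and k_le: "\<And>v. inner (k v) v \<le> inner (p v) v" and Ek: "E k = t *\<^sub>R E p"
    using kK by (auto simp: K_def)
  have kpos: "positive_op k" using hk k0 by (simp add: positive_op_iff)
  have nk: "norm k \<le> 1"
  proof (rule hermitian_norm_le[OF hk])
    show "\<bar>inner (k v) v\<bar> \<le> 1 * (norm v)\<^sup>2" for v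
      using k0[of v] k_le[of v] inner_projection_le[OF p(2), of v] by simp
  qed simp
  have kk: "(norm (k v))\<^sup>2 \<le> inner (k v) v" for v
    using positive_op_norm_apply[OF kpos, of v] mult_right_mono[OF nk k0[of v]] by linarith
  \<comment> \<open>\<open>k\<^sup>2 \<le> k \<le> p\<close> makes \<open>k\<close> vanish on the
    kernel of \<open>p\<close>.\<close>
  have kp: "k (p v) = k v" for v
  proof -
    have "(norm (k (v - p v)))\<^sup>2 \<le> inner (p (v - p v)) (v - p v)"
      using kk[of "v - p v"] k_le[of "v - p v"] by linarith
    also have "\<dots> = 0" by (simp add: blinfun.diff_right pp)
    finally show ?thesis by (simp add: blinfun.diff_right)
  qed
  have pk: "p (k v) = k v" for v
  proof (rule inner_right_ext)
    show "inner w (p (k v)) = inner w (k v)" for w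
      using kp[of w] by (metis hermitian_inner[OF hk] hermitian_inner[OF hp])
  qed
  define w where "w = k - (k o\<^sub>L k)"
  have w_inner: "inner (w v) v = inner (k v) v - (norm (k v))\<^sup>2" for v
    using hermitian_inner[OF hk, of "k v" v]
    by (simp add: w_def blinfun.diff_left inner_diff_left power2_norm_eq_inner)
  have wM: "w \<in> M" using kM by (simp add: w_def)
  have hw: "hermitian w" using hk by (auto simp: w_def intro: hermitian_compose_commute)
  have wpos: "positive_op w" using hw kk by (simp add: positive_op_iff w_inner)
  have "w = 0"
  proof (rule ccontr)
    assume "w \<noteq> 0"
    from positive_op_dominates_projection[OF wM wpos this]
    obtain e s where e: "e \<in> M" "projection e" "e \<noteq> 0" "0 < s"
      "\<And>v. s * (norm (e v))\<^sup>2 \<le> inner (w v) v" by metis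
    obtain Z where Z: "Z \<in> M" "hermitian Z" "Z \<noteq> 0" "E Z = 0" "\<And>v. Z v = e (Z (e v))"
      by (rule hermitian_kernel_element[OF ker e(1-3)], assumption+, rule that)
    \<comment> \<open>Scaled so that the form of \<open>z\<close> is bounded in absolute value by
      that of \<open>s e\<close>, and hence by that of \<open>w\<close>.\<close>
    define z where "z = (s / norm Z) *\<^sub>R Z"
    have zM: "z \<in> M" and hz: "hermitian z" and Ez: "E z = 0"
      using Z by (auto simp: z_def E_scaleR)
    have z_le: "\<bar>inner (z v) v\<bar> \<le> inner (w v) v" for v
    proof -
      have "inner (Z v) v = inner (Z (e v)) (e v)"
        by (subst Z(5)) (rule hermitian_inner[OF projectionD(1)[OF e(2)]])
      then have "\<bar>inner (z v) v\<bar> = (s / norm Z) * \<bar>inner (Z (e v)) (e v)\<bar>"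
        using e(4) by (simp add: z_def blinfun.scaleR_left abs_mult)
      also have "\<dots> \<le> (s / norm Z) * (norm Z * (norm (e v))\<^sup>2)"
        using e(4) by (intro mult_left_mono inner_blinfun_le) auto
      also have "\<dots> = s * (norm (e v))\<^sup>2" using Z(3) by simp
      also have "\<dots> \<le> inner (w v) v" by (rule e(5))
      finally show ?thesis .
    qed
    have w_k: "inner (w v) v \<le> inner (k v) v" for v by (simp add: w_inner)
    \<comment> \<open>\<open>p - k - w = (p - k)\<^sup>2\<close> is positive, so the upper
      constraint also leaves room for a perturbation of size \<open>w\<close>.\<close>
    have w_pk: "inner (w v) v \<le> inner (p v) v - inner (k v) v" for v
    proof -
      have "inner (p v) (k v) = inner (k v) v"
        by (metis hermitian_inner[OF hp] pk inner_commute)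
      moreover have "(norm (p v - k v))\<^sup>2 = (norm (p v))\<^sup>2 - 2 * inner (p v) (k v) + (norm (k v))\<^sup>2"
        by (simp add: power2_norm_eq_inner inner_diff_left inner_diff_right inner_commute)
      ultimately have "0 \<le> inner (p v) v - 2 * inner (k v) v + (norm (k v))\<^sup>2"
        using zero_le_power2[of "norm (p v - k v)"] inner_projection[OF p(2), of v] by linarith
      then show ?thesis by (simp add: w_inner)
    qed
    have "k + r *\<^sub>R z \<in> K" if "\<bar>r\<bar> = 1" for r
    proof -
      have "\<bar>r * inner (z v) v\<bar> \<le> inner (w v) v" for v using z_le[of v] that by (simp add: abs_mult)
      then have "0 \<le> inner (k v) v + r * inner (z v) v \<and> inner (k v) v + r * inner (z v) v \<le> inner (p v) v" for v
        using w_k[of v] w_pk[of v] by (smt (verit))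
      then show ?thesis using kM zM hk hz Ek Ez
        by (simp add: K_def E_add E_scaleR blinfun.bilinear_simps inner_add_left)
    qed
    from this[of 1] this[of "-1"] have "z = 0" using ext[OF zM] by simp
    then show False using Z(3) e(4) by (simp add: z_def)
  qed
  then have "k o\<^sub>L k = k" by (simp add: w_def)
  then show thesis using pk by (intro that[OF kM _ _ Ek]) (auto simp: projection_def hk intro!: blinfun_eqI)
qed

end

subsection \<open>Joint spectral cells\<close>

text \<open>The newest bit is the head, so the children of a cell arise by \<open>Cons\<close>, and
  the length of the tail is the index of the projection that splits it.\<close>

primrec cell :: "(nat \<Rightarrow> 'h::complex_hilbert op) \<Rightarrow> bool list \<Rightarrow> 'h op" where
  "cell e [] = id_blinfun"
| "cell e (b # bs) = (if b then e (length bs) else id_blinfun - e (length bs)) o\<^sub>L cell e bs"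

lemma cell_split: "cell e (True # bs) + cell e (False # bs) = cell e bs"
  by (rule blinfun_eqI) (simp add: blinfun.bilinear_simps)

lemma commute_cell:
  assumes "\<And>n. C o\<^sub>L e n = e n o\<^sub>L C"
  shows "C o\<^sub>L cell e bs = cell e bs o\<^sub>L C"
proof (induction bs)
  case (Cons b bs)
  show ?case
    unfolding cell.simps
    by (intro commute_compose Cons) (simp add: assms commute_diff)
qed simp

lemma projection_compose:
  assumes "projection P" "projection Q" "P o\<^sub>L Q = Q o\<^sub>L P"
  shows "projection (P o\<^sub>L Q)"
proof -
  have "P (Q (P (Q v))) = P (Q v)" for v
    using commute_apply[OF assms(3)] assms(1,2) by (simp add: projectionD)
  then have "(P o\<^sub>L Q) o\<^sub>L (P o\<^sub>L Q) = P o\<^sub>L Q" by (intro blinfun_eqI) simp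
  moreover have "hermitian (P o\<^sub>L Q)"
    using assms by (intro hermitian_compose_commute projectionD(1))
  ultimately show ?thesis by (simp add: projection_def)
qed

definition bool_lists :: "nat \<Rightarrow> bool list set" where
  "bool_lists m = {bs. length bs = m}"

lemma bool_lists_0: "bool_lists 0 = {[]}"
  by (auto simp: bool_lists_def)

lemma bool_lists_Suc: "bool_lists (Suc m) = (\<lambda>bs. True # bs) ` bool_lists m \<union> (\<lambda>bs. False # bs) ` bool_lists m"
  by (auto simp: bool_lists_def length_Suc_conv image_iff)

lemma finite_bool_lists [simp]: "finite (bool_lists m)"
  by (induction m) (auto simp: bool_lists_0 bool_lists_Suc)

lemma sum_bool_lists_Suc:
  "(\<Sum>bs\<in>bool_lists (Suc m). f bs) = (\<Sum>bs\<in>bool_lists m. f (True # bs) + f (False # bs))"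
proof -
  have "(\<Sum>bs\<in>bool_lists (Suc m). f bs)
      = (\<Sum>bs\<in>(\<lambda>bs. True # bs) ` bool_lists m. f bs) + (\<Sum>bs\<in>(\<lambda>bs. False # bs) ` bool_lists m. f bs)"
    unfolding bool_lists_Suc by (rule sum.union_disjoint) auto
  then show ?thesis by (simp add: sum.reindex inj_on_def sum.distrib)
qed

locale commuting_projections =
  fixes e :: "nat \<Rightarrow> 'h::complex_hilbert op"
  assumes e_proj: "\<And>n. projection (e n)" and e_comm: "\<And>m n. e m o\<^sub>L e n = e n o\<^sub>L e m"
begin

lemma half_proj: "projection (if b then e n else id_blinfun - e n)"
  using e_proj projection_complement[OF e_proj] by simp

lemma half_comm: "(if b then e n else id_blinfun - e n) o\<^sub>L cell e bs = cell e bs o\<^sub>L (if b then e n else id_blinfun - e n)"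
proof (rule commute_cell)
  fix m
  have "e m o\<^sub>L (if b then e n else id_blinfun - e n) = (if b then e n else id_blinfun - e n) o\<^sub>L e m"
    by (simp add: e_comm commute_diff)
  then show "(if b then e n else id_blinfun - e n) o\<^sub>L e m = e m o\<^sub>L (if b then e n else id_blinfun - e n)" by simp
qed

lemma cell_proj: "projection (cell e bs)"
proof (induction bs)
  case Nil
  then show ?case by (simp add: projection_def)
next
  case (Cons b bs)
  show ?case unfolding cell.simps by (rule projection_compose[OF half_proj Cons half_comm])
qed

lemma cell_fixed_Cons:
  assumes "cell e (b # bs) v = v"
  shows "(if b then e (length bs) else id_blinfun - e (length bs)) v = v" "cell e bs v = v"
proof -
  let ?h = "if b then e (length bs) else id_blinfun - e (length bs)"
  have v: "v = ?h (cell e bs v)" using assms by simp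
  show "?h v = v" by (subst (1 2) v) (rule projectionD(5)[OF half_proj])
  have "cell e bs v = cell e bs (cell e bs (?h v))"
    using v commute_apply[OF half_comm[of b "length bs" bs], of v] projectionD(5)[OF cell_proj[of bs]] by metis
  also have "\<dots> = cell e bs (?h v)" by (rule projectionD(5)[OF cell_proj])
  also have "\<dots> = v" using v commute_apply[OF half_comm[of b "length bs" bs], of v] by simp
  finally show "cell e bs v = v" .
qed

text \<open>The bit recorded at depth \<open>k\<close> decides whether \<open>e k\<close> acts as 1
  or as 0 on the range of the cell. This converts bit strings into spectral bounds.\<close>

lemma cell_fixed_dichotomy:
  assumes "k < length bs"
  shows "(\<forall>v. cell e bs v = v \<longrightarrow> e k v = v) \<or> (\<forall>v. cell e bs v = v \<longrightarrow> e k v = 0)"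
  using assms
proof (induction bs)
  case (Cons b bs)
  show ?case
  proof (cases "k = length bs")
    case True
    have "if b then e k v = v else e k v = 0" if "cell e (b # bs) v = v" for v
      using cell_fixed_Cons(1)[OF that] True by (cases b) (auto simp: blinfun.diff_left)
    then show ?thesis by (cases b) auto
  next
    case False
    then have "k < length bs" using Cons by simp
    then show ?thesis using Cons.IH cell_fixed_Cons(2)[of b bs] by meson
  qed
qed simp

lemma cell_orthogonal:
  "length bs = length cs \<Longrightarrow> bs \<noteq> cs \<Longrightarrow> cell e bs o\<^sub>L cell e cs = 0"
proof (induction bs cs rule: list_induct2)
  case (Cons b bs c cs)
  have "cell e (b # bs) (cell e (c # cs) v) = 0" for v
  proof -
    let ?u = "cell e (c # cs) v"
    have u: "cell e (c # cs) ?u = ?u" by (rule projectionD(5)[OF cell_proj])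
    note u' = cell_fixed_Cons[OF u]
    show ?thesis
    proof (cases "b = c")
      case True
      then have "cell e bs o\<^sub>L cell e cs = 0" using Cons by simp
      then have "cell e bs (cell e cs ?u) = 0" by (metis blinfun_apply_blinfun_compose blinfun.zero_left)
      then have "cell e bs ?u = 0" using u'(2) by simp
      then show ?thesis by (simp only: cell.simps blinfun_apply_blinfun_compose blinfun.zero_right)
    next
      case False
      then have "(if b then e (length bs) else id_blinfun - e (length bs)) ?u = 0"
        using u'(1) Cons.hyps by (cases b; cases c) (auto simp: blinfun.diff_left)
      then have "cell e bs ((if b then e (length bs) else id_blinfun - e (length bs)) ?u) = 0"
        by (simp only: blinfun.zero_right)
      then show ?thesis
        using commute_apply[OF half_comm[of b "length bs" bs], of ?u]
        by (simp only: cell.simps blinfun_apply_blinfun_compose)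
    qed
  qed
  then show ?case by (intro blinfun_eqI) (simp only: blinfun_apply_blinfun_compose blinfun.zero_left)
qed simp

lemma cell_partition: "partition_of_unity (bool_lists m) (cell e)"
  unfolding partition_of_unity_def
proof (intro conjI ballI impI cell_proj finite_bool_lists)
  show "sum (cell e) (bool_lists m) = id_blinfun"
  proof (induction m)
    case (Suc m)
    then show ?case by (simp only: sum_bool_lists_Suc cell_split)
  qed (simp add: bool_lists_0)
qed (auto simp: bool_lists_def intro!: cell_orthogonal)

end

lemma partition_of_unity_norm:
  assumes "partition_of_unity J P"
  shows "(\<Sum>j\<in>J. (norm (P j v))\<^sup>2) = (norm v)\<^sup>2"
proof -
  have "(\<Sum>j\<in>J. (norm (P j v))\<^sup>2) = (\<Sum>j\<in>J. inner (P j v) v)"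
    using assms by (intro sum.cong) (auto simp: partition_of_unity_def inner_projection)
  also have "\<dots> = inner (sum P J v) v" by (simp add: blinfun.sum_left inner_sum_left)
  finally show ?thesis using assms by (simp add: partition_of_unity_def power2_norm_eq_inner)
qed

text \<open>The cells are orthogonal and reduce \<open>S\<close>, so errors do not add up: each cell
  contributes at most \<open>d\<close> times the squared norm of its own component of
  \<open>v\<close>.\<close>

lemma partition_approximation:
  assumes P: "partition_of_unity J P" and S: "hermitian S"
    and comm: "\<And>j. j \<in> J \<Longrightarrow> S o\<^sub>L P j = P j o\<^sub>L S"
    and le: "\<And>j. j \<in> J \<Longrightarrow> norm ((S - \<mu> j *\<^sub>R id_blinfun) o\<^sub>L P j) \<le> d" and d: "0 \<le> d"
  shows "norm (S - (\<Sum>j\<in>J. \<mu> j *\<^sub>R P j)) \<le> d"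
proof (rule hermitian_norm_le[OF _ d])
  have Pj: "projection (P j)" if "j \<in> J" for j using P that by (simp add: partition_of_unity_def)
  show "hermitian (S - (\<Sum>j\<in>J. \<mu> j *\<^sub>R P j))"
    using S Pj projectionD(1) by (intro hermitian_intros hermitian_sum) auto
  fix v
  let ?R = "\<lambda>j. (S - \<mu> j *\<^sub>R id_blinfun) o\<^sub>L P j"
  have "S v = S (sum P J v)" using P by (simp add: partition_of_unity_def)
  then have "(S - (\<Sum>j\<in>J. \<mu> j *\<^sub>R P j)) v = (\<Sum>j\<in>J. ?R j v)"
    by (simp add: blinfun.bilinear_simps sum_subtractf)
  then have "\<bar>inner ((S - (\<Sum>j\<in>J. \<mu> j *\<^sub>R P j)) v) v\<bar> = \<bar>\<Sum>j\<in>J. inner (?R j v) v\<bar>"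
    by (simp add: inner_sum_left)
  also have "\<dots> \<le> (\<Sum>j\<in>J. \<bar>inner (?R j v) v\<bar>)" by (rule sum_abs)
  also have "\<dots> \<le> (\<Sum>j\<in>J. d * (norm (P j v))\<^sup>2)"
  proof (rule sum_mono)
    fix j assume j: "j \<in> J"
    have pp: "P j (P j x) = P j x" for x by (rule projectionD(5)[OF Pj[OF j]])
    have "?R j v = P j (?R j v)"
      using commute_apply[OF comm[OF j]] by (simp add: blinfun.bilinear_simps pp)
    then have "inner (?R j v) v = inner (?R j v) (P j v)"
      by (metis hermitian_inner[OF projectionD(1)[OF Pj[OF j]]])
    also have "?R j v = ?R j (P j v)" by (simp add: pp)
    finally have "\<bar>inner (?R j v) v\<bar> \<le> norm (?R j) * (norm (P j v))\<^sup>2"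
      using inner_blinfun_le[of "?R j" "P j v"] by (simp add: pp)
    also have "\<dots> \<le> d * (norm (P j v))\<^sup>2" using le[OF j] by (intro mult_right_mono) auto
    finally show "\<bar>inner (?R j v) v\<bar> \<le> d * (norm (P j v))\<^sup>2" .
  qed
  also have "\<dots> = d * (norm v)\<^sup>2"
    by (simp add: partition_of_unity_norm[OF P] flip: sum_distrib_left)
  finally show "\<bar>inner ((S - (\<Sum>j\<in>J. \<mu> j *\<^sub>R P j)) v) v\<bar> \<le> d * (norm v)\<^sup>2" .
qed

text \<open>\<open>e\<close> enumerates the spectral projections of all \<open>S i\<close> at all rational thresholds.\<close>

lemma (in vna) spectral_sequence:
  fixes S :: "'n::finite \<Rightarrow> 'h op"
  assumes SM: "\<And>i. S i \<in> M" and SH: "\<And>i. hermitian (S i)"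
    and comm: "\<And>i j. S i o\<^sub>L S j = S j o\<^sub>L S i"
  obtains e :: "nat \<Rightarrow> 'h op" where "commuting_projections e" "\<And>n. e n \<in> M"
    "\<And>C n. C \<in> cbounded_ops \<Longrightarrow> (\<And>i. C o\<^sub>L S i = S i o\<^sub>L C) \<Longrightarrow> C o\<^sub>L e n = e n o\<^sub>L C"
    "\<And>d. 0 < d \<Longrightarrow> \<exists>m. \<forall>bs. m \<le> length bs \<longrightarrow>
        (\<exists>\<mu>. \<forall>i. norm ((S i - \<mu> i *\<^sub>R id_blinfun) o\<^sub>L cell e bs) \<le> d)"
proof -
  have "\<exists>g. g \<in> M \<and> projection g \<and> (\<forall>C. C \<in> cbounded_ops \<longrightarrow> C o\<^sub>L S i = S i o\<^sub>L C \<longrightarrow> C o\<^sub>L g = g o\<^sub>L C) \<and>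
    (\<forall>v. g v = v \<longrightarrow> t * (norm v)\<^sup>2 \<le> inner (S i v) v) \<and> (\<forall>v. g v = 0 \<longrightarrow> inner (S i v) v \<le> t * (norm v)\<^sup>2)"
    for i t
    using spectral_projection_mem[OF SM[of i] SH[of i], where t = t] by metis
  then obtain g where g: "\<And>i t. g i t \<in> M" "\<And>i t. projection (g i t)"
    "\<And>i t C. C \<in> cbounded_ops \<Longrightarrow> C o\<^sub>L S i = S i o\<^sub>L C \<Longrightarrow> C o\<^sub>L g i t = g i t o\<^sub>L C"
    "\<And>i t v. g i t v = v \<Longrightarrow> t * (norm v)\<^sup>2 \<le> inner (S i v) v"
    "\<And>i t v. g i t v = 0 \<Longrightarrow> inner (S i v) v \<le> t * (norm v)\<^sup>2"
    by metis
  define e where "e n = (case from_nat n :: 'n \<times> rat of (i, r) \<Rightarrow> g i (of_rat r))" for n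
  have e_ir: "e (to_nat (i, r)) = g i (of_rat r)" for i r by (simp add: e_def)
  have eM: "e n \<in> M" and ep: "projection (e n)" for n by (auto simp: e_def g split: prod.split)
  have e_commI: "C o\<^sub>L e n = e n o\<^sub>L C" if "C \<in> cbounded_ops" "\<And>i. C o\<^sub>L S i = S i o\<^sub>L C" for C n
    using that by (auto simp: e_def g(3) split: prod.split)
  have eS: "S i o\<^sub>L e n = e n o\<^sub>L S i" for i n by (rule e_commI) (use SM comm in auto)
  have ee: "e m o\<^sub>L e n = e n o\<^sub>L e m" for m n by (rule e_commI) (use eM eS in auto)
  interpret commuting_projections e by standard (rule ep, rule ee)
  have Scell: "S i o\<^sub>L cell e bs = cell e bs o\<^sub>L S i" for i bs by (rule commute_cell) (rule eS)
  have approx: "\<exists>m. \<forall>bs. m \<le> length bs \<longrightarrow>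
        (\<exists>\<mu>. \<forall>i. norm ((S i - \<mu> i *\<^sub>R id_blinfun) o\<^sub>L cell e bs) \<le> d)" if d: "0 < d" for d
  proof -
    obtain N where N: "1 / d < real N" using reals_Archimedean2 by blast
    then have N0: "0 < real N" using d by (smt (verit) divide_pos_pos)
    then have Nd: "1 / real N \<le> d" using N d by (simp add: field_simps)
    obtain c where c: "(\<Sum>i\<in>UNIV. norm (S i)) \<le> real c" using real_arch_simple by blast
    have Sc: "norm (S i) \<le> real c" for i
      using c member_le_sum[of i UNIV "\<lambda>i. norm (S i)"] by simp
    \<comment> \<open>Rational thresholds from \<open>-c\<close> to \<open>c\<close> with spacing
      \<open>1 / N \<le> d\<close>. \<open>J\<close> is the index of the last one, and
      \<open>m\<close> exceeds the codes of all of them, so a string of length at least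
      \<open>m\<close> has decided every threshold for every \<open>i\<close>.\<close>
    define r where "r j = - of_nat c + of_nat j / (of_nat N :: rat)" for j :: nat
    define t where "t j = (of_rat (r j) :: real)" for j
    have t: "t j = - real c + real j / real N" for j
      by (simp add: t_def r_def of_rat_add of_rat_divide of_rat_minus of_rat_diff)
    define J where "J = 2 * c * N"
    define m where "m = Suc (Max ((\<lambda>(i, j). to_nat (i :: 'n, r j)) ` (UNIV \<times> {..J})))"
    have m: "to_nat (i, r j) < m" if "j \<le> J" for i :: 'n and j
      unfolding m_def less_Suc_eq_le using that by (intro Max_ge) (auto intro!: image_eqI[of _ _ "(i, j)"])
    have "\<exists>\<mu>. norm ((S i - \<mu> *\<^sub>R id_blinfun) o\<^sub>L cell e bs) \<le> d" if bs: "m \<le> length bs" for bs i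
    proof -
      define lower upper where "lower j \<longleftrightarrow> (\<forall>v. cell e bs v = v \<longrightarrow> t j * (norm v)\<^sup>2 \<le> inner (S i v) v)"
        and "upper j \<longleftrightarrow> (\<forall>v. cell e bs v = v \<longrightarrow> inner (S i v) v \<le> t j * (norm v)\<^sup>2)" for j
      have dich: "lower j \<or> upper j" if "j \<le> J" for j
        using cell_fixed_dichotomy[of "to_nat (i, r j)" bs] m[OF that, of i] bs g(4,5)[of i "t j"]
        by (auto simp: e_ir lower_def upper_def t_def)
      have S_le: "\<bar>inner (S i v) v\<bar> \<le> real c * (norm v)\<^sup>2" for v
        using inner_blinfun_le[of "S i" v] mult_right_mono[OF Sc[of i], of "(norm v)\<^sup>2"] by simp
      have "t J = real c" using N0 by (simp add: t J_def)
      then have uJ: "upper J" using S_le by (simp add: upper_def abs_le_iff)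
      \<comment> \<open>The least threshold that bounds \<open>S i\<close> from above on the cell.
        Its predecessor must then be a lower bound, and \<open>t 0 = -c\<close> is a lower bound
        anyway.\<close>
      define k where "k = (LEAST j. upper j)"
      have uk: "upper k" and kJ: "k \<le> J" using uJ by (auto simp: k_def intro: LeastI Least_le)
      have "\<exists>\<mu>. \<forall>v. cell e bs v = v \<longrightarrow> \<mu> * (norm v)\<^sup>2 \<le> inner (S i v) v \<and> inner (S i v) v \<le> (\<mu> + d) * (norm v)\<^sup>2"
      proof (cases k)
        case 0
        show ?thesis
        proof (intro exI[of _ "t 0"] allI impI conjI)
          fix v assume v: "cell e bs v = v"
          show "t 0 * (norm v)\<^sup>2 \<le> inner (S i v) v" using S_le[of v] by (simp add: t)
          have "inner (S i v) v \<le> t 0 * (norm v)\<^sup>2" using uk v by (simp add: upper_def 0)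
          also have "\<dots> \<le> (t 0 + d) * (norm v)\<^sup>2" using d by (intro mult_right_mono) auto
          finally show "inner (S i v) v \<le> (t 0 + d) * (norm v)\<^sup>2" .
        qed
      next
        case (Suc j)
        then have "\<not> upper j" using not_less_Least[of j upper] by (simp add: k_def)
        then have lj: "lower j" using dich[of j] kJ Suc by simp
        have "t k \<le> t j + d" using Nd by (simp add: t Suc add_divide_distrib)
        then have "t k * (norm v)\<^sup>2 \<le> (t j + d) * (norm v)\<^sup>2" for v by (intro mult_right_mono) auto
        then show ?thesis
          using lj uk by (intro exI[of _ "t j"]) (auto simp: lower_def upper_def intro: order_trans)
      qed
      then obtain \<mu> where \<mu>: "\<And>v. cell e bs v = v \<Longrightarrow> \<mu> * (norm v)\<^sup>2 \<le> inner (S i v) v"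
        "\<And>v. cell e bs v = v \<Longrightarrow> inner (S i v) v \<le> (\<mu> + d) * (norm v)\<^sup>2" by blast
      let ?C = "cell e bs" and ?R = "(S i - \<mu> *\<^sub>R id_blinfun) o\<^sub>L cell e bs"
      have cc: "?C (?C v) = ?C v" for v by (rule projectionD(5)[OF cell_proj])
      have hC: "hermitian ?C" by (rule projectionD(1)[OF cell_proj])
      have "?C o\<^sub>L (S i - \<mu> *\<^sub>R id_blinfun) = (S i - \<mu> *\<^sub>R id_blinfun) o\<^sub>L ?C"
        by (intro commute_diff commute_scaleR commute_id Scell[symmetric])
      then have hR: "hermitian ?R" using SH hC by (intro hermitian_compose_commute) auto
      have "norm ?R \<le> d"
      proof (rule hermitian_norm_le[OF hR])
        fix v
        have sc: "S i (?C w) = ?C (S i w)" for w by (rule commute_apply[OF Scell])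
        have "?R v = ?C (?R v)" by (simp add: blinfun.bilinear_simps sc cc)
        then have "inner (?R v) v = inner (?R v) (?C v)" by (metis hermitian_inner[OF hC])
        then have "inner (?R v) v = inner (S i (?C v)) (?C v) - \<mu> * (norm (?C v))\<^sup>2"
          by (simp add: blinfun.bilinear_simps inner_diff_left power2_norm_eq_inner)
        then have "\<bar>inner (?R v) v\<bar> \<le> d * (norm (?C v))\<^sup>2"
          using \<mu>[OF cc[of v]] by (simp add: algebra_simps abs_le_iff)
        also have "\<dots> \<le> d * (norm v)\<^sup>2"
          using d norm_projection_apply[OF cell_proj] by (intro mult_left_mono power_mono) auto
        finally show "\<bar>inner (?R v) v\<bar> \<le> d * (norm v)\<^sup>2" .
      qed (use d in simp)
      then show ?thesis by blast
    qed
    then have "\<forall>bs. m \<le> length bs \<longrightarrow> (\<exists>\<mu>. \<forall>i. norm ((S i - \<mu> i *\<^sub>R id_blinfun) o\<^sub>L cell e bs) \<le> d)"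
      by (metis choice)
    then show ?thesis by blast
  qed
  show thesis
  proof (rule that)
    show "commuting_projections e" by standard
    show "C o\<^sub>L e n = e n o\<^sub>L C" if "C \<in> cbounded_ops" "\<And>i. C o\<^sub>L S i = S i o\<^sub>L C" for C n
      by (rule e_commI) (use that in auto)
  qed (use eM approx in auto)
qed

subsection \<open>Operators with finite joint spectrum\<close>

text \<open>Approximate eigenvectors: along unit vectors \<open>v\<close> the approximate eigenvalue
  is unique, additive and multiplicative, so it is a character on any algebra on which it
  exists.\<close>

definition asym_eig :: "(nat \<Rightarrow> 'h::complex_hilbert) \<Rightarrow> 'h op \<Rightarrow> complex \<Rightarrow> bool" where
  "asym_eig v b c \<longleftrightarrow> (\<lambda>m. b (v m) - c *\<^sub>C v m) \<longlonglongrightarrow> 0"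

lemma asym_eig_add: "asym_eig v a c \<Longrightarrow> asym_eig v b d \<Longrightarrow> asym_eig v (a + b) (c + d)"
  unfolding asym_eig_def
  by (drule (1) tendsto_add) (simp add: blinfun.add_left scaleC_add_left algebra_simps)

lemma asym_eig_scaleC:
  assumes "asym_eig v b d"
  shows "asym_eig v (scaleC_op c b) (c * d)"
  using bounded_linear.tendsto[OF bounded_linear_scaleC[of c] assms[unfolded asym_eig_def]]
  by (simp add: asym_eig_def scaleC_diff scaleC_scaleC)

lemma asym_eig_compose:
  assumes "asym_eig v a c" "asym_eig v b d" "a \<in> cbounded_ops"
  shows "asym_eig v (a o\<^sub>L b) (c * d)"
proof -
  have "(\<lambda>m. a (b (v m) - d *\<^sub>C v m) + d *\<^sub>C (a (v m) - c *\<^sub>C v m)) \<longlonglongrightarrow> a 0 + d *\<^sub>C 0"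
    using assms(1,2) unfolding asym_eig_def
    by (intro tendsto_intros bounded_linear.tendsto[OF bounded_linear_scaleC])
  moreover have "a (b (v m) - d *\<^sub>C v m) + d *\<^sub>C (a (v m) - c *\<^sub>C v m) = (a o\<^sub>L b) (v m) - (c * d) *\<^sub>C v m" for m
    using assms(3) by (simp add: blinfun.diff_right cbounded_ops_apply scaleC_diff scaleC_scaleC mult.commute)
  ultimately show ?thesis by (simp add: asym_eig_def)
qed

lemma asym_eig_id: "asym_eig v id_blinfun 1"
  by (simp add: asym_eig_def)

lemma asym_eig_zero: "asym_eig v 0 0"
  by (simp add: asym_eig_def)

lemma asym_eig_diff: "asym_eig v a c \<Longrightarrow> asym_eig v b d \<Longrightarrow> asym_eig v (a - b) (c - d)"
  using asym_eig_add[of v a c "scaleC_op (-1) b" "-1 * d"] asym_eig_scaleC[of v b d "-1"]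
    scaleR_eq_scaleC_op[of "-1" b, symmetric] by simp

lemma asym_eig_le:
  assumes unit: "\<And>m. norm (v m) = 1" and b: "asym_eig v a c" "asym_eig v b d"
  shows "cmod (c - d) \<le> norm (a - b)"
proof -
  have lim: "(\<lambda>m. norm ((a - b) (v m) - (c - d) *\<^sub>C v m)) \<longlonglongrightarrow> norm (0::'a)"
    using asym_eig_diff[OF b] unfolding asym_eig_def by (intro tendsto_norm)
  have "cmod (c - d) \<le> norm ((a - b) (v m) - (c - d) *\<^sub>C v m) + norm (a - b)" for m
  proof -
    have "cmod (c - d) = norm ((c - d) *\<^sub>C v m)" by (simp add: norm_scaleC unit)
    also have "\<dots> \<le> norm ((a - b) (v m) - (c - d) *\<^sub>C v m) + norm ((a - b) (v m))"
      by (metis norm_minus_commute norm_triangle_sub add.commute)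
    also have "norm ((a - b) (v m)) \<le> norm (a - b)" using norm_blinfun[of "a - b" "v m"] by (simp add: unit)
    finally show ?thesis by simp
  qed
  then have "cmod (c - d) \<le> norm (0::'a) + norm (a - b)"
    by (intro LIMSEQ_le_const[OF tendsto_add[OF lim tendsto_const]]) auto
  then show ?thesis by simp
qed

lemma asym_eig_unique:
  assumes "\<And>m. norm (v m) = 1" "asym_eig v b c" "asym_eig v b d"
  shows "c = d"
  using asym_eig_le[OF assms] by simp

lemma asym_eig_closed:
  assumes unit: "\<And>m. norm (v m) = 1" and b: "b \<longlonglongrightarrow> b'" and c: "\<And>k. asym_eig v (b k) (c k)"
  obtains c' where "c \<longlonglongrightarrow> c'" "asym_eig v b' c'"
proof -
  have "Cauchy c"
  proof (rule CauchyI)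
    fix r :: real assume "0 < r"
    then obtain N where N: "\<And>m n. m \<ge> N \<Longrightarrow> n \<ge> N \<Longrightarrow> norm (b m - b n) < r"
      using CauchyD[OF LIMSEQ_imp_Cauchy[OF b]] by meson
    have "norm (c m - c n) < r" if "m \<ge> N" "n \<ge> N" for m n
      using N[OF that] asym_eig_le[OF unit c c, of m n] by linarith
    then show "\<exists>M. \<forall>m\<ge>M. \<forall>n\<ge>M. norm (c m - c n) < r" by blast
  qed
  then obtain c' where c': "c \<longlonglongrightarrow> c'" using Cauchy_convergent convergent_def by blast
  have tri: "norm (x - y + z) \<le> norm x + norm y + norm z" for x y z :: 'a
    using norm_triangle_ineq[of "x - y" z] norm_triangle_ineq4[of x y] by linarith
  have "(\<lambda>m. b' (v m) - c' *\<^sub>C v m) \<longlonglongrightarrow> 0"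
  proof (rule LIMSEQ_I)
    fix r :: real assume r: "0 < r"
    then have "\<forall>\<^sub>F k in sequentially. norm (b k - b') < r / 3" "\<forall>\<^sub>F k in sequentially. norm (c k - c') < r / 3"
      using tendstoD[OF b, of "r/3"] tendstoD[OF c', of "r/3"] by (auto simp: dist_norm)
    then have "\<forall>\<^sub>F k in sequentially. norm (b k - b') < r / 3 \<and> norm (c k - c') < r / 3"
      by (rule eventually_conj)
    then obtain k where k: "norm (b k - b') < r / 3" "norm (c k - c') < r / 3"
      by (auto simp: eventually_sequentially)
    obtain N where N: "\<And>m. m \<ge> N \<Longrightarrow> norm (b k (v m) - c k *\<^sub>C v m - 0) < r / 3"
      using LIMSEQ_D[OF c[of k, unfolded asym_eig_def], of "r / 3"] r by auto
    have "norm (b' (v m) - c' *\<^sub>C v m - 0) < r" if "m \<ge> N" for m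
    proof -
      have "b' (v m) - c' *\<^sub>C v m = (b k (v m) - c k *\<^sub>C v m) - (b k - b') (v m) + (c k - c') *\<^sub>C v m"
        using scaleC_add_left[of "c k - c'" c' "v m"] by (simp add: blinfun.diff_left)
      then have "norm (b' (v m) - c' *\<^sub>C v m)
          \<le> norm (b k (v m) - c k *\<^sub>C v m) + norm ((b k - b') (v m)) + norm ((c k - c') *\<^sub>C v m)"
        by (simp only: tri)
      also have "norm ((b k - b') (v m)) \<le> norm (b k - b')" using norm_blinfun[of "b k - b'" "v m"] by (simp add: unit)
      also have "norm ((c k - c') *\<^sub>C v m) = norm (c k - c')" by (simp add: norm_scaleC unit)
      finally show ?thesis using k N[OF that] by simp
    qed
    then show "\<exists>no. \<forall>m\<ge>no. norm (b' (v m) - c' *\<^sub>C v m - 0) < r" by blast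
  qed
  then show thesis using that c' by (simp add: asym_eig_def)
qed

text \<open>The operators having \<open>v\<close> as approximate eigenvectors, together with their
  adjoints for the conjugate eigenvalue, form a closed star algebra \<open>B\<close>. It contains
  the generated C*-algebra, on which the eigenvalue is a character. The condition on adjoints makes
  \<open>B\<close> stable under \<open>adj\<close>.\<close>

lemma asym_eig_character:
  fixes A :: "'n::finite \<Rightarrow> 'h::complex_hilbert op"
  assumes unit: "\<And>m. norm (v m) = 1" and A: "\<And>i. hermitian (A i)"
    and l: "\<And>i. asym_eig v (A i) (complex_of_real (l i))"
  shows "(\<lambda>i. complex_of_real (l i)) \<in> joint_spectrum A"
proof -
  define B where "B = {b :: 'h op. b \<in> cbounded_ops \<and> (\<exists>c. asym_eig v b c \<and> asym_eig v (adj b) (cnj c))}"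
  have "cstar_generated (range A) \<subseteq> B"
    unfolding cstar_generated_def
  proof (rule hull_minimal)
    show "range A \<subseteq> B"
    proof
      fix b assume "b \<in> range A"
      then obtain i where i: "b = A i" by blast
      show "b \<in> B" unfolding B_def
        using A[of i] l[of i] by (auto simp: i hermitian_def intro!: exI[of _ "complex_of_real (l i)"])
    qed
    have "star_subalgebra B"
      unfolding star_subalgebra_def
    proof (intro conjI ballI allI)
      show "B \<subseteq> cbounded_ops" by (auto simp: B_def)
      show "0 \<in> B" using asym_eig_zero by (auto simp: B_def intro!: exI[of _ 0])
      fix S assume S: "S \<in> B"
      then obtain c where c: "S \<in> cbounded_ops" "asym_eig v S c" "asym_eig v (adj S) (cnj c)" by (auto simp: B_def)
      show "adj S \<in> B" using c by (auto simp: B_def intro!: exI[of _ "cnj c"])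
      show "scaleC_op k S \<in> B" for k
        using c asym_eig_scaleC[OF c(2), of k] asym_eig_scaleC[OF c(3), of "cnj k"]
        by (auto simp: B_def intro!: exI[of _ "k * c"])
      fix T assume "T \<in> B"
      then obtain d where d: "T \<in> cbounded_ops" "asym_eig v T d" "asym_eig v (adj T) (cnj d)" by (auto simp: B_def)
      show "S + T \<in> B"
        using c d asym_eig_add[OF c(2) d(2)] asym_eig_add[OF c(3) d(3)]
        by (auto simp: B_def intro!: exI[of _ "c + d"])
      show "S o\<^sub>L T \<in> B"
        using c d asym_eig_compose[OF c(2) d(2)] asym_eig_compose[OF d(3) c(3)]
        by (auto simp: B_def mult.commute intro!: exI[of _ "c * d"])
    qed
    moreover have "id_blinfun \<in> B" using asym_eig_id by (auto simp: B_def intro!: exI[of _ 1])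
    moreover have "closed B"
    proof (unfold closed_sequential_limits, intro allI impI)
      fix b b' assume "(\<forall>n. b n \<in> B) \<and> b \<longlonglongrightarrow> b'"
      then have bB: "\<And>n. b n \<in> B" and lim: "b \<longlonglongrightarrow> b'" by auto
      have bcb: "b n \<in> cbounded_ops" for n using bB by (simp add: B_def)
      have b'cbounded: "b' \<in> cbounded_ops" by (rule sot_limit_cbounded[of b, OF bcb]) (intro tendsto_intros lim)
      have "\<forall>n. \<exists>c. asym_eig v (b n) c \<and> asym_eig v (adj (b n)) (cnj c)" using bB by (simp add: B_def)
      then obtain c where c: "\<And>n. asym_eig v (b n) (c n)" "\<And>n. asym_eig v (adj (b n)) (cnj (c n))" by metis
      have "(\<lambda>n. adj (b n)) \<longlonglongrightarrow> adj b'"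
      proof (rule LIM_zero_cancel[OF tendsto_norm_zero_cancel])
        have "norm (adj (b n) - adj b') = norm (b n - b')" for n
          using norm_adj[of "b n - b'"] bcb b'cbounded by simp
        then show "(\<lambda>n. norm (adj (b n) - adj b')) \<longlonglongrightarrow> 0"
          using tendsto_norm_zero[OF LIM_zero[OF lim]] by simp
      qed
      from asym_eig_closed[OF unit this c(2)]
      obtain d' where d': "(\<lambda>n. cnj (c n)) \<longlonglongrightarrow> d'" "asym_eig v (adj b') d'" by metis
      obtain c' where c': "c \<longlonglongrightarrow> c'" "asym_eig v b' c'" by (rule asym_eig_closed[OF unit lim c(1)])
      have "d' = cnj c'" using d'(1) tendsto_cnj[OF c'(1)] LIMSEQ_unique by blast
      then show "b' \<in> B" using b'cbounded c' d' by (auto simp: B_def)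
    qed
    ultimately show "star_subalgebra B \<and> id_blinfun \<in> B \<and> closed B" by blast
  qed
  then have sub: "b \<in> cbounded_ops \<and> (\<exists>c. asym_eig v b c)" if "b \<in> cstar_generated (range A)" for b
    using that by (auto simp: B_def)
  have mem: "x \<in> cstar_generated (range A) \<longleftrightarrow>
      (\<forall>t. star_subalgebra t \<and> id_blinfun \<in> t \<and> closed t \<and> range A \<subseteq> t \<longrightarrow> x \<in> t)" for x
    by (auto simp: cstar_generated_def hull_def)
  have star: "S + T \<in> t \<and> S o\<^sub>L T \<in> t \<and> scaleC_op c T \<in> t"
    if "star_subalgebra t" "S \<in> t" "T \<in> t" for S T :: "'h op" and t c
    using that by (simp add: star_subalgebra_def)
  have alg: "S + T \<in> cstar_generated (range A)" "S o\<^sub>L T \<in> cstar_generated (range A)"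
    "scaleC_op c T \<in> cstar_generated (range A)"
    if "S \<in> cstar_generated (range A)" "T \<in> cstar_generated (range A)" for S T c
    using that star unfolding mem by blast+
  have id_mem: "id_blinfun \<in> cstar_generated (range A)" and A_mem: "A i \<in> cstar_generated (range A)" for i
    unfolding mem by blast+
  define \<phi> where "\<phi> b = (SOME c. asym_eig v b c)" for b
  have \<phi>: "asym_eig v b (\<phi> b)" if "b \<in> cstar_generated (range A)" for b
    unfolding \<phi>_def using sub[OF that] by (metis someI)
  have \<phi>I: "\<phi> b = c" if "b \<in> cstar_generated (range A)" "asym_eig v b c" for b c
    using asym_eig_unique[OF unit \<phi>[OF that(1)] that(2)] .
  have "character_on (cstar_generated (range A)) \<phi>"
    unfolding character_on_def linear_functional_on_def
  proof (intro conjI ballI allI)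
    fix S T assume ST: "S \<in> cstar_generated (range A)" "T \<in> cstar_generated (range A)"
    show "\<phi> (S + T) = \<phi> S + \<phi> T"
      by (rule \<phi>I[OF alg(1)[OF ST] asym_eig_add[OF \<phi>[OF ST(1)] \<phi>[OF ST(2)]]])
    have "S \<in> cbounded_ops" using sub[OF ST(1)] by blast
    then show "\<phi> (S o\<^sub>L T) = \<phi> S * \<phi> T"
      by (rule \<phi>I[OF alg(2)[OF ST] asym_eig_compose[OF \<phi>[OF ST(1)] \<phi>[OF ST(2)]]])
  next
    fix c T assume T: "T \<in> cstar_generated (range A)"
    show "\<phi> (scaleC_op c T) = c * \<phi> T"
      by (rule \<phi>I[OF alg(3)[OF T T] asym_eig_scaleC[OF \<phi>[OF T]]])
  next
    have "\<phi> id_blinfun = 1" by (rule \<phi>I[OF id_mem asym_eig_id])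
    then show "\<exists>T\<in>cstar_generated (range A). \<phi> T \<noteq> 0" using id_mem by (metis zero_neq_one)
  qed
  moreover have "(\<lambda>i. complex_of_real (l i)) = (\<lambda>i. \<phi> (A i))"
    by (rule ext) (rule \<phi>I[OF A_mem l, symmetric])
  ultimately show ?thesis unfolding joint_spectrum_def by blast
qed

lemma commute_foldr:
  fixes g :: "'b \<Rightarrow> 'a::real_normed_vector \<Rightarrow>\<^sub>L 'a"
  assumes "\<And>x. C o\<^sub>L g x = g x o\<^sub>L C"
  shows "C o\<^sub>L foldr (\<lambda>x T. g x o\<^sub>L T) xs id_blinfun = foldr (\<lambda>x T. g x o\<^sub>L T) xs id_blinfun o\<^sub>L C"
  by (induction xs) (auto intro: commute_compose assms)

text \<open>Any decreasing sequence of nonzero cells yields a character, so \<open>f = \<Prod>\<^sub>l \<Sum>\<^sub>i (A\<^sub>i - l\<^sub>i)\<^sup>2\<close>, with \<open>l\<close> ranging over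
  the joint spectrum, vanishes; hence the joint eigenprojections sum to \<open>1\<close>.\<close>

lemma (in vna) finite_joint_spectrum_decomposition:
  fixes A :: "'n::finite \<Rightarrow> 'h op"
  assumes AM: "\<And>i. A i \<in> M" and AH: "\<And>i. hermitian (A i)"
    and comm: "\<And>i j. A i o\<^sub>L A j = A j o\<^sub>L A i" and fin: "finite (joint_spectrum A)"
  obtains \<Lambda> :: "('n \<Rightarrow> real) set" and P where "partition_of_unity \<Lambda> P"
    "\<And>l. l \<in> \<Lambda> \<Longrightarrow> P l \<in> M" "\<And>l. l \<in> \<Lambda> \<Longrightarrow> P l \<noteq> 0" "\<And>l i. l \<in> \<Lambda> \<Longrightarrow> A i o\<^sub>L P l = l i *\<^sub>R P l"
proof -
  obtain e where e: "commuting_projections e" "\<And>n. e n \<in> M"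
    "\<And>C n. C \<in> cbounded_ops \<Longrightarrow> (\<And>i. C o\<^sub>L A i = A i o\<^sub>L C) \<Longrightarrow> C o\<^sub>L e n = e n o\<^sub>L C"
    "\<And>d. 0 < d \<Longrightarrow> \<exists>m. \<forall>bs. m \<le> length bs \<longrightarrow>
        (\<exists>\<mu>. \<forall>i. norm ((A i - \<mu> i *\<^sub>R id_blinfun) o\<^sub>L cell e bs) \<le> d)"
    by (rule spectral_sequence[of A, OF AM AH comm], rule that) blast+
  interpret commuting_projections e by (rule e(1))
  define \<Lambda> :: "('n \<Rightarrow> real) set" where "\<Lambda> = {l. (\<lambda>i. complex_of_real (l i)) \<in> joint_spectrum A}"
  have fin\<Lambda>: "finite \<Lambda>"
  proof -
    have "inj (\<lambda>l :: 'n \<Rightarrow> real. \<lambda>i. complex_of_real (l i))" by (auto simp: inj_def fun_eq_iff)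
    from finite_vimageI[OF fin this] show ?thesis by (simp add: \<Lambda>_def vimage_def)
  qed
  define dA where "dA l i = A i - l i *\<^sub>R id_blinfun" for l :: "'n \<Rightarrow> real" and i
  have dAM: "dA l i \<in> M" and dAH: "hermitian (dA l i)" for l i using AM AH by (auto simp: dA_def)
  define g where "g l = (\<Sum>i\<in>UNIV. dA l i o\<^sub>L dA l i)" for l
  have gM: "g l \<in> M" for l unfolding g_def using dAM by (intro sum_mem) auto
  have gH: "hermitian (g l)" for l
    unfolding g_def using dAH by (intro hermitian_sum hermitian_compose_commute) auto
  have g_inner: "inner (g l v) v = (\<Sum>i\<in>UNIV. (norm (dA l i v))\<^sup>2)" for l v
    by (simp add: g_def blinfun.sum_left inner_sum_left hermitian_inner[OF dAH] power2_norm_eq_inner)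
  have comm_dA: "C o\<^sub>L dA l i = dA l i o\<^sub>L C" if "\<And>i. C o\<^sub>L A i = A i o\<^sub>L C" for C l i
    unfolding dA_def by (intro commute_diff commute_scaleR commute_id that)
  have comm_g: "C o\<^sub>L g l = g l o\<^sub>L C" if "\<And>i. C o\<^sub>L A i = A i o\<^sub>L C" for C l
    unfolding g_def sum_compose_left sum_compose_right
    using comm_dA[OF that] by (intro sum.cong refl commute_compose) auto
  obtain xs where xs: "set xs = \<Lambda>" "distinct xs" using finite_distinct_list[OF fin\<Lambda>] by blast
  \<comment> \<open>The product runs over a list so that one factor at a time can be peeled off, in
    \<open>eig_F\<close> for eigenvalues and in \<open>Q_kernel\<close> for kernels.\<close>
  define F where "F ys = foldr (\<lambda>x T. g x o\<^sub>L T) ys id_blinfun" for ys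
  have comm_F: "C o\<^sub>L F ys = F ys o\<^sub>L C" if "\<And>i. C o\<^sub>L A i = A i o\<^sub>L C" for C ys
    unfolding F_def by (rule commute_foldr) (rule comm_g[OF that])
  have gA: "g l o\<^sub>L A i = A i o\<^sub>L g l" for l i using comm_g[of "A i" l] comm by simp
  have FM: "F ys \<in> M" for ys unfolding F_def by (induction ys) (auto simp: gM)
  have FH: "hermitian (F ys)" for ys
  proof (induction ys)
    case (Cons y ys)
    have "g y o\<^sub>L F ys = F ys o\<^sub>L g y" by (rule comm_F) (rule gA)
    then have "hermitian (g y o\<^sub>L F ys)" using gH Cons by (intro hermitian_compose_commute)
    then show ?case by (simp add: F_def)
  qed (simp add: F_def)
  have F0: "F xs = 0"
  proof (rule ccontr)
    assume "F xs \<noteq> 0"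
    define w where "w = F xs o\<^sub>L F xs"
    have w_inner: "inner (w v) v = (norm (F xs v))\<^sup>2" for v
      by (simp add: w_def hermitian_inner[OF FH] power2_norm_eq_inner)
    have wM: "w \<in> M" using FM by (simp add: w_def)
    have wpos: "positive_op w"
      using FH w_inner by (auto simp: positive_op_iff w_def intro!: hermitian_compose_commute)
    have "w \<noteq> 0"
    proof
      assume "w = 0"
      then have "F xs v = 0" for v using w_inner[of v] by simp
      then have "F xs = 0" by (intro blinfun_eqI) simp
      then show False using \<open>F xs \<noteq> 0\<close> by simp
    qed
    from positive_op_dominates_projection[OF wM wpos this]
    obtain q t where q: "q \<in> M" "projection q" "q \<noteq> 0" "0 < t"
      "\<And>v. t * (norm (q v))\<^sup>2 \<le> inner (w v) v"
      "\<And>C. C \<in> cbounded_ops \<Longrightarrow> C o\<^sub>L w = w o\<^sub>L C \<Longrightarrow> C o\<^sub>L q = q o\<^sub>L C" by metis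
    have cA: "cell e bs o\<^sub>L A i = A i o\<^sub>L cell e bs" for bs i
    proof (rule commute_cell[symmetric])
      show "A i o\<^sub>L e n = e n o\<^sub>L A i" for n by (rule e(3)) (use AM comm in auto)
    qed
    have cq: "cell e bs o\<^sub>L q = q o\<^sub>L cell e bs" for bs
    proof (rule q(6))
      show "cell e bs \<in> cbounded_ops" using cell_proj by (rule projectionD)
      show "cell e bs o\<^sub>L w = w o\<^sub>L cell e bs"
        unfolding w_def using comm_F[OF cA] by (intro commute_compose)
    qed
    \<comment> \<open>On the range of \<open>q\<close> the operator \<open>F xs\<close> is bounded
      below. A vector with nonzero component in a cell has one in some child, and the cells commute
      with \<open>q\<close>, so the normalised components of \<open>x\<close> along a suitable
      branch stay in the range of \<open>q\<close>.\<close>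
    obtain u where "q u \<noteq> 0" using q(3) by (metis blinfun_eqI blinfun.zero_left)
    then obtain x where x: "x \<noteq> 0" "q x = x" using projectionD(5)[OF q(2)] by metis
    have "\<exists>bs. \<forall>m. (cell e (bs m) x \<noteq> 0 \<and> length (bs m) = m) \<and> (\<exists>b. bs (Suc m) = b # bs m)"
    proof (rule dependent_nat_choice)
      show "\<exists>bs. cell e bs x \<noteq> 0 \<and> length bs = 0" using x by auto
      fix bs m assume bs: "cell e bs x \<noteq> 0 \<and> length bs = m"
      then have "cell e (True # bs) x + cell e (False # bs) x \<noteq> 0"
        by (metis cell_split blinfun.add_left)
      then have "\<exists>b. cell e (b # bs) x \<noteq> 0" by (metis add.right_neutral)
      then obtain b where "cell e (b # bs) x \<noteq> 0" by blast
      then show "\<exists>cs. (cell e cs x \<noteq> 0 \<and> length cs = Suc m) \<and> (\<exists>b. cs = b # bs)"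
        using bs by (intro exI[of _ "b # bs"]) simp
    qed
    then obtain bs where bs: "\<And>m. cell e (bs m) x \<noteq> 0" "\<And>m. length (bs m) = m" "\<And>m. \<exists>b. bs (Suc m) = b # bs m"
      by metis
    define v where "v m = (1 / norm (cell e (bs m) x)) *\<^sub>R cell e (bs m) x" for m
    have unit: "norm (v m) = 1" for m using bs(1) by (simp add: v_def)
    have cv: "cell e (bs m) (v m) = v m" for m
      by (simp add: v_def blinfun.scaleR_right projectionD(5)[OF cell_proj])
    have qv: "q (v m) = v m" for m
      using commute_apply[OF cq, of "bs m" x] x by (simp add: v_def blinfun.scaleR_right)
    have "cell e (bs (k + d)) y = y \<longrightarrow> cell e (bs k) y = y" for k d y
    proof (induction d)
      case (Suc d)
      obtain b where b: "bs (Suc (k + d)) = b # bs (k + d)" using bs(3) by blast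
      have "cell e (bs (k + d)) y = y" if "cell e (bs (Suc (k + d))) y = y"
        using cell_fixed_Cons(2)[of b "bs (k + d)" y] that unfolding b by simp
      then show ?case using Suc by simp
    qed simp
    then have nest: "cell e (bs k) (v m) = v m" if "k \<le> m" for k m
      using cv[of m] that by (metis le_add_diff_inverse)
    have close: "\<exists>k \<mu>. \<forall>m\<ge>k. \<forall>i. norm (A i (v m) - \<mu> i *\<^sub>R v m) \<le> d" if "0 < d" for d
    proof -
      obtain k where k: "\<And>cs. k \<le> length cs \<Longrightarrow>
          (\<exists>\<mu>. \<forall>i. norm ((A i - \<mu> i *\<^sub>R id_blinfun) o\<^sub>L cell e cs) \<le> d)" using e(4)[OF \<open>0 < d\<close>] by blast
      obtain \<mu> where \<mu>: "\<And>i. norm ((A i - \<mu> i *\<^sub>R id_blinfun) o\<^sub>L cell e (bs k)) \<le> d"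
        using k[of "bs k"] bs(2) by auto
      have "norm (A i (v m) - \<mu> i *\<^sub>R v m) \<le> d" if "k \<le> m" for m i
      proof -
        have "A i (v m) - \<mu> i *\<^sub>R v m = ((A i - \<mu> i *\<^sub>R id_blinfun) o\<^sub>L cell e (bs k)) (v m)"
          by (simp add: nest[OF that] blinfun.bilinear_simps)
        then show ?thesis
          using norm_blinfun[of "(A i - \<mu> i *\<^sub>R id_blinfun) o\<^sub>L cell e (bs k)" "v m"] \<mu>[of i]
          by (simp add: unit)
      qed
      then show ?thesis by blast
    qed
    define a where "a i m = inner (A i (v m)) (v m)" for i m
    have a_close: "\<bar>a i m - \<mu>\<bar> \<le> norm (A i (v m) - \<mu> *\<^sub>R v m)" for i m \<mu>
    proof -
      have "a i m - \<mu> = inner (A i (v m) - \<mu> *\<^sub>R v m) (v m)"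
        using unit[of m] by (simp add: a_def inner_diff_left flip: power2_norm_eq_inner)
      then show ?thesis using Cauchy_Schwarz_ineq2[of "A i (v m) - \<mu> *\<^sub>R v m" "v m"] by (simp add: unit)
    qed
    have "Cauchy (a i)" for i
    proof (rule CauchyI)
      fix r :: real assume "0 < r"
      then obtain k \<mu> where k: "\<And>m i. m \<ge> k \<Longrightarrow> norm (A i (v m) - \<mu> i *\<^sub>R v m) \<le> r / 3"
        using close[of "r / 3"] by auto
      have "norm (a i m - a i n) < r" if "m \<ge> k" "n \<ge> k" for m n
        using k[OF that(1), of i] k[OF that(2), of i] a_close[of i m "\<mu> i"] a_close[of i n "\<mu> i"] \<open>0 < r\<close>
        by (simp add: abs_if split: if_splits)
      then show "\<exists>M. \<forall>m\<ge>M. \<forall>n\<ge>M. norm (a i m - a i n) < r" by blast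
    qed
    then have "\<forall>i. \<exists>l. a i \<longlonglongrightarrow> l" using Cauchy_convergent convergent_def by blast
    then obtain l where l: "\<And>i. a i \<longlonglongrightarrow> l i" by metis
    have eig: "asym_eig v (A i) (complex_of_real (l i))" for i
      unfolding asym_eig_def scaleC_of_real
    proof (rule LIMSEQ_I)
      fix r :: real assume r: "0 < r"
      then obtain k \<mu> where k: "\<And>m i. m \<ge> k \<Longrightarrow> norm (A i (v m) - \<mu> i *\<^sub>R v m) \<le> r / 3"
        using close[of "r / 3"] by auto
      have "\<bar>l i - \<mu> i\<bar> \<le> r / 3"
      proof (rule LIMSEQ_le_const2)
        show "(\<lambda>m. \<bar>a i m - \<mu> i\<bar>) \<longlonglongrightarrow> \<bar>l i - \<mu> i\<bar>" by (intro tendsto_intros l)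
        show "\<exists>N. \<forall>n\<ge>N. \<bar>a i n - \<mu> i\<bar> \<le> r / 3" using k a_close order_trans by blast
      qed
      then have \<mu>l: "norm ((\<mu> i - l i) *\<^sub>R v m) \<le> r / 3" for m by (simp add: unit abs_minus_commute)
      have "norm (A i (v m) - l i *\<^sub>R v m - 0) < r" if "m \<ge> k" for m
      proof -
        have "A i (v m) - l i *\<^sub>R v m = (A i (v m) - \<mu> i *\<^sub>R v m) + (\<mu> i - l i) *\<^sub>R v m"
          by (simp add: algebra_simps)
        then have "norm (A i (v m) - l i *\<^sub>R v m) \<le> norm (A i (v m) - \<mu> i *\<^sub>R v m) + norm ((\<mu> i - l i) *\<^sub>R v m)"
          by (metis norm_triangle_ineq)
        then show ?thesis using k[OF that, of i] \<mu>l[of m] r by simp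
      qed
      then show "\<exists>no. \<forall>m\<ge>no. norm (A i (v m) - l i *\<^sub>R v m - 0) < r" by blast
    qed
    have "l \<in> \<Lambda>" unfolding \<Lambda>_def using asym_eig_character[OF unit AH eig] by simp
    have eig_dA: "asym_eig v (dA l' i) (complex_of_real (l i - l' i))" for l' i
      using asym_eig_diff[OF eig[of i] asym_eig_scaleC[OF asym_eig_id, of v "complex_of_real (l' i)"]]
      by (simp add: dA_def scaleR_eq_scaleC_op)
    have eig_g: "\<exists>c. asym_eig v (g l') c \<and> (l' = l \<longrightarrow> c = 0)" for l'
    proof -
      have "asym_eig v (\<Sum>i\<in>I. dA l' i o\<^sub>L dA l' i) (\<Sum>i\<in>I. complex_of_real (l i - l' i) * complex_of_real (l i - l' i))"
        for I :: "'n set"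
        using dAH eig_dA
        by (induction I rule: infinite_finite_induct)
          (auto simp del: of_real_diff intro!: asym_eig_zero asym_eig_add asym_eig_compose)
      then show ?thesis unfolding g_def by (intro exI conjI) auto
    qed
    have eig_F: "\<exists>c. asym_eig v (F ys) c \<and> (l \<in> set ys \<longrightarrow> c = 0)" for ys
    proof (induction ys)
      case Nil
      then show ?case using asym_eig_id by (auto simp: F_def)
    next
      case (Cons y ys)
      obtain c where c: "asym_eig v (F ys) c" "l \<in> set ys \<longrightarrow> c = 0" using Cons by blast
      obtain d where d: "asym_eig v (g y) d" "y = l \<longrightarrow> d = 0" using eig_g by blast
      have "asym_eig v (g y o\<^sub>L F ys) (d * c)" using asym_eig_compose[OF d(1) c(1)] gM by simp
      then show ?case using c(2) d(2) by (intro exI[of _ "d * c"]) (auto simp: F_def)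
    qed
    \<comment> \<open>The limit tuple \<open>l\<close> lies in the joint spectrum, so
      \<open>g l\<close> occurs among the factors and contributes the eigenvalue 0; this contradicts
      the lower bound \<open>t_le\<close>.\<close>
    then have "asym_eig v (F xs) 0" using \<open>l \<in> \<Lambda>\<close> xs by metis
    then have "(\<lambda>m. F xs (v m)) \<longlonglongrightarrow> 0"
      by (simp add: asym_eig_def)
    then have lim: "(\<lambda>m. (norm (F xs (v m)))\<^sup>2) \<longlonglongrightarrow> (norm (0::'h))\<^sup>2" by (intro tendsto_intros)
    have t_le: "t \<le> (norm (F xs (v m)))\<^sup>2" for m
      using q(5)[of "v m"] by (simp add: w_inner qv unit)
    have "t \<le> (norm (0::'h))\<^sup>2" by (rule LIMSEQ_le_const[OF lim]) (use t_le in blast)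
    then show False using q(4) by simp
  qed
  have "\<exists>P. projection P \<and> (\<forall>v. P v = v \<longleftrightarrow> g l v = 0) \<and>
      (\<forall>C. C \<in> cbounded_ops \<longrightarrow> C o\<^sub>L g l = g l o\<^sub>L C \<longrightarrow> adj C o\<^sub>L g l = g l o\<^sub>L adj C \<longrightarrow> C o\<^sub>L P = P o\<^sub>L C)" for l
    using kernel_projection[of "g l"] gM by (metis cbounded)
  then obtain P where P: "\<And>l. projection (P l)" "\<And>l v. P l v = v \<longleftrightarrow> g l v = 0"
    "\<And>l C. C \<in> cbounded_ops \<Longrightarrow> C o\<^sub>L g l = g l o\<^sub>L C \<Longrightarrow> adj C o\<^sub>L g l = g l o\<^sub>L adj C \<Longrightarrow> C o\<^sub>L P l = P l o\<^sub>L C"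
    by metis
  have Pg: "C o\<^sub>L P l = P l o\<^sub>L C" if "C \<in> cbounded_ops" "C o\<^sub>L g l = g l o\<^sub>L C" for C l
    by (rule P(3)[OF that hermitian_commute_adj[OF gH that]])
  have Pcb: "P l \<in> cbounded_ops" for l using P(1) by (rule projectionD)
  have PM: "P l \<in> M" for l by (rule mem_if_commutes[OF Pcb gM Pg])
  have PA: "P l o\<^sub>L A i = A i o\<^sub>L P l" for l i
    by (rule Pg[symmetric]) (use AM gA in auto)
  have PP: "P l o\<^sub>L P l' = P l' o\<^sub>L P l" for l l'
    by (rule Pg[OF Pcb]) (rule comm_g, rule PA)
  have Peig: "A i v = l i *\<^sub>R v" if "P l v = v" for l i v
  proof -
    have "inner (g l v) v = 0" using P(2) that by simp
    then have "norm (dA l i v) = 0" unfolding g_inner by (subst (asm) sum_nonneg_eq_0_iff) auto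
    then show ?thesis by (simp add: dA_def blinfun.bilinear_simps)
  qed
  have orth: "P l o\<^sub>L P l' = 0" if ne: "l \<noteq> l'" for l l'
  proof (rule blinfun_eqI)
    fix v
    let ?u = "P l (P l' v)"
    have pp: "P l (P l x) = P l x" for l x using P(1) by (rule projectionD)
    have 1: "P l ?u = ?u" by (rule pp)
    have 2: "P l' ?u = ?u" using commute_apply[OF PP, of l' l] pp by simp
    obtain i where i: "l i \<noteq> l' i" using ne by (auto simp: fun_eq_iff)
    have "l i *\<^sub>R ?u = l' i *\<^sub>R ?u" using Peig[OF 1, of i] Peig[OF 2, of i] by metis
    then have "(l i - l' i) *\<^sub>R ?u = 0" by (simp add: scaleR_diff_left)
    then show "(P l o\<^sub>L P l') v = blinfun_apply 0 v" using i by simp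
  qed
  \<comment> \<open>If \<open>F (y # ys) v = 0\<close>, then \<open>F ys v\<close> lies in the range
    of \<open>P y\<close>, which commutes with \<open>F ys\<close>; so \<open>v - P y v\<close> is
    in the kernel of \<open>F ys\<close>. Peeling off all factors exhausts the space by
    eigenprojections.\<close>
  define Q where "Q ys = id_blinfun - sum P (set ys)" for ys
  have Q_kernel: "F ys v = 0 \<longrightarrow> Q ys v = 0" if "distinct ys" for ys v
    using that
  proof (induction ys arbitrary: v)
    case (Cons y ys)
    show ?case
    proof
      assume "F (y # ys) v = 0"
      then have "g y (F ys v) = 0" by (simp add: F_def)
      then have Pf: "P y (F ys v) = F ys v" by (simp add: P(2))
      have "P y (F ys v) = F ys (P y v)" by (rule commute_apply[OF comm_F[OF PA]])
      then have "F ys (v - P y v) = 0" using Pf by (simp add: blinfun.diff_right)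
      then have "Q ys (v - P y v) = 0" using Cons by simp
      moreover have "P l (P y v) = 0" if "l \<in> set ys" for l
        using orth[of l y] that Cons.prems by (metis blinfun_apply_blinfun_compose blinfun.zero_left distinct.simps(2))
      then have "(\<Sum>l\<in>set ys. P l (P y v)) = 0" by simp
      ultimately show "Q (y # ys) v = 0"
        using Cons.prems by (simp add: Q_def blinfun.bilinear_simps sum_subtractf algebra_simps)
    qed
  qed (simp add: F_def Q_def)
  have "Q xs = 0" by (rule blinfun_eqI) (use Q_kernel[OF xs(2)] F0 in simp)
  then have sumP: "sum P \<Lambda> = id_blinfun" by (simp add: Q_def xs)
  \<comment> \<open>Zero eigenprojections are dropped because the traces of the remaining ones
    become denominators.\<close>
  have sumP': "sum P {l \<in> \<Lambda>. P l \<noteq> 0} = id_blinfun"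
    unfolding sumP[symmetric] by (rule sum.mono_neutral_left) (use fin\<Lambda> in auto)
  show thesis
  proof (rule that[of "{l \<in> \<Lambda>. P l \<noteq> 0}" P])
    show "partition_of_unity {l \<in> \<Lambda>. P l \<noteq> 0} P"
      using fin\<Lambda> P(1) orth sumP' by (simp add: partition_of_unity_def)
    show "A i o\<^sub>L P l = l i *\<^sub>R P l" for l i
      using Peig[of l] P(1)[of l] by (intro blinfun_eqI) (simp add: blinfun.scaleR_left projectionD(5))
  qed (use PM in auto)
qed

subsection \<open>Splitting projections along a tree\<close>

text \<open>Orthogonality is automatic: the squared norms of all components of a vector add up to
  its own, and for a vector in the range of \<open>P j\<close> the component under
  \<open>P j\<close> already takes all of it.\<close>

lemma partition_of_unityI:
  assumes "finite J" "\<And>j. j \<in> J \<Longrightarrow> projection (P j)" "sum P J = id_blinfun"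
  shows "partition_of_unity J P"
  unfolding partition_of_unity_def
proof (intro conjI ballI impI assms)
  fix i j assume ij: "i \<in> J" "j \<in> J" "i \<noteq> j"
  show "P i o\<^sub>L P j = 0"
  proof (rule blinfun_eqI)
    fix v
    let ?u = "P j v"
    have "inner ?u ?u = inner (sum P J ?u) ?u" using assms(3) by simp
    also have "\<dots> = (\<Sum>k\<in>J. (norm (P k ?u))\<^sup>2)"
      using assms(2) by (simp add: blinfun.sum_left inner_sum_left inner_projection)
    also have "\<dots> \<ge> (\<Sum>k\<in>{i, j}. (norm (P k ?u))\<^sup>2)"
      using assms(1) ij by (intro sum_mono2) auto
    finally have "(norm (P i ?u))\<^sup>2 + (norm (P j ?u))\<^sup>2 \<le> (norm ?u)\<^sup>2"
      using ij by (simp add: power2_norm_eq_inner)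
    then have "(norm (P i ?u))\<^sup>2 \<le> 0" using assms(2)[OF ij(2)] by (simp add: projectionD(5))
    then show "(P i o\<^sub>L P j) v = blinfun_apply 0 v" by simp
  qed
qed

lemma projection_sum:
  assumes "finite I" "\<And>i. i \<in> I \<Longrightarrow> projection (P i)" "\<And>i j. i \<in> I \<Longrightarrow> j \<in> I \<Longrightarrow> i \<noteq> j \<Longrightarrow> P i o\<^sub>L P j = 0"
  shows "projection (sum P I)"
proof -
  have "P i o\<^sub>L sum P I = P i" if "i \<in> I" for i
  proof -
    have "P i o\<^sub>L sum P I = (\<Sum>j\<in>I. if j = i then P i else 0)"
      unfolding sum_compose_right using assms that by (intro sum.cong) (auto simp: projectionD(2))
    then show ?thesis using assms(1) that by simp
  qed
  then have "sum P I o\<^sub>L sum P I = sum P I" by (simp add: sum_compose_left)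
  then show ?thesis using assms(2) projectionD(1) by (auto simp: projection_def intro!: hermitian_sum)
qed

lemma projection_diff:
  assumes "projection p" "projection q" "p o\<^sub>L q = q"
  shows "projection (p - q)"
proof -
  have "adj q o\<^sub>L adj p = adj q"
    using arg_cong[OF assms(3), of adj]
    unfolding adj_compose[OF projectionD(3)[OF assms(1)] projectionD(3)[OF assms(2)]] .
  then have qp: "q o\<^sub>L p = q" using assms(1,2) by (simp add: projectionD(4))
  have "p (q v) = q v" "q (p v) = q v" for v
    using arg_cong[OF assms(3), of "\<lambda>T. T v"] arg_cong[OF qp, of "\<lambda>T. T v"] by auto
  then show ?thesis
    using assms(1,2) by (auto simp: projection_def blinfun.bilinear_simps projectionD(5)[OF assms(1)]
      projectionD(5)[OF assms(2)] intro!: blinfun_eqI)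
qed

text \<open>Mirrors the encoding of \<open>cell\<close>; the second argument of \<open>pick\<close>
  is the proportion of the parent to be selected.\<close>

primrec split_tree :: "('a::minus \<Rightarrow> real \<Rightarrow> 'a) \<Rightarrow> (bool list \<Rightarrow> real) \<Rightarrow> 'a \<Rightarrow> bool list \<Rightarrow> 'a" where
  "split_tree pick r p [] = p"
| "split_tree pick r p (b # bs) =
    (if b then pick (split_tree pick r p bs) (r bs)
     else split_tree pick r p bs - pick (split_tree pick r p bs) (r bs))"

text \<open>The carpenter lemma holds for arbitrary projections of \<open>M\<close> and so applies
  again to the pieces it produces. The proportion to split off at a node is the ratio of child
  weight to parent weight.\<close>

lemma (in masa_expectation) carpenter_tree:
  assumes ker: "\<And>P. P \<in> M \<Longrightarrow> projection P \<Longrightarrow> P \<noteq> 0 \<Longrightarrow> {X \<in> corner M P. E X = 0} \<noteq> {0}"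
    and p: "p \<in> M" "projection p"
    and w: "\<And>bs. 0 \<le> w bs" "\<And>bs. w bs = w (True # bs) + w (False # bs)" "w [] = 1"
  obtains F where "F [] = p" "\<And>bs. F bs \<in> M" "\<And>bs. projection (F bs)"
    "\<And>bs. F (True # bs) + F (False # bs) = F bs" "\<And>bs. E (F bs) = w bs *\<^sub>R E p"
proof -
  define good where "good p t q \<longleftrightarrow> q \<in> M \<and> projection q \<and> p o\<^sub>L q = q \<and> E q = t *\<^sub>R E p" for p t q
  define pick where "pick p t = (SOME q. good p t q)" for p t
  have pick: "good p t (pick p t)" if pt: "p \<in> M" "projection p" "0 \<le> t" "t \<le> 1" for p t
  proof -
    have "\<exists>q. good p t q"
      by (rule carpenter[of p t], erule (2) ker, (rule pt)+, auto simp: good_def)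
    then show ?thesis unfolding pick_def by (rule someI_ex)
  qed
  \<comment> \<open>If \<open>w bs = 0\<close>, the quotient is 0 and \<open>w (True # bs)\<close>
    vanishes too, so \<open>rw\<close> holds in every case.\<close>
  define r where "r bs = w (True # bs) / w bs" for bs
  have wT: "w (True # bs) \<le> w bs" for bs using w(1)[of "False # bs"] w(2)[of bs] by simp
  have r: "0 \<le> r bs" "r bs \<le> 1" for bs
    using wT[of bs] w(1)[of bs] w(1)[of "True # bs"] by (auto simp: r_def divide_le_eq_1)
  have rw: "r bs * w bs = w (True # bs)" for bs
    using w(1)[of "True # bs"] wT[of bs] by (cases "w bs = 0") (auto simp: r_def)
  define F where "F = split_tree pick r p"
  have F: "F bs \<in> M \<and> projection (F bs) \<and> E (F bs) = w bs *\<^sub>R E p" for bs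
  proof (induction bs)
    case Nil
    then show ?case using p w(3) by (simp add: F_def)
  next
    case (Cons b bs)
    let ?q = "pick (F bs) (r bs)"
    have q: "?q \<in> M" "projection ?q" "F bs o\<^sub>L ?q = ?q" "E ?q = r bs *\<^sub>R E (F bs)"
      using pick[of "F bs" "r bs"] Cons r by (auto simp: good_def)
    then have Eq: "E ?q = w (True # bs) *\<^sub>R E p" using Cons rw by simp
    show ?case
    proof (cases b)
      case True
      then show ?thesis using q Eq by (simp add: F_def)
    next
      case False
      have "E (F bs - ?q) = w (False # bs) *\<^sub>R E p"
        using Cons q(1) Eq w(2)[of bs] by (simp add: E_diff scaleR_add_left)
      moreover have "projection (F bs - ?q)" using Cons q by (intro projection_diff) auto
      ultimately show ?thesis using False Cons q(1) by (simp add: F_def)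
    qed
  qed
  show thesis by (rule that[of F]) (use F in \<open>auto simp: F_def\<close>)
qed

section \<open>A tuple in the closed unitary orbit with prescribed expectation\<close>

lemma norm_conjugate_le:
  assumes "unitary U"
  shows "norm (U o\<^sub>L X o\<^sub>L adj U) \<le> norm X"
proof -
  have U: "U \<in> cbounded_ops" "adj U o\<^sub>L U = id_blinfun" "U o\<^sub>L adj U = id_blinfun"
    using assms by (auto simp: unitary_def)
  have iso: "norm (V v) \<le> norm v" if "V \<in> cbounded_ops" "adj V o\<^sub>L V = id_blinfun" for V :: "'a op" and v
  proof -
    have "adj V (V v) = v" by (metis blinfun_apply_blinfun_compose blinfun_apply_id_blinfun that(2))
    then have "(norm (V v))\<^sup>2 = (norm v)\<^sup>2"
      using inner_adj_right[OF that(1), of v "V v"] by (simp add: power2_norm_eq_inner)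
    then show ?thesis by simp
  qed
  have 1: "norm U \<le> 1" using iso[OF U(1,2)] by (simp add: norm_le_one_apply)
  then have "norm (adj U) \<le> 1" using U(1) by simp
  then have "norm (U o\<^sub>L X o\<^sub>L adj U) \<le> (1 * norm X) * 1"
    by (intro norm_compose_le 1) simp_all
  then show ?thesis by simp
qed

lemma (in masa_expectation) schur_horn:
  fixes A S :: "'n::finite \<Rightarrow> 'h op"
  assumes fac: "factor M"
    and ker: "\<And>P. P \<in> M \<Longrightarrow> projection P \<Longrightarrow> P \<noteq> 0 \<Longrightarrow> {X \<in> corner M P. E X = 0} \<noteq> {0}"
    and A: "\<And>i. A i \<in> \<A>" "\<And>i. hermitian (A i)" "finite (joint_spectrum A)"
    and S: "\<And>i. S i \<in> M" "\<And>i. hermitian (S i)" "\<And>i j. S i o\<^sub>L S j = S j o\<^sub>L S i"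
    and maj: "majorized_by M \<tau> A S"
  shows "\<exists>T \<in> unitary_orbit_closure M S. \<forall>i. E (T i) = A i"
proof -
  obtain D where D: "doubly_stochastic M \<tau> D" and DS: "\<And>i. D (S i) = A i"
    using maj by (auto simp: majorized_by_def)
  have DM: "D X \<in> M" if "X \<in> M" for X using D that by (auto simp: doubly_stochastic_def)
  have D_lin: "linear_map_on M D" and D_posm: "positive_map_on M D" and D1: "D id_blinfun = id_blinfun"
    using D by (auto simp: doubly_stochastic_def)
  have D_add: "D (X + Y) = D X + D Y" if "X \<in> M" "Y \<in> M" for X Y
    using D_lin that by (simp add: linear_map_on_def)
  have D_scale: "D (c *\<^sub>R X) = c *\<^sub>R D X" if "X \<in> M" for X c
    using D_lin that by (simp add: linear_map_on_def scaleR_eq_scaleC_op)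
  have D_tr: "tr (D X) = tr X" if "X \<in> M" for X
    using D that by (simp add: doubly_stochastic_def trace_preserving_def tr_def)
  have D_herm: "hermitian (D X)" "norm (D X) \<le> norm X" if "X \<in> M" "hermitian X" for X
    using positive_map_hermitian[OF that vna D_lin D_posm D1] by auto
  have A_comm: "A i o\<^sub>L A j = A j o\<^sub>L A i" for i j using A(1) masa_commute by blast
  \<comment> \<open>The decomposition is taken in the von Neumann algebra \<open>\<A>\<close>, so
    that the eigenprojections are fixed by \<open>E\<close>.\<close>
  obtain \<Lambda> :: "('n \<Rightarrow> real) set" and P where P: "partition_of_unity \<Lambda> P" "\<And>l. l \<in> \<Lambda> \<Longrightarrow> P l \<in> \<A>"
    "\<And>l. l \<in> \<Lambda> \<Longrightarrow> P l \<noteq> 0" "\<And>l i. l \<in> \<Lambda> \<Longrightarrow> A i o\<^sub>L P l = l i *\<^sub>R P l"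
    by (rule A.finite_joint_spectrum_decomposition[of A, OF A(1,2) A_comm A(3)], rule that)
  have fin: "finite \<Lambda>" and Pp: "\<And>l. l \<in> \<Lambda> \<Longrightarrow> projection (P l)" and sumP: "sum P \<Lambda> = id_blinfun"
    using P(1) by (auto simp: partition_of_unity_def)
  have PM: "P l \<in> M" if "l \<in> \<Lambda>" for l using P(2)[OF that] by (rule masa_subset)
  have trP: "0 < tr (P l)" if "l \<in> \<Lambda>" for l
    using tr_pos[OF PM positive_projection[OF Pp], OF that that]
      tr_faithful[OF PM positive_projection[OF Pp], OF that that] P(3)[OF that] by linarith
  have A_sum: "A i = (\<Sum>l\<in>\<Lambda>. l i *\<^sub>R P l)" for i
  proof -
    have "A i = A i o\<^sub>L sum P \<Lambda>" by (simp add: sumP)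
    then show ?thesis using P(4) by (simp add: sum_compose_right)
  qed

  define \<omega> where "\<omega> l X = tr (P l o\<^sub>L D X) / tr (P l)" for l X
  have \<omega>_add: "\<omega> l (X + Y) = \<omega> l X + \<omega> l Y" if "l \<in> \<Lambda>" "X \<in> M" "Y \<in> M" for l X Y
  proof -
    have "P l o\<^sub>L D (X + Y) = (P l o\<^sub>L D X) + (P l o\<^sub>L D Y)"
      using that by (intro blinfun_eqI) (simp add: D_add blinfun.bilinear_simps)
    then show ?thesis using that PM DM by (simp add: \<omega>_def tr_add add_divide_distrib)
  qed
  have \<omega>_scale: "\<omega> l (c *\<^sub>R X) = c * \<omega> l X" if "l \<in> \<Lambda>" "X \<in> M" for l X c
  proof -
    have "P l o\<^sub>L D (c *\<^sub>R X) = c *\<^sub>R (P l o\<^sub>L D X)"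
      using that by (intro blinfun_eqI) (simp add: D_scale blinfun.bilinear_simps)
    then show ?thesis using that PM DM by (simp add: \<omega>_def tr_scaleR)
  qed
  have \<omega>_diff: "\<omega> l (X - Y) = \<omega> l X - \<omega> l Y" if "l \<in> \<Lambda>" "X \<in> M" "Y \<in> M" for l X Y
    using \<omega>_add[of l X "- Y"] \<omega>_scale[of l Y "-1"] that by simp
  have \<omega>_sum: "\<omega> l (\<Sum>i\<in>I. f i) = (\<Sum>i\<in>I. \<omega> l (f i))" if "l \<in> \<Lambda>" "\<And>i. i \<in> I \<Longrightarrow> f i \<in> M" "finite I"
    for l I and f :: "bool list \<Rightarrow> 'h op"
    using that(3,2)
  proof (induction I rule: finite_induct)
    case empty
    then show ?case using \<omega>_scale[OF that(1), of 0 0] by simp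
  next
    case (insert x I)
    then show ?case using that(1) by (simp add: \<omega>_add sum_mem)
  qed
  have \<omega>_id: "\<omega> l id_blinfun = 1" if "l \<in> \<Lambda>" for l using trP[OF that] by (simp add: \<omega>_def D1)
  \<comment> \<open>\<open>P l o\<^sub>L D X\<close> need not be positive for positive
    \<open>X\<close>; by the trace property it may be replaced by its compression to
    \<open>P l\<close>, which is.\<close>
  have PDP: "tr (P l o\<^sub>L Y) = tr (P l o\<^sub>L Y o\<^sub>L P l)" if "l \<in> \<Lambda>" "Y \<in> M" for l Y
  proof -
    have "tr (P l o\<^sub>L Y o\<^sub>L P l) = tr (P l o\<^sub>L (P l o\<^sub>L Y))" using that PM by (intro tr_commute) auto
    then show ?thesis using projectionD(2)[OF Pp[OF that(1)]] by (simp flip: blinfun_compose_assoc)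
  qed
  have PYP_inner: "inner ((P l o\<^sub>L Y o\<^sub>L P l) v) v = inner (Y (P l v)) (P l v)" if "l \<in> \<Lambda>" for l Y v
    using hermitian_inner[OF projectionD(1)[OF Pp[OF that]]] by simp
  have PYP_herm: "hermitian (P l o\<^sub>L Y o\<^sub>L P l)" if "l \<in> \<Lambda>" "hermitian Y" for l Y
    using hermitian_conjugate[OF that(2), of "P l"] Pp[OF that(1)] by (simp add: projectionD)
  have \<omega>_pos: "0 \<le> \<omega> l X" if l: "l \<in> \<Lambda>" and X: "X \<in> M" "positive_op X" for l X
  proof -
    have "positive_op (D X)" using D_posm X by (simp add: positive_map_on_def)
    then have "positive_op (P l o\<^sub>L D X o\<^sub>L P l)"
      using PYP_herm[OF l] PYP_inner[OF l] by (auto simp: positive_op_iff simp del: blinfun_apply_blinfun_compose)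
    then have "0 \<le> tr (P l o\<^sub>L D X o\<^sub>L P l)" using l X PM DM by (intro tr_pos) auto
    then show ?thesis using trP[OF l] PDP[OF l DM[OF X(1)]] by (simp add: \<omega>_def)
  qed
  have \<omega>_bound: "\<bar>\<omega> l X\<bar> \<le> norm X" if l: "l \<in> \<Lambda>" and X: "X \<in> M" "hermitian X" for l X
  proof -
    have le: "\<omega> l (s *\<^sub>R X) \<le> norm X" if s: "\<bar>s\<bar> = 1" for s
    proof -
      have "tr (P l o\<^sub>L (s *\<^sub>R D X) o\<^sub>L P l) \<le> tr (norm X *\<^sub>R P l)"
      proof (rule tr_mono)
        fix v
        have "inner ((P l o\<^sub>L (s *\<^sub>R D X) o\<^sub>L P l) v) v = inner ((s *\<^sub>R D X) (P l v)) (P l v)"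
          by (rule PYP_inner[OF l])
        also have "\<dots> \<le> norm (s *\<^sub>R D X) * (norm (P l v))\<^sup>2"
          using inner_blinfun_le[of "s *\<^sub>R D X" "P l v"] by simp
        also have "\<dots> \<le> norm X * (norm (P l v))\<^sup>2"
          using D_herm(2)[OF X] s by (intro mult_right_mono) auto
        also have "\<dots> = inner ((norm X *\<^sub>R P l) v) v"
          by (simp add: blinfun.scaleR_left inner_projection[OF Pp[OF l]])
        finally show "inner ((P l o\<^sub>L (s *\<^sub>R D X) o\<^sub>L P l) v) v \<le> inner ((norm X *\<^sub>R P l) v) v" .
      qed (use l X PM DM D_herm PYP_herm[OF l] projectionD(1)[OF Pp[OF l]] in auto)
      then have "tr (P l o\<^sub>L D (s *\<^sub>R X)) \<le> norm X * tr (P l)"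
        using PDP[OF l, of "s *\<^sub>R D X"] X DM PM[OF l] by (simp add: D_scale tr_scaleR)
      then show ?thesis using trP[OF l] by (simp add: \<omega>_def pos_divide_le_eq)
    qed
    show ?thesis using le[of 1] le[of "-1"] \<omega>_scale[OF l X(1), of "-1"] by (simp add: abs_le_iff)
  qed
  have \<omega>_S: "\<omega> l (S i) = l i" if "l \<in> \<Lambda>" for l i
  proof -
    have "P l o\<^sub>L A i = l i *\<^sub>R P l" using P(4)[OF that] masa_commute[OF P(2)[OF that] A(1)] by simp
    then show ?thesis using trP[OF that] PM[OF that] by (simp add: \<omega>_def DS tr_scaleR)
  qed
  have \<omega>_tr: "(\<Sum>l\<in>\<Lambda>. \<omega> l X * tr (P l)) = tr X" if "X \<in> M" for X
  proof -
    have "(\<Sum>l\<in>\<Lambda>. \<omega> l X * tr (P l)) = (\<Sum>l\<in>\<Lambda>. tr (P l o\<^sub>L D X))"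
      using trP by (intro sum.cong) (auto simp: \<omega>_def less_le)
    also have "\<dots> = tr (sum P \<Lambda> o\<^sub>L D X)"
      unfolding sum_compose_left using PM DM[OF that] by (intro tr_sum[symmetric]) auto
    finally show ?thesis using D_tr[OF that] by (simp add: sumP)
  qed

  obtain e where e: "commuting_projections e" "\<And>n. e n \<in> M"
    "\<And>C n. C \<in> cbounded_ops \<Longrightarrow> (\<And>i. C o\<^sub>L S i = S i o\<^sub>L C) \<Longrightarrow> C o\<^sub>L e n = e n o\<^sub>L C"
    "\<And>d. 0 < d \<Longrightarrow> \<exists>m. \<forall>bs. m \<le> length bs \<longrightarrow>
        (\<exists>\<mu>. \<forall>i. norm ((S i - \<mu> i *\<^sub>R id_blinfun) o\<^sub>L cell e bs) \<le> d)"
    by (rule spectral_sequence[of S, OF S], rule that) blast+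
  interpret commuting_projections e by (rule e(1))
  have cM: "cell e bs \<in> M" for bs by (induction bs) (auto simp: e(2))
  have Sc: "S i o\<^sub>L cell e bs = cell e bs o\<^sub>L S i" for i bs
  proof (rule commute_cell)
    show "S i o\<^sub>L e n = e n o\<^sub>L S i" for n by (rule e(3)) (use S in auto)
  qed
  have "\<exists>F. F [] = P l \<and> (\<forall>bs. F bs \<in> M) \<and> (\<forall>bs. projection (F bs)) \<and>
      (\<forall>bs. F (True # bs) + F (False # bs) = F bs) \<and> (\<forall>bs. E (F bs) = \<omega> l (cell e bs) *\<^sub>R E (P l))"
    if l: "l \<in> \<Lambda>" for l
  proof -
    have 1: "0 \<le> \<omega> l (cell e bs)" for bs by (rule \<omega>_pos[OF l cM positive_projection[OF cell_proj]])
    have 2: "\<omega> l (cell e bs) = \<omega> l (cell e (True # bs)) + \<omega> l (cell e (False # bs))" for bs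
      using \<omega>_add[OF l cM cM, of "True # bs" "False # bs"] by (simp only: cell_split)
    have 3: "\<omega> l (cell e []) = 1" using \<omega>_id[OF l] by simp
    obtain F where "F [] = P l" "\<And>bs. F bs \<in> M" "\<And>bs. projection (F bs)"
        "\<And>bs. F (True # bs) + F (False # bs) = F bs" "\<And>bs. E (F bs) = \<omega> l (cell e bs) *\<^sub>R E (P l)"
      by (rule carpenter_tree[OF ker PM[OF l] Pp[OF l] 1 2 3], assumption+, rule that)
    then show ?thesis by blast
  qed
  then obtain F where F: "\<And>l. l \<in> \<Lambda> \<Longrightarrow> F l [] = P l" "\<And>l bs. l \<in> \<Lambda> \<Longrightarrow> F l bs \<in> M"
    "\<And>l bs. l \<in> \<Lambda> \<Longrightarrow> projection (F l bs)" "\<And>l bs. l \<in> \<Lambda> \<Longrightarrow> F l (True # bs) + F l (False # bs) = F l bs"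
    "\<And>l bs. l \<in> \<Lambda> \<Longrightarrow> E (F l bs) = \<omega> l (cell e bs) *\<^sub>R E (P l)"
    by metis
  have EF: "E (F l bs) = \<omega> l (cell e bs) *\<^sub>R P l" if "l \<in> \<Lambda>" for l bs
    using F(5)[OF that] E_fix[OF P(2)[OF that]] by simp
  define R where "R bs = (\<Sum>l\<in>\<Lambda>. F l bs)" for bs
  have RM: "R bs \<in> M" for bs unfolding R_def using F(2) by (rule sum_mem)
  have R_split: "R (True # bs) + R (False # bs) = R bs" for bs
    by (simp add: R_def F(4) flip: sum.distrib)
  have R_sum: "(\<Sum>bs\<in>bool_lists m. R bs) = id_blinfun" for m
  proof (induction m)
    case 0
    then show ?case using F(1) by (simp add: bool_lists_0 R_def sumP)
  next
    case (Suc m)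
    then show ?case by (simp only: sum_bool_lists_Suc R_split)
  qed
  have R_proj: "projection (R bs)" for bs
    unfolding R_def
  proof (rule projection_sum[OF fin F(3)])
    fix l l' assume ll: "l \<in> \<Lambda>" "l' \<in> \<Lambda>" "l \<noteq> l'"
    \<comment> \<open>The pieces for all \<open>l\<close> at one level are projections with sum 1,
      hence mutually orthogonal.\<close>
    let ?J = "\<Lambda> \<times> bool_lists (length bs)"
    have "(\<Sum>(l, cs)\<in>?J. F l cs) = (\<Sum>l\<in>\<Lambda>. \<Sum>cs\<in>bool_lists (length bs). F l cs)"
      by (rule sum.cartesian_product[symmetric])
    also have "\<dots> = id_blinfun" using R_sum[of "length bs"] unfolding R_def by (subst sum.swap)
    finally have "(\<Sum>(l, cs)\<in>?J. F l cs) = id_blinfun" .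
    then have "partition_of_unity ?J (\<lambda>(l, cs). F l cs)"
      using fin F(3) by (intro partition_of_unityI) auto
    then have "(\<lambda>(l, cs). F l cs) (l, bs) o\<^sub>L (\<lambda>(l, cs). F l cs) (l', bs) = 0"
      using ll unfolding partition_of_unity_def by (auto simp: bool_lists_def)
    then show "F l bs o\<^sub>L F l' bs = 0" by simp
  qed
  have ER: "E (R bs) = (\<Sum>l\<in>\<Lambda>. \<omega> l (cell e bs) *\<^sub>R P l)" for bs
    unfolding R_def using F(2) by (subst E_sum) (auto simp: EF)
  have trR: "tr (cell e bs) = tr (R bs)" for bs
  proof -
    have "tr (R bs) = tr (E (R bs))" using tr_E[OF RM] by simp
    also have "\<dots> = (\<Sum>l\<in>\<Lambda>. \<omega> l (cell e bs) * tr (P l))"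
      unfolding ER using PM by (subst tr_sum) (auto simp: tr_scaleR)
    finally show ?thesis using \<omega>_tr[OF cM] by simp
  qed
  have "\<exists>U. U \<in> M \<and> unitary U \<and> (\<forall>bs. length bs = m \<longrightarrow> U o\<^sub>L cell e bs o\<^sub>L adj U = R bs)" for m
  proof -
    have "partition_of_unity (bool_lists m) R" using R_proj R_sum by (intro partition_of_unityI) auto
    from equal_trace_unitary[OF fac this cell_partition RM cM trR]
    obtain U where "U \<in> M" "unitary U" "\<And>bs. bs \<in> bool_lists m \<Longrightarrow> U o\<^sub>L cell e bs o\<^sub>L adj U = R bs"
      by metis
    then show ?thesis unfolding bool_lists_def by blast
  qed
  then obtain U where U: "\<And>m. U m \<in> M" "\<And>m. unitary (U m)"
    "\<And>m bs. length bs = m \<Longrightarrow> U m o\<^sub>L cell e bs o\<^sub>L adj (U m) = R bs"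
    by metis
  \<comment> \<open>A unitary chosen for level \<open>m\<close> also treats the coarser cells
    correctly, as these are sums of finer ones; \<open>k\<close> counts the missing levels.\<close>
  have "U m o\<^sub>L cell e bs o\<^sub>L adj (U m) = R bs" if "length bs + k = m" for m k bs
    using that
  proof (induction k arbitrary: bs)
    case 0
    then show ?case by (intro U(3)) simp
  next
    case (Suc k)
    have *: "U m o\<^sub>L cell e (b # bs) o\<^sub>L adj (U m) = R (b # bs)" for b
      using Suc.IH[of "b # bs"] Suc.prems by simp
    have "U m o\<^sub>L cell e bs o\<^sub>L adj (U m) = U m o\<^sub>L (cell e (True # bs) + cell e (False # bs)) o\<^sub>L adj (U m)"
      by (simp only: cell_split)
    also have "\<dots> = R (True # bs) + R (False # bs)"
      unfolding *[symmetric] by (rule blinfun_eqI) (simp only: blinfun.bilinear_simps blinfun_apply_blinfun_compose)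
    finally show ?case by (simp only: R_split)
  qed
  then have U_le: "U m o\<^sub>L cell e bs o\<^sub>L adj (U m) = R bs" if "length bs \<le> m" for m bs
    using that by (metis le_add_diff_inverse)

  define d where "d j = 1 / real (Suc j)" for j
  have d0: "0 < d j" for j by (simp add: d_def)
  have d_lim: "d \<longlonglongrightarrow> 0" unfolding d_def by (rule LIMSEQ_Suc[OF lim_1_over_n])
  \<comment> \<open>The chosen levels \<open>m j\<close> need not increase with \<open>j\<close>,
    hence the maximum of two levels in \<open>TT_diff\<close>.\<close>
  have "\<exists>m \<mu>. \<forall>bs. length bs = m \<longrightarrow> (\<forall>i. norm ((S i - \<mu> bs i *\<^sub>R id_blinfun) o\<^sub>L cell e bs) \<le> d j)" for j
    using e(4)[OF d0[of j]] by (metis order_refl)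
  then obtain m \<mu> where \<mu>: "\<And>j bs i. length bs = m j \<Longrightarrow>
      norm ((S i - \<mu> j bs i *\<^sub>R id_blinfun) o\<^sub>L cell e bs) \<le> d j"
    by metis
  define SS where "SS j i = (\<Sum>bs\<in>bool_lists (m j). \<mu> j bs i *\<^sub>R cell e bs)" for j i
  define TT where "TT j i = (\<Sum>bs\<in>bool_lists (m j). \<mu> j bs i *\<^sub>R R bs)" for j i
  have SSM: "SS j i \<in> M" for j i unfolding SS_def using cM by (intro sum_mem) auto
  have SSH: "hermitian (SS j i)" for j i
    unfolding SS_def using projectionD(1)[OF cell_proj] by (intro hermitian_sum) auto
  have TTM: "TT j i \<in> M" for j i unfolding TT_def using RM by (intro sum_mem) auto
  have TTH: "hermitian (TT j i)" for j i
    unfolding TT_def using projectionD(1)[OF R_proj] by (intro hermitian_sum) auto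
  have S_SS: "norm (S i - SS j i) \<le> d j" for i j
    unfolding SS_def
    using \<mu> d0[of j] Sc by (intro partition_approximation[OF cell_partition S(2)]) (auto simp: bool_lists_def)
  have conj: "U k o\<^sub>L SS j i o\<^sub>L adj (U k) = TT j i" if "m j \<le> k" for j k i
  proof -
    have "U k o\<^sub>L SS j i o\<^sub>L adj (U k) = (\<Sum>bs\<in>bool_lists (m j). \<mu> j bs i *\<^sub>R (U k o\<^sub>L cell e bs o\<^sub>L adj (U k)))"
      by (rule blinfun_eqI) (simp add: SS_def blinfun.bilinear_simps)
    also have "\<dots> = TT j i"
      unfolding TT_def using that by (intro sum.cong refl) (simp add: U_le bool_lists_def)
    finally show ?thesis .
  qed
  have conj_diff: "U k o\<^sub>L (X - Y) o\<^sub>L adj (U k) = (U k o\<^sub>L X o\<^sub>L adj (U k)) - (U k o\<^sub>L Y o\<^sub>L adj (U k))" for k X Y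
    by (rule blinfun_eqI) (simp add: blinfun.bilinear_simps)
  \<comment> \<open>The finer of the two levels provides one unitary that conjugates both step
    functions, so their distance is controlled by that of \<open>SS j\<close> and
    \<open>SS k\<close>, which are both close to \<open>S\<close>.\<close>
  have TT_diff: "norm (TT j i - TT k i) \<le> d j + d k" for i j k
  proof -
    let ?n = "max (m j) (m k)"
    have "TT j i - TT k i = U ?n o\<^sub>L (SS j i - SS k i) o\<^sub>L adj (U ?n)" by (simp add: conj_diff conj)
    then have "norm (TT j i - TT k i) \<le> norm (SS j i - SS k i)" using norm_conjugate_le[OF U(2)] by simp
    also have "\<dots> = norm ((S i - SS k i) - (S i - SS j i))" by simp
    also have "\<dots> \<le> norm (S i - SS k i) + norm (S i - SS j i)" by (rule norm_triangle_ineq4)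
    finally show ?thesis using S_SS[of i k] S_SS[of i j] by linarith
  qed
  have "Cauchy (\<lambda>j. TT j i)" for i
  proof (rule CauchyI)
    fix r :: real assume "0 < r"
    then obtain N where N: "\<And>n. n \<ge> N \<Longrightarrow> norm (d n - 0) < r / 2"
      using LIMSEQ_D[OF d_lim, of "r / 2"] by auto
    have "norm (TT j i - TT k i) < r" if "j \<ge> N" "k \<ge> N" for j k
      using TT_diff[of j i k] N[OF that(1)] N[OF that(2)] by (simp add: abs_if split: if_splits)
    then show "\<exists>M. \<forall>m\<ge>M. \<forall>n\<ge>M. norm (TT m i - TT n i) < r" by blast
  qed
  then have "\<forall>i. \<exists>T. (\<lambda>j. TT j i) \<longlonglongrightarrow> T" using Cauchy_convergent convergent_def by blast
  then obtain T where T: "\<And>i. (\<lambda>j. TT j i) \<longlonglongrightarrow> T i" by metis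
  have Tv: "(\<lambda>j. TT j i v) \<longlonglongrightarrow> T i v" for i v by (intro tendsto_intros T)
  have TM: "T i \<in> M" for i by (rule sot_limit_mem[OF TTM Tv])
  have TH: "hermitian (T i)" for i by (rule sot_limit_hermitian[OF TTH Tv])
  have T_TT: "norm (T i - TT j i) \<le> d j" for i j
  proof (rule LIMSEQ_le)
    show "(\<lambda>k. norm (TT k i - TT j i)) \<longlonglongrightarrow> norm (T i - TT j i)" by (intro tendsto_intros T)
    show "(\<lambda>k. d k + d j) \<longlonglongrightarrow> d j" using tendsto_add[OF d_lim tendsto_const[of "d j"]] by simp
  qed (use TT_diff in blast)
  have "T \<in> unitary_orbit_closure M S"
    unfolding unitary_orbit_closure_def
  proof (intro CollectI allI impI)
    fix \<epsilon> :: real assume "0 < \<epsilon>"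
    then obtain j where "norm (d j - 0) < \<epsilon> / 2" using LIMSEQ_D[OF d_lim, of "\<epsilon> / 2"] by auto
    then have dj: "d j + d j < \<epsilon>" by (simp add: abs_if split: if_splits)
    \<comment> \<open>\<open>?U\<close> carries \<open>SS j i\<close> exactly to
      \<open>TT j i\<close>. One \<open>d j\<close> accounts for \<open>T i\<close> against
      \<open>TT j i\<close>, the other for \<open>S i\<close> against \<open>SS j i\<close>.\<close>
    let ?U = "U (m j)"
    have "norm (T i - (?U o\<^sub>L S i o\<^sub>L adj ?U)) < \<epsilon>" for i
    proof -
      have "T i - (?U o\<^sub>L S i o\<^sub>L adj ?U) = (T i - TT j i) - (?U o\<^sub>L (S i - SS j i) o\<^sub>L adj ?U)"
        by (simp add: conj_diff conj)
      then have "norm (T i - (?U o\<^sub>L S i o\<^sub>L adj ?U))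
          \<le> norm (T i - TT j i) + norm (?U o\<^sub>L (S i - SS j i) o\<^sub>L adj ?U)"
        by (simp only: norm_triangle_ineq4)
      also have "\<dots> \<le> d j + norm (S i - SS j i)" by (intro add_mono T_TT norm_conjugate_le U)
      finally show ?thesis using S_SS[of i j] dj by linarith
    qed
    then have "tuple_norm (\<lambda>i. T i - (?U o\<^sub>L S i o\<^sub>L adj ?U)) < \<epsilon>"
      unfolding tuple_norm_def by (subst Max_less_iff) auto
    then show "\<exists>R\<in>unitary_orbit M S. tuple_norm (\<lambda>i. T i - R i) < \<epsilon>"
      using U by (auto simp: unitary_orbit_def intro!: exI[of _ ?U])
  qed
  \<comment> \<open>Both sides are limits of \<open>E (TT j i)\<close>: one by contractivity of
    \<open>E\<close> on hermitian operators, the other by that of the functionals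
    \<open>\<omega> l\<close> together with \<open>\<omega> l (S i) = l i\<close>.\<close>
  moreover have "E (T i) = A i" for i
  proof (rule LIMSEQ_unique)
    have E_TT: "E (TT j i) = (\<Sum>l\<in>\<Lambda>. \<omega> l (SS j i) *\<^sub>R P l)" for j
    proof -
      have "E (TT j i) = (\<Sum>bs\<in>bool_lists (m j). \<mu> j bs i *\<^sub>R (\<Sum>l\<in>\<Lambda>. \<omega> l (cell e bs) *\<^sub>R P l))"
        unfolding TT_def using RM by (subst E_sum) (auto simp: E_scaleR ER)
      also have "\<dots> = (\<Sum>l\<in>\<Lambda>. \<Sum>bs\<in>bool_lists (m j). (\<mu> j bs i * \<omega> l (cell e bs)) *\<^sub>R P l)"
        by (simp add: scaleR_sum_right) (rule sum.swap)
      also have "\<dots> = (\<Sum>l\<in>\<Lambda>. \<omega> l (SS j i) *\<^sub>R P l)"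
      proof (rule sum.cong[OF refl])
        fix l assume l: "l \<in> \<Lambda>"
        have "\<omega> l (SS j i) = (\<Sum>bs\<in>bool_lists (m j). \<mu> j bs i * \<omega> l (cell e bs))"
          unfolding SS_def using l cM by (subst \<omega>_sum) (auto simp: \<omega>_scale)
        then show "(\<Sum>bs\<in>bool_lists (m j). (\<mu> j bs i * \<omega> l (cell e bs)) *\<^sub>R P l) = \<omega> l (SS j i) *\<^sub>R P l"
          by (simp add: scaleR_sum_left)
      qed
      finally show ?thesis .
    qed
    have "norm (E (TT j i) - E (T i)) \<le> d j" for j
    proof -
      have "E (TT j i) - E (T i) = E (TT j i - T i)" using TTM TM by (simp add: E_diff)
      also have "norm \<dots> \<le> norm (TT j i - T i)" using TTM TM TTH TH by (intro norm_E_le) auto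
      finally show ?thesis using T_TT[of i j] by (simp add: norm_minus_commute)
    qed
    then show "(\<lambda>j. E (TT j i)) \<longlonglongrightarrow> E (T i)"
      by (intro LIM_zero_cancel[OF Lim_null_comparison[OF _ d_lim]]) simp
    have "(\<lambda>j. \<omega> l (SS j i)) \<longlonglongrightarrow> l i" if l: "l \<in> \<Lambda>" for l
    proof -
      have "norm (\<omega> l (SS j i) - l i) \<le> d j" for j
      proof -
        have "\<omega> l (SS j i) - l i = \<omega> l (SS j i - S i)" using l SSM S by (simp add: \<omega>_diff \<omega>_S)
        then show ?thesis
          using \<omega>_bound[OF l, of "SS j i - S i"] S_SS[of i j] SSM SSH S by (simp add: norm_minus_commute)
      qed
      then show ?thesis by (intro LIM_zero_cancel[OF Lim_null_comparison[OF _ d_lim]]) simp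
    qed
    then show "(\<lambda>j. E (TT j i)) \<longlonglongrightarrow> A i"
      unfolding E_TT A_sum by (intro tendsto_sum tendsto_scaleR tendsto_const)
  qed
  ultimately show ?thesis by blast
qed

theorem proposition29:
  fixes M \<A> :: "'h::complex_hilbert op set"
    and \<tau> :: "'h op \<Rightarrow> complex"
    and E :: "'h op \<Rightarrow> 'h op"
    and A S :: "'n::finite \<Rightarrow> 'h op"
  assumes "type_II1_factor M"
    and "is_trace M \<tau>"
    and "masa M \<A>"
    and "conditional_expectation M \<A> E" and "trace_preserving M \<tau> E"
    and "\<And>P. P \<in> M \<Longrightarrow> projection P \<Longrightarrow> P \<noteq> 0 \<Longrightarrow> {X \<in> corner M P. E X = 0} \<noteq> {0}"
    and "\<And>i. A i \<in> \<A>" and "\<And>i. hermitian (A i)"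
    and "finite (joint_spectrum A)"
    and "\<And>i. S i \<in> M" and "\<And>i. hermitian (S i)"
    and "\<And>i j. S i o\<^sub>L S j = S j o\<^sub>L S i"
    and "majorized_by M \<tau> A S"
  shows "\<exists>T \<in> unitary_orbit_closure M S. \<forall>i. E (T i) = A i"
proof -
  have fac: "factor M" using assms(1) by (simp add: type_II1_factor_def)
  interpret masa_expectation M \<tau> \<A> E
    using fac assms(2-5) by unfold_locales (auto simp: factor_def)
  show ?thesis by (rule schur_horn[OF fac assms(6-13)])
qed

end
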